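(* Let $v,z,u$ be positive integers and let $s\ge 0$. Inside the brackets below, $a^k$ denotes the sequence $a,a,\dots,a$ with $k$ terms, and juxtaposition denotes concatenation of sequences. Then the following two families of $\mathrm{SL}(2,\mathbb{C})$-isomorphisms hold. (I) The following six modules are all isomorphic as $\mathrm{SL}(2,\mathbb{C})$-modules: $$\langle z^s v^{s+1}\,\|\,z^{s+1}uv^s\rangle\simeq\langle z^s u v^s\,\|\,z^{s+1}v^{s+1}\rangle\simeq\langle z^{s+1}v^s\,\|\,z^s u v^{s+1}\rangle$$ $$\simeq\langle v^s z^{s+1}\,\|\,v^{s+1}uz^s\rangle\simeq\langle v^s u z^s\,\|\,v^{s+1}z^{s+1}\rangle\simeq\langle v^{s+1}z^s\,\|\,v^s u z^{s+1}\rangle.$$ (II) The following six modules are all isomorphic as $\mathrm{SL}(2,\mathbb{C})$-modules: $$\langle z^s u v^{s+1}\,\|\,z^{s+2}v^{s+1}\rangle\simeq\langle z^{s+1}v^{s+1}\,\|\,z^{s+1}uv^{s+1}\rangle\simeq\langle z^{s+1}uv^s\,\|\,z^{s+1}v^{s+2}\rangle$$ $$\simeq\langle v^s u z^{s+1}\,\|\,v^{s+2}z^{s+1}\rangle\simeq\langle v^{s+1}z^{s+1}\,\|\,v^{s+1}uz^{s+1}\rangle\simeq\langle v^{s+1}uz^s\,\|\,v^{s+1}z^{s+2}\rangle.$$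
   Context: For a partition $\lambda$, $\mathbb{S}_\lambda$ denotes the Schur functor on complex vector spaces (image of $V^{\otimes|\lambda|}$ under the Young symmetrizer of $\lambda$), so that $\mathbb{S}_{(n)}(V)\simeq\mathrm{Sym}^n(V)$, $\mathbb{S}_{(1^n)}(V)\simeq\Lambda^n(V)$. Given positive integers $h_1,\dots,h_r$ and $v_1,\dots,v_{r+1}$, the notation $\langle h_1,\dots,h_r\,\|\,v_1,\dots,v_r,v_{r+1}\rangle$ means the $\mathrm{SL}(2,\mathbb{C})$-module $\mathbb{S}_\lambda(\mathbb{S}_{(w)}(\mathbb{C}^2))$, where $w=v_1+\cdots+v_{r+1}-1$ and $$\lambda=\big((h_1+\cdots+h_r)^{v_1},(h_1+\cdots+h_{r-1})^{v_2},\dots,(h_1+h_2)^{v_{r-1}},h_1^{v_r}\big),$$ where in this definition of $\lambda$ exponents denote multiplicities of parts. (For example, $\langle z^s v^{s+1}\,\|\,z^{s+1}uv^s\rangle$ has $r=2s+1$, $(h_1,\dots,h_r)$ equal to $s$ copies of $z$ followed by $s+1$ copies of $v$, and $(v_1,\dots,v_{r+1})$ equal to $s+1$ copies of $z$, then $u$, then $s$ copies of $v$.) *)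

theory Defs
  imports "HOL-Analysis.Analysis" "HOL-Combinatorics.Permutations" "HOL-Library.Function_Algebras"
begin

text \<open>
  Vector spaces occur as subspaces \<open>V\<close> of the space of finitely supported functions
  \<open>'a \<Rightarrow> complex\<close> on an index type. This class is closed under tensor powers: the pure tensor
  of \<open>v\<^sub>1, \<dots>, v\<^sub>n\<close> is the function \<open>[x\<^sub>1, \<dots>, x\<^sub>n] \<mapsto> v\<^sub>1 x\<^sub>1 \<cdots> v\<^sub>n x\<^sub>n\<close> on lists, and the span of the
  pure tensors with entries in \<open>V\<close> is the \<open>n\<close>-th tensor power of \<open>V\<close>.
\<close>

definition cscale :: "complex \<Rightarrow> ('a \<Rightarrow> complex) \<Rightarrow> 'a \<Rightarrow> complex" where
  "cscale c f = (\<lambda>x. c * f x)"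

global_interpretation cfun: vector_space cscale
  by unfold_locales (auto simp: cscale_def fun_eq_iff algebra_simps)

definition pure_tensor :: "('a \<Rightarrow> complex) list \<Rightarrow> 'a list \<Rightarrow> complex" where
  "pure_tensor vs xs =
     (if length xs = length vs then \<Prod>i<length vs. (vs ! i) (xs ! i) else 0)"

definition tensor_power :: "nat \<Rightarrow> ('a \<Rightarrow> complex) set \<Rightarrow> ('a list \<Rightarrow> complex) set" where
  "tensor_power n V = cfun.span {pure_tensor vs | vs. length vs = n \<and> set vs \<subseteq> V}"

definition unit_fun :: "'a \<Rightarrow> 'a \<Rightarrow> complex" where
  "unit_fun y = (\<lambda>x. if x = y then 1 else 0)"

text \<open>
  The tensor power of a linear map \<open>f\<close>, defined by linear extension from the tensors of standard
  unit vectors. For finitely supported arguments and linear \<open>f\<close> this is the map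
  \<open>v\<^sub>1 \<otimes> \<cdots> \<otimes> v\<^sub>n \<mapsto> f v\<^sub>1 \<otimes> \<cdots> \<otimes> f v\<^sub>n\<close>, see \<open>tensor_map_pure_tensor\<close>.
\<close>

definition tensor_map ::
    "(('a \<Rightarrow> complex) \<Rightarrow> 'b \<Rightarrow> complex) \<Rightarrow> ('a list \<Rightarrow> complex) \<Rightarrow> 'b list \<Rightarrow> complex" where
  "tensor_map f T =
     (\<Sum>ys | T ys \<noteq> 0. cscale (T ys) (pure_tensor (map (\<lambda>y. f (unit_fun y)) ys)))"

text \<open>
  The right action of the symmetric group,
  \<open>(v\<^sub>0 \<otimes> \<cdots> \<otimes> v\<^bsub>n-1\<^esub>) \<cdot> \<sigma> = v\<^bsub>\<sigma> 0\<^esub> \<otimes> \<cdots> \<otimes> v\<^bsub>\<sigma> (n-1)\<^esub>\<close>, see \<open>permute_tensor_pure_tensor\<close>; the inverse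
  appears because a permutation of the factors is expressed here on the arguments.
\<close>

definition permute_tensor ::
    "(nat \<Rightarrow> nat) \<Rightarrow> ('a list \<Rightarrow> complex) \<Rightarrow> 'a list \<Rightarrow> complex" where
  "permute_tensor \<sigma> T = (\<lambda>xs. T (permute_list (inv \<sigma>) xs))"

text \<open>
  A partition is the list of its parts in weakly decreasing order. The list of the boxes
  \<open>(row, column)\<close> of its Young diagram, read row by row, represents the canonical tableau:
  its \<open>k\<close>-th element is the box containing \<open>k\<close>, for \<open>0 \<le> k < |\<mu>|\<close>.
\<close>

definition boxes :: "nat list \<Rightarrow> (nat \<times> nat) list" where
  "boxes \<mu> = concat (map (\<lambda>i. map (\<lambda>j. (i, j)) [0..<\<mu> ! i]) [0..<length \<mu>])"

definition row_group :: "nat list \<Rightarrow> (nat \<Rightarrow> nat) set" where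
  "row_group \<mu> =
     {p. p permutes {..<sum_list \<mu>} \<and> (\<forall>k<sum_list \<mu>. fst (boxes \<mu> ! p k) = fst (boxes \<mu> ! k))}"

definition column_group :: "nat list \<Rightarrow> (nat \<Rightarrow> nat) set" where
  "column_group \<mu> =
     {q. q permutes {..<sum_list \<mu>} \<and> (\<forall>k<sum_list \<mu>. snd (boxes \<mu> ! q k) = snd (boxes \<mu> ! k))}"

definition young_symmetrizer :: "nat list \<Rightarrow> ('a list \<Rightarrow> complex) \<Rightarrow> 'a list \<Rightarrow> complex" where
  "young_symmetrizer \<mu> T =
     (\<Sum>p\<in>row_group \<mu>. \<Sum>q\<in>column_group \<mu>. cscale (of_int (sign q)) (permute_tensor (p \<circ> q) T))"

definition schur_space :: "nat list \<Rightarrow> ('a \<Rightarrow> complex) set \<Rightarrow> ('a list \<Rightarrow> complex) set" where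
  "schur_space \<mu> V = young_symmetrizer \<mu> ` tensor_power (sum_list \<mu>) V"

definition SL2 :: "(complex ^ 2 ^ 2) set" where
  "SL2 = {A. det A = 1}"

text \<open>
  The maps \<open>act M A\<close> are given on the ambient space of all finitely supported functions; only
  their restrictions to \<open>vecs M\<close>, for \<open>A \<in> SL2\<close>, belong to the module.
\<close>

record 'a sl2_module =
  vecs :: "('a \<Rightarrow> complex) set"
  act :: "complex ^ 2 ^ 2 \<Rightarrow> ('a \<Rightarrow> complex) \<Rightarrow> 'a \<Rightarrow> complex"

definition standard_module :: "2 sl2_module" where
  "standard_module = \<lparr>vecs = UNIV, act = (\<lambda>A f. vec_nth (A *v vec_lambda f))\<rparr>"

definition schur_module :: "nat list \<Rightarrow> 'a sl2_module \<Rightarrow> 'a list sl2_module" where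
  "schur_module \<mu> M = \<lparr>vecs = schur_space \<mu> (vecs M), act = (\<lambda>A. tensor_map (act M A))\<rparr>"

definition sl2_iso :: "'a sl2_module \<Rightarrow> 'b sl2_module \<Rightarrow> bool"  (infix "\<simeq>\<^sub>S\<^sub>L" 50) where
  "M \<simeq>\<^sub>S\<^sub>L N \<longleftrightarrow>
     (\<exists>\<phi>. bij_betw \<phi> (vecs M) (vecs N) \<and>
          (\<forall>x\<in>vecs M. \<forall>y\<in>vecs M. \<phi> (x + y) = \<phi> x + \<phi> y) \<and>
          (\<forall>c. \<forall>x\<in>vecs M. \<phi> (cscale c x) = cscale c (\<phi> x)) \<and>
          (\<forall>A\<in>SL2. \<forall>x\<in>vecs M. \<phi> (act M A x) = act N A (\<phi> x)))"

definition all_isomorphic :: "'a sl2_module list \<Rightarrow> bool" where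
  "all_isomorphic Ms \<longleftrightarrow> (\<forall>M\<in>set Ms. \<forall>N\<in>set Ms. M \<simeq>\<^sub>S\<^sub>L N)"

text \<open>The part \<open>h\<^sub>1 + \<cdots> + h\<^bsub>r-i\<^esub>\<close> occurs \<open>v\<^bsub>i+1\<^esub>\<close> times, for \<open>0 \<le> i < r\<close>.\<close>

definition bracket_partition :: "nat list \<Rightarrow> nat list \<Rightarrow> nat list" where
  "bracket_partition h v =
     concat (map (\<lambda>i. replicate (v ! i) (sum_list (take (length h - i) h))) [0..<length h])"

text \<open>The lists are meant to have positive entries and to satisfy \<open>length v = length h + 1\<close>.\<close>

definition bracket :: "nat list \<Rightarrow> nat list \<Rightarrow> 2 list list sl2_module"  ("\<langle>_ \<parallel> _\<rangle>") where
  "\<langle>h \<parallel> v\<rangle> =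
     schur_module (bracket_partition h v) (schur_module [sum_list v - 1] standard_module)"

abbreviation repeated :: "'a \<Rightarrow> nat \<Rightarrow> 'a list"  (infix "\<up>" 80) where
  "a \<up> k \<equiv> replicate k a"

lemma permute_tensor_pure_tensor:
  assumes "\<sigma> permutes {..<length vs}"
  shows "permute_tensor \<sigma> (pure_tensor vs) = pure_tensor (permute_list \<sigma> vs)"
proof
  fix xs :: "'a list"
  have inv: "inv \<sigma> permutes {..<length vs}"
    using assms by (rule permutes_inv)
  show "permute_tensor \<sigma> (pure_tensor vs) xs = pure_tensor (permute_list \<sigma> vs) xs"
  proof (cases "length xs = length vs")
    case True
    have "(\<Prod>i<length vs. (vs ! i) (xs ! inv \<sigma> i)) = (\<Prod>i<length vs. (vs ! \<sigma> i) (xs ! i))"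
      by (subst prod.permute[OF assms]) (simp add: permutes_inverses[OF assms] o_def)
    with True assms inv show ?thesis
      by (simp add: permute_tensor_def pure_tensor_def permute_list_nth)
  qed (simp add: permute_tensor_def pure_tensor_def)
qed

lemma pure_tensor_Nil: "pure_tensor [] xs = (if xs = [] then 1 else 0)"
  by (simp add: pure_tensor_def)

lemma pure_tensor_Cons_Nil: "pure_tensor (v # vs) [] = 0"
  by (simp add: pure_tensor_def)

lemma pure_tensor_Cons_Cons: "pure_tensor (v # vs) (x # xs) = v x * pure_tensor vs xs"
  by (simp add: pure_tensor_def prod.lessThan_Suc_shift del: prod.lessThan_Suc)

lemma tensor_map_apply:
  "tensor_map f T xs = (\<Sum>ys | T ys \<noteq> 0. T ys * pure_tensor (map (\<lambda>y. f (unit_fun y)) ys) xs)"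
proof -
  have "(\<Sum>a\<in>S. g a) x = (\<Sum>a\<in>S. g a x)" for S and g :: "'c \<Rightarrow> 'b list \<Rightarrow> complex" and x
    by (induction S rule: infinite_finite_induct) auto
  then show ?thesis
    by (simp add: tensor_map_def cscale_def)
qed

lemma support_pure_tensor_Cons:
  "{ys. pure_tensor (v # vs) ys \<noteq> 0} =
     (\<lambda>(y, ys). y # ys) ` ({y. v y \<noteq> 0} \<times> {ys. pure_tensor vs ys \<noteq> 0})" (is "?L = ?R")
proof
  show "?L \<subseteq> ?R"
  proof
    fix ys assume "ys \<in> ?L"
    then show "ys \<in> ?R"
      by (cases ys) (auto simp: pure_tensor_Cons_Nil pure_tensor_Cons_Cons)
  qed
qed (auto simp: pure_tensor_Cons_Cons)

lemma tensor_map_pure_tensor: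
  assumes linear: "\<And>v. v \<in> set vs \<Longrightarrow> f v = (\<lambda>x. \<Sum>y | v y \<noteq> 0. v y * f (unit_fun y) x)"
  shows "tensor_map f (pure_tensor vs) = pure_tensor (map f vs)"
proof
  fix xs
  show "tensor_map f (pure_tensor vs) xs = pure_tensor (map f vs) xs"
    using linear
  proof (induction vs arbitrary: xs)
    case Nil
    show ?case
      by (simp add: tensor_map_apply pure_tensor_Nil)
  next
    case (Cons v vs)
    have "tensor_map f (pure_tensor (v # vs)) xs =
        (\<Sum>(y, ys) \<in> {y. v y \<noteq> 0} \<times> {ys. pure_tensor vs ys \<noteq> 0}.
           v y * pure_tensor vs ys *
           pure_tensor (f (unit_fun y) # map (\<lambda>y. f (unit_fun y)) ys) xs)"
      unfolding tensor_map_apply support_pure_tensor_Cons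
      by (subst sum.reindex) (auto simp: inj_on_def pure_tensor_Cons_Cons intro!: sum.cong)
    also have "\<dots> = pure_tensor (map f (v # vs)) xs"
    proof (cases xs)
      case (Cons x xs')
      have "(\<Sum>(y, ys) \<in> {y. v y \<noteq> 0} \<times> {ys. pure_tensor vs ys \<noteq> 0}.
           v y * pure_tensor vs ys *
           pure_tensor (f (unit_fun y) # map (\<lambda>y. f (unit_fun y)) ys) xs) =
         (\<Sum>y | v y \<noteq> 0. v y * f (unit_fun y) x) * tensor_map f (pure_tensor vs) xs'"
        unfolding tensor_map_apply Cons
        by (simp add: sum_product sum.cartesian_product pure_tensor_Cons_Cons mult_ac)
      also have "(\<Sum>y | v y \<noteq> 0. v y * f (unit_fun y) x) = f v x"
        by (subst Cons.prems[of v]) simp_all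
      finally show ?thesis
        using Cons Cons.IH[of xs'] Cons.prems by (simp add: pure_tensor_Cons_Cons)
    qed (simp add: pure_tensor_Cons_Nil case_prod_beta)
    finally show ?case .
  qed
qed

text \<open>The next two lemmas provide the premise of \<open>tensor_map_pure_tensor\<close> for the maps in a bracket.\<close>

lemma tensor_map_linear:
  "tensor_map f T = (\<lambda>xs. \<Sum>ys | T ys \<noteq> 0. T ys * tensor_map f (unit_fun ys) xs)"
proof -
  have "{zs. unit_fun ys zs \<noteq> 0} = {ys}" for ys :: "'a list"
    by (auto simp: unit_fun_def)
  then have "tensor_map f (unit_fun ys) = pure_tensor (map (\<lambda>y. f (unit_fun y)) ys)" for ys
    by (simp add: fun_eq_iff tensor_map_apply) (simp add: unit_fun_def)
  then show ?thesis
    by (simp add: fun_eq_iff tensor_map_apply)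
qed

lemma act_standard_module_linear:
  "act standard_module A v =
     (\<lambda>x. \<Sum>y | v y \<noteq> 0. v y * act standard_module A (unit_fun y) x)"
proof -
  have "(\<Sum>j\<in>UNIV. A $ x $ j * v j) = (\<Sum>y | v y \<noteq> 0. v y * A $ x $ y)" for x
    by (rule sum.mono_neutral_cong_right) auto
  then show ?thesis
    by (simp add: fun_eq_iff standard_module_def matrix_vector_mult_def unit_fun_def
        if_distrib cong: if_cong)
qed

end

theory Submission
  imports Defs "Jordan_Normal_Form.Determinant" "HOL-Computational_Algebra.Polynomial"
begin

text \<open>
  The modules are semisimple because \<open>SL2\<close> is closed under adjoints, so they are determined by their
  weight multiplicities. The Garnir relations and a triangularity argument give a basis of
  \<open>schur_space \<lambda> V\<close> indexed by semistandard tableaux, so for \<open>V\<close> the symmetric power of dimension \<open>n\<close>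
  the character is the principal specialisation of a Schur function, which equals
  \<open>\<Prod>\<^sub>i\<^sub><\<^sub>j [l\<^sub>i - l\<^sub>j] / [j - i]\<close> with \<open>l\<^sub>i = \<lambda>\<^sub>i + n - i\<close> and \<open>[d] = q\<^sup>d - q\<^sup>-\<^sup>d\<close>.

  For a bracket, the numbers \<open>l\<^sub>i\<close> form blocks of consecutive integers whose lengths and gaps are
  the letters of the word \<open>v\<^sub>1, h\<^sub>r, v\<^sub>2, h\<^sub>r\<^sub>-\<^sub>1, \<dots>, h\<^sub>1, v\<^sub>r\<^sub>+\<^sub>1\<close>. With \<open>H k = \<Prod>\<^sub>i\<^sub><\<^sub>j\<^sub><\<^sub>k [j - i]\<close>, the product
  above is the alternating product of \<open>H (sum of I)\<close> over all intervals \<open>I\<close> of this word, divided by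
  \<open>H n\<close>, where \<open>n\<close> is the sum of the letters in the even positions \<open>0, 2, \<dots>\<close>. The words of each
  family arise from one alternating word in \<open>z\<close> and \<open>v\<close> by inserting \<open>u\<close> at or next to the middle and by
  reversal, and all of them give the same alternating product.
\<close>

section \<open>Principal specialisations of Schur functions\<close>

text \<open>The members of a family differ in the partition, in its size and in the dimension
  \<open>n\<close>, so they are compared through one object that carries all three, the word.
  Logarithms turn the alternating product into an alternating sum, and its equality is proved with
  an arbitrary function in place of the logarithm of \<open>H\<close>: it is a cancellation of
  intervals. If \<open>u\<close> is exchanged with a neighbour \<open>x\<close>, only the intervals
  containing exactly one of the two change. Those on the left cancel against those on the right,
  because an alternating word reads the same away from the middle in both directions. One longest
  interval is left over and cancels against the change of \<open>H n\<close>. The logarithms require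
  a real \<open>q > 1\<close>; such values determine a Laurent polynomial.

  Equal weights give an isomorphism for the following reason. By the Gauss decomposition, the weight
  of a highest weight vector determines its matrix coefficient up to scaling, hence the cyclic
  module that it generates up to isomorphism. Orthogonal complements then permit an induction on the
  dimension.\<close>

definition vandermonde :: "nat \<Rightarrow> (nat \<Rightarrow> 'a::comm_ring_1) \<Rightarrow> 'a" where
  "vandermonde n y = (\<Prod>j<n. \<Prod>i<j. y i - y j)"

abbreviation power_mat :: "nat \<Rightarrow> (nat \<Rightarrow> 'a::comm_ring_1) \<Rightarrow> 'a mat" where
  "power_mat n y \<equiv> mat n n (\<lambda>(i, j). y i ^ (n - 1 - j))"

text \<open>Right multiplication by \<open>U\<close> subtracts \<open>y n\<close> times each column
  from its left neighbour. This clears the last row up to a final 1 and leaves the factor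
  \<open>y i - y n\<close> in every other row, so that the determinant drops to size
  \<open>n\<close>.\<close>

lemma det_power_mat:
  fixes y :: "nat \<Rightarrow> 'a::idom"
  shows "Determinant.det (power_mat n y) = vandermonde n y"
proof (induction n)
  case 0
  show ?case
    by (simp add: vandermonde_def)
next
  case (Suc n)
  define U where "U = mat (Suc n) (Suc n) (\<lambda>(i, j). if i = j then 1 else if i = Suc j then - y n else 0)"
  define B where "B = mat n n (\<lambda>(i, j). (y i - y n) * y i ^ (n - 1 - j))"
  have "Determinant.det U = 1"
    by (subst det_lower_triangular[of "Suc n"])
      (auto simp: U_def prod_list_diag_prod)
  have eq: "power_mat (Suc n) y * U =
      four_block_mat B (mat n 1 (\<lambda>_. 1)) (0\<^sub>m 1 n) (1\<^sub>m 1)"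
  proof (rule eq_matI)
    fix i j
    assume "i < dim_row (four_block_mat B (mat n 1 (\<lambda>_. 1)) (0\<^sub>m 1 n) (1\<^sub>m 1))"
      and "j < dim_col (four_block_mat B (mat n 1 (\<lambda>_. 1)) (0\<^sub>m 1 n) (1\<^sub>m 1))"
    then have ij: "i \<le> n" "j \<le> n"
      by (auto simp: B_def)
    have "(power_mat (Suc n) y * U) $$ (i, j) =
        (\<Sum>k\<in>{0..<Suc n}. y i ^ (n - k) * (if k = j then 1 else if k = Suc j then - y n else 0))"
      using ij by (simp add: U_def scalar_prod_def)
    also have "\<dots> = (\<Sum>k\<in>{j, Suc j} \<inter> {0..<Suc n}.
        y i ^ (n - k) * (if k = j then 1 else if k = Suc j then - y n else 0))"
      by (rule sum.mono_neutral_right) auto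
    also have "\<dots> = (if j < n then (y i - y n) * y i ^ (n - 1 - j) else 1)"
    proof (cases "j < n")
      case True
      then have "{j, Suc j} \<inter> {0..<Suc n} = {j, Suc j}" "n - j = Suc (n - 1 - j)"
        by auto
      then show ?thesis
        using True by (simp add: algebra_simps)
    next
      case False
      then have "{j, Suc j} \<inter> {0..<Suc n} = {j}"
        using ij by auto
      then show ?thesis
        using False ij by simp
    qed
    also have "\<dots> = four_block_mat B (mat n 1 (\<lambda>_. 1)) (0\<^sub>m 1 n) (1\<^sub>m 1) $$ (i, j)"
      using ij by (auto simp: B_def)
    finally show "(power_mat (Suc n) y * U) $$ (i, j) =
        four_block_mat B (mat n 1 (\<lambda>_. 1)) (0\<^sub>m 1 n) (1\<^sub>m 1) $$ (i, j)" .
  qed (simp_all add: B_def U_def)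
  have "Determinant.det (power_mat (Suc n) y) = Determinant.det (power_mat (Suc n) y * U)"
    using \<open>Determinant.det U = 1\<close> by (subst det_mult[of _ "Suc n"]) (simp_all add: U_def)
  also have "\<dots> = Determinant.det B"
    unfolding eq by (subst det_four_block_mat_lower_left_zero[of _ n _ 1]) (auto simp: B_def)
  also have "\<dots> = (\<Prod>i<n. y i - y n) * Determinant.det (power_mat n y)"
    unfolding B_def
    by (subst (1 2) det_def'[of _ n])
      (auto simp: prod.distrib sum_distrib_left atLeast0LessThan permutes_in_image mult_ac
        intro!: sum.cong prod.cong)
  also have "\<dots> = vandermonde (Suc n) y"
    unfolding Suc.IH by (simp add: vandermonde_def mult.commute)
  finally show ?case .
qed

text \<open>Left multiplication by \<open>L\<close> subtracts from each row the next one and clears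
  the last column up to a final 1. Differences of powers in this form arise when geometric series
  are summed entry by entry.\<close>

lemma det_power_mat_differences:
  fixes y :: "nat \<Rightarrow> 'a::idom"
  shows "Determinant.det (mat n n (\<lambda>(i, j). y i ^ (n - j) - y (Suc i) ^ (n - j))) = vandermonde (Suc n) y"
proof -
  define L :: "'a mat" where
    "L = mat (Suc n) (Suc n) (\<lambda>(i, j). if i = j then 1 else if j = Suc i then - 1 else 0)"
  define B where "B = mat n n (\<lambda>(i, j). y i ^ (n - j) - y (Suc i) ^ (n - j))"
  define R where "R = mat 1 n (\<lambda>(i, j). y n ^ (n - j))"
  have "Determinant.det L = 1"
    by (subst det_upper_triangular[of _ "Suc n"])
      (auto simp: L_def prod_list_diag_prod upper_triangular_def)
  have eq: "L * power_mat (Suc n) y = four_block_mat B (0\<^sub>m n 1) R (1\<^sub>m 1)"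
  proof (rule eq_matI)
    fix i j
    assume "i < dim_row (four_block_mat B (0\<^sub>m n 1) R (1\<^sub>m 1))"
      and "j < dim_col (four_block_mat B (0\<^sub>m n 1) R (1\<^sub>m 1))"
    then have ij: "i \<le> n" "j \<le> n"
      by (auto simp: B_def R_def)
    have "(L * power_mat (Suc n) y) $$ (i, j) =
        (\<Sum>k\<in>{0..<Suc n}. (if i = k then 1 else if k = Suc i then - 1 else 0) * y k ^ (n - j))"
      using ij by (simp add: L_def scalar_prod_def)
    also have "\<dots> = (\<Sum>k\<in>{i, Suc i} \<inter> {0..<Suc n}.
        (if i = k then 1 else if k = Suc i then - 1 else 0) * y k ^ (n - j))"
      by (rule sum.mono_neutral_right) auto
    also have "\<dots> = (if i < n then y i ^ (n - j) - y (Suc i) ^ (n - j) else y n ^ (n - j))"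
    proof (cases "i < n")
      case True
      then have "{i, Suc i} \<inter> {0..<Suc n} = {i, Suc i}"
        by auto
      then show ?thesis
        using True by simp
    next
      case False
      then have "{i, Suc i} \<inter> {0..<Suc n} = {i}"
        using ij by auto
      then show ?thesis
        using False ij by simp
    qed
    also have "\<dots> = four_block_mat B (0\<^sub>m n 1) R (1\<^sub>m 1) $$ (i, j)"
      using ij by (auto simp: B_def R_def)
    finally show "(L * power_mat (Suc n) y) $$ (i, j) =
        four_block_mat B (0\<^sub>m n 1) R (1\<^sub>m 1) $$ (i, j)" .
  qed (simp_all add: B_def R_def L_def)
  have "vandermonde (Suc n) y = Determinant.det (L * power_mat (Suc n) y)"
    using \<open>Determinant.det L = 1\<close>
    by (subst det_mult[of _ "Suc n"]) (simp_all add: L_def det_power_mat[symmetric])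
  also have "\<dots> = Determinant.det B"
    unfolding eq by (subst det_four_block_mat_upper_right_zero[of _ n _ 1]) (auto simp: B_def R_def)
  finally show ?thesis
    by (simp add: B_def)
qed

text \<open>The sum over an interlacing pattern telescopes row by row in the determinant.\<close>

lemma sum_interlacing_vandermonde:
  fixes Q :: real and l :: "nat \<Rightarrow> nat"
  assumes Q: "Q > 1" and l: "\<And>i. i < n \<Longrightarrow> l (Suc i) \<le> l i"
  shows "(\<Sum>m\<in>PiE {..<n} (\<lambda>i. {l (Suc i)..<l i}). (\<Prod>i<n. Q ^ m i) * vandermonde n (\<lambda>i. Q ^ m i)) =
    vandermonde (Suc n) (\<lambda>i. Q ^ l i) / (\<Prod>j<n. Q ^ (n - j) - 1)"
proof -
  define P where "P = {p. p permutes {0..<n}}"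
  \<comment> \<open>The factor \<open>\<Prod>i<n. Q ^ m i\<close> raises the exponents
    \<open>n - 1 - j\<close> in the determinant to \<open>n - j\<close>, which are positive. The
    geometric series below therefore have ratios different from 1.\<close>
  have inner: "(\<Prod>i<n. Q ^ m i) * vandermonde n (\<lambda>i. Q ^ m i) =
      (\<Sum>p\<in>P. of_int (sign p) * (\<Prod>i<n. (Q ^ (n - p i)) ^ m i))" for m :: "nat \<Rightarrow> nat"
  proof -
    have "(\<Prod>i<n. Q ^ m i) * (\<Prod>i<n. (Q ^ m i) ^ (n - Suc (p i))) = (\<Prod>i<n. (Q ^ (n - p i)) ^ m i)"
      if "p \<in> P" for p
      unfolding prod.distrib[symmetric]
    proof (rule prod.cong[OF refl])
      fix i assume "i \<in> {..<n}"
      then have "p i < n"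
        using that permutes_in_image[of p "{0..<n}" i] by (auto simp: P_def)
      then have "n - p i = Suc (n - Suc (p i))"
        by simp
      then have "(Q ^ (n - p i)) ^ m i = (Q * Q ^ (n - Suc (p i))) ^ m i"
        by simp
      then show "Q ^ m i * (Q ^ m i) ^ (n - Suc (p i)) = (Q ^ (n - p i)) ^ m i"
        by (simp add: power_mult_distrib power_mult[symmetric] mult.commute)
    qed
    then show ?thesis
      unfolding det_power_mat[symmetric]
      by (subst det_def'[of _ n])
        (auto simp: P_def sum_distrib_left atLeast0LessThan permutes_in_image
          mult.left_commute[of "prod _ _"] intro!: sum.cong)
  qed
  have geom: "(\<Sum>k\<in>{a..<b}. x ^ k) = (x ^ b - x ^ a) / (x - 1)" if "x \<noteq> 1" "a \<le> b" for x :: real and a b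
    using that by (simp add: sum_diff_nat_ivl[of 0 a b "\<lambda>k. x ^ k", symmetric]
        atLeast0LessThan geometric_sum diff_divide_distrib)
  have "(\<Sum>m\<in>PiE {..<n} (\<lambda>i. {l (Suc i)..<l i}). (\<Prod>i<n. Q ^ m i) * vandermonde n (\<lambda>i. Q ^ m i)) =
      (\<Sum>p\<in>P. of_int (sign p) *
        (\<Sum>m\<in>PiE {..<n} (\<lambda>i. {l (Suc i)..<l i}). \<Prod>i<n. (Q ^ (n - p i)) ^ m i))"
    unfolding inner by (subst sum.swap) (simp add: sum_distrib_left)
  also have "\<dots> = (\<Sum>p\<in>P. of_int (sign p) * (\<Prod>i<n. \<Sum>k\<in>{l (Suc i)..<l i}. (Q ^ (n - p i)) ^ k))"
    by (subst prod_sum_PiE) simp_all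
  also have "\<dots> = (\<Sum>p\<in>P. of_int (sign p) *
      ((\<Prod>i<n. (Q ^ l i) ^ (n - p i) - (Q ^ l (Suc i)) ^ (n - p i)) / (\<Prod>j<n. Q ^ (n - j) - 1)))"
  proof (rule sum.cong[OF refl])
    fix p assume p: "p \<in> P"
    \<comment> \<open>A permutation meets every column once, so the denominators of the series have
      the same product in each term of the determinant.\<close>
    have "(\<Prod>j<n. Q ^ (n - j) - 1) = (\<Prod>i<n. Q ^ (n - p i) - 1)"
      using prod.permute[of p "{..<n}" "\<lambda>j. Q ^ (n - j) - 1"] p
      by (simp add: P_def atLeast0LessThan o_def)
    moreover have "(\<Sum>k\<in>{l (Suc i)..<l i}. (Q ^ (n - p i)) ^ k) =
        ((Q ^ l i) ^ (n - p i) - (Q ^ l (Suc i)) ^ (n - p i)) / (Q ^ (n - p i) - 1)" if "i < n" for i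
    proof -
      have "p i < n"
        using p that permutes_in_image[of p "{0..<n}" i] by (auto simp: P_def)
      then have "Q ^ (n - p i) \<noteq> 1"
        using one_less_power[OF Q, of "n - p i"] by simp
      then show ?thesis
        using geom[OF _ l[OF that], of "Q ^ (n - p i)"] by (simp add: power_mult[symmetric] mult.commute)
    qed
    ultimately show "of_int (sign p) * (\<Prod>i<n. \<Sum>k\<in>{l (Suc i)..<l i}. (Q ^ (n - p i)) ^ k) =
        of_int (sign p) * ((\<Prod>i<n. (Q ^ l i) ^ (n - p i) - (Q ^ l (Suc i)) ^ (n - p i)) /
          (\<Prod>j<n. Q ^ (n - j) - 1))"
      by (simp add: prod_dividef)
  qed
  also have "\<dots> = vandermonde (Suc n) (\<lambda>i. Q ^ l i) / (\<Prod>j<n. Q ^ (n - j) - 1)"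
    unfolding det_power_mat_differences[symmetric]
    by (subst det_def'[of _ n])
      (auto simp: P_def sum_divide_distrib atLeast0LessThan permutes_in_image intro!: sum.cong)
  finally show ?thesis .
qed

no_notation Group.m_inv (\<open>(\<open>open_block notation=\<open>prefix inv\<close>\<close>inv\<index> _)\<close> [81] 80)
no_notation Matrix.vec_index (infixl \<open>$\<close> 100)
hide_const (open) Determinant.det Matrix.mat

section \<open>The bialternant formula at powers of Q\<close>

definition semistandard :: "nat \<Rightarrow> (nat \<Rightarrow> nat) \<Rightarrow> (nat \<Rightarrow> nat \<Rightarrow> nat) set" where
  "semistandard n \<alpha> = {t.
     (\<forall>i j. j < \<alpha> i \<longrightarrow> t i j < n) \<and> (\<forall>i j. \<alpha> i \<le> j \<longrightarrow> t i j = 0) \<and>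
     (\<forall>i j j'. j \<le> j' \<longrightarrow> j' < \<alpha> i \<longrightarrow> t i j \<le> t i j') \<and>
     (\<forall>i j. j < \<alpha> (Suc i) \<longrightarrow> t i j < t (Suc i) j)}"

text \<open>The Schur polynomial of \<open>\<alpha>\<close> at the point
  \<open>Q^(n-1), ..., Q, 1\<close>. The largest letter has weight 1, so its boxes can be removed
  without a factor, while every remaining box gains one factor \<open>Q\<close>. Tableaux are 0
  outside the shape, so that equal tableaux are equal functions.\<close>

definition schur_sum :: "real \<Rightarrow> nat \<Rightarrow> (nat \<Rightarrow> nat) \<Rightarrow> real" where
  "schur_sum Q n \<alpha> = (\<Sum>t\<in>semistandard n \<alpha>. Q ^ (\<Sum>i<n. \<Sum>j<\<alpha> i. n - 1 - t i j))"

lemma semistandard_ge_row: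
  assumes "t \<in> semistandard n \<alpha>" "antimono \<alpha>" "j < \<alpha> i"
  shows "i \<le> t i j"
  using assms(3)
proof (induction i)
  case (Suc i)
  have "j < \<alpha> i"
    using Suc.prems antimonoD[OF assms(2), of i "Suc i"] by simp
  moreover have "t i j < t (Suc i) j"
    using assms(1) Suc.prems by (simp add: semistandard_def)
  ultimately show ?case
    using Suc.IH by simp
qed simp

lemma finite_semistandard:
  assumes "finite {i. \<alpha> i \<noteq> 0}"
  shows "finite (semistandard n \<alpha>)"
proof -
  let ?C = "Sigma {i. \<alpha> i \<noteq> 0} (\<lambda>i. {..<\<alpha> i})"
  have "finite (PiE ?C (\<lambda>_. {..<n}))"
    using assms by (intro finite_PiE) auto
  moreover have "inj_on (\<lambda>t. restrict (case_prod t) ?C) (semistandard n \<alpha>)"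
  proof (rule inj_onI, intro ext)
    fix s t i j
    assume st: "s \<in> semistandard n \<alpha>" "t \<in> semistandard n \<alpha>"
      and eq: "restrict (case_prod s) ?C = restrict (case_prod t) ?C"
    show "s i j = t i j"
      using st fun_cong[OF eq, of "(i, j)"] 
      by (cases "j < \<alpha> i") (auto simp: semistandard_def restrict_def not_less split: if_splits)
  qed
  moreover have "(\<lambda>t. restrict (case_prod t) ?C) ` semistandard n \<alpha> \<subseteq> PiE ?C (\<lambda>_. {..<n})"
    by (auto simp: semistandard_def split: if_splits)
  ultimately show ?thesis
    by (meson finite_imageD finite_subset)
qed

text \<open>Removing the boxes that contain the largest letter.\<close>

lemma schur_sum_Suc:
  assumes \<alpha>: "antimono \<alpha>" "\<And>i. n < i \<Longrightarrow> \<alpha> i = 0"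
  shows "schur_sum Q (Suc n) \<alpha> =
    (\<Sum>\<mu>\<in>PiE {..<n} (\<lambda>i. {\<alpha> (Suc i)..\<alpha> i}).
       Q ^ (\<Sum>i<n. \<mu> i) * schur_sum Q n (\<lambda>i. if i < n then \<mu> i else 0))"
proof -
  define z :: "(nat \<Rightarrow> nat) \<Rightarrow> nat \<Rightarrow> nat" where "z = (\<lambda>\<mu> i. if i < n then \<mu> i else 0)"
  \<comment> \<open>Interlacing says that \<open>\<alpha>/\<mu>\<close> is a horizontal strip, which
    is the shape formed by the boxes with the largest letter \<open>n\<close>. \<open>f\<close>
    fills the strip with \<open>n\<close>; \<open>sh\<close> and \<open>g\<close> recover
    \<open>\<mu>\<close> and the smaller tableau.\<close>
  define I where "I = PiE {..<n} (\<lambda>i. {\<alpha> (Suc i)..\<alpha> i})"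
  define f where "f = (\<lambda>(\<mu>, t) i j. if j < z \<mu> i then t i j else if j < \<alpha> i then n else (0::nat))"
  define sh where "sh = (\<lambda>t. \<lambda>i\<in>{..<n}. card {j. j < \<alpha> i \<and> t i j < n})"
  define g where "g = (\<lambda>t. (sh t, \<lambda>i j. if j < z (sh t) i then t i j else (0::nat)))"
  have dec: "\<alpha> (Suc i) \<le> \<alpha> i" for i
    using \<alpha>(1) by (simp add: antimonoD)
  have zI: "z \<mu> i \<le> \<alpha> i" "\<alpha> (Suc i) \<le> z \<mu> i" if "\<mu> \<in> I" for \<mu> i
    using that \<alpha>(2)[of "Suc i"] by (auto simp: z_def I_def PiE_iff)
  have sh_iff: "t i j < n \<longleftrightarrow> j < z (sh t) i" if t: "t \<in> semistandard (Suc n) \<alpha>" and j: "j < \<alpha> i" for t i j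
  proof (cases "i < n")
    case True
    define c where "c = card {j. j < \<alpha> i \<and> t i j < n}"
    have "{j. j < \<alpha> i \<and> t i j < n} = {..<c}"
    proof -
      have down: "j \<in> {j. j < \<alpha> i \<and> t i j < n}" if "j \<le> j'" "j' \<in> {j. j < \<alpha> i \<and> t i j < n}" for j j'
      proof -
        have "t i j \<le> t i j'"
          using that t by (simp add: semistandard_def)
        then show ?thesis
          using that by simp
      qed
      have fin: "finite {j. j < \<alpha> i \<and> t i j < n}"
        by simp
      show ?thesis
      proof (rule card_subset_eq[symmetric])
        show "{..<c} \<subseteq> {j. j < \<alpha> i \<and> t i j < n}"
        proof (rule ccontr)
          assume "\<not> ?thesis"
          then obtain k where k: "k < c" "k \<notin> {j. j < \<alpha> i \<and> t i j < n}"
            by auto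
          then have "{j. j < \<alpha> i \<and> t i j < n} \<subseteq> {..<k}"
            using down by (meson lessThan_iff not_le subsetI)
          then have "c \<le> k"
            unfolding c_def using card_mono[of "{..<k}"] by fastforce
          with k show False
            by simp
        qed
      qed (simp_all add: c_def)
    qed
    then have "j < \<alpha> i \<and> t i j < n \<longleftrightarrow> j < c"
      by blast
    then show ?thesis
      using True j by (simp add: z_def sh_def c_def)
  next
    case False
    \<comment> \<open>From row \<open>n\<close> on, column strictness makes all entries at least
      \<open>n\<close>, in agreement with the value 0 of \<open>z\<close> there.\<close>
    then show ?thesis
      using semistandard_ge_row[OF t \<alpha>(1) j] by (simp add: z_def)
  qed
  have f_in: "f (\<mu>, t) \<in> semistandard (Suc n) \<alpha>" if "\<mu> \<in> I" "t \<in> semistandard n (z \<mu>)" for \<mu> t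
  proof -
    have "f (\<mu>, t) i j < Suc n" if "j < \<alpha> i" for i j
      using that \<open>t \<in> _\<close> by (auto simp: f_def semistandard_def less_Suc_eq)
    moreover have "f (\<mu>, t) i j = 0" if "\<alpha> i \<le> j" for i j
      using that zI(1)[OF \<open>\<mu> \<in> I\<close>, of i] by (auto simp: f_def)
    moreover have "f (\<mu>, t) i j \<le> f (\<mu>, t) i j'" if "j \<le> j'" "j' < \<alpha> i" for i j j'
      using that \<open>t \<in> _\<close> by (auto simp: f_def semistandard_def intro: less_imp_le)
    moreover have "f (\<mu>, t) i j < f (\<mu>, t) (Suc i) j" if "j < \<alpha> (Suc i)" for i j
      using that zI(2)[OF \<open>\<mu> \<in> I\<close>, of i] \<open>t \<in> _\<close> by (auto simp: f_def semistandard_def)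
    ultimately show ?thesis
      by (simp add: semistandard_def)
  qed
  have sh_in: "sh t \<in> I" if t: "t \<in> semistandard (Suc n) \<alpha>" for t
  proof -
    have "card {j. j < \<alpha> i \<and> t i j < n} \<le> \<alpha> i" for i
      using card_mono[of "{..<\<alpha> i}" "{j. j < \<alpha> i \<and> t i j < n}"] by auto
    moreover have "\<alpha> (Suc i) \<le> card {j. j < \<alpha> i \<and> t i j < n}" for i
    proof -
      have "{..<\<alpha> (Suc i)} \<subseteq> {j. j < \<alpha> i \<and> t i j < n}"
      proof
        fix j assume "j \<in> {..<\<alpha> (Suc i)}"
        then have "t i j < t (Suc i) j" "t (Suc i) j < Suc n" "j < \<alpha> i"
          using t dec[of i] by (auto simp: semistandard_def)
        then show "j \<in> {j. j < \<alpha> i \<and> t i j < n}"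
          by simp
      qed
      from card_mono[OF _ this] show ?thesis
        by simp
    qed
    ultimately show ?thesis
      by (auto simp: sh_def I_def)
  qed
  have g_in: "snd (g t) \<in> semistandard n (z (sh t))" if t: "t \<in> semistandard (Suc n) \<alpha>" for t
  proof -
    have le: "z (sh t) i \<le> \<alpha> i" for i
      using zI(1)[OF sh_in[OF t]] .
    have "z (sh t) (Suc i) \<le> z (sh t) i" for i
      using zI[OF sh_in[OF t], of i] zI[OF sh_in[OF t], of "Suc i"] by simp
    then have le2: "j < z (sh t) i" if "j < z (sh t) (Suc i)" for i j
      using that less_le_trans by blast
    have le1: "j < \<alpha> i" if "j < z (sh t) i" for i j
      using that le less_le_trans by blast
    have t': "snd (g t) i j = (if j < z (sh t) i then t i j else 0)" for i j
      by (simp add: g_def)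
    have "snd (g t) i j < n" if "j < z (sh t) i" for i j
      using that sh_iff[OF t, of j i] le1[of j i] by (simp add: t')
    moreover have "snd (g t) i j \<le> snd (g t) i j'" if "j \<le> j'" "j' < z (sh t) i" for i j j'
      using that t le1[of j' i] by (simp add: t' semistandard_def)
    moreover have "snd (g t) i j < snd (g t) (Suc i) j" if "j < z (sh t) (Suc i)" for i j
      using that t le1[of j "Suc i"] le2[of j i] by (simp add: t' semistandard_def)
    ultimately show ?thesis
      by (simp add: semistandard_def t')
  qed
  have "schur_sum Q (Suc n) \<alpha> =
      (\<Sum>(\<mu>, t)\<in>Sigma I (\<lambda>\<mu>. semistandard n (z \<mu>)).
         Q ^ (\<Sum>i<n. \<mu> i) * Q ^ (\<Sum>i<n. \<Sum>j<z \<mu> i. n - 1 - t i j))"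
    unfolding schur_sum_def
  proof (rule sum.reindex_bij_witness[of _ f g])
    fix t assume t: "t \<in> semistandard (Suc n) \<alpha>"
    show "f (g t) = t"
    proof (intro ext)
      fix i j
      show "f (g t) i j = t i j"
      proof (cases "j < \<alpha> i")
        case True
        then have "t i j < Suc n"
          using t by (simp add: semistandard_def)
        then show ?thesis
          using sh_iff[OF t True] True by (auto simp: f_def g_def)
      next
        case False
        then show ?thesis
          using t zI(1)[OF sh_in[OF t], of i] by (auto simp: f_def g_def semistandard_def)
      qed
    qed
    show "g t \<in> Sigma I (\<lambda>\<mu>. semistandard n (z \<mu>))"
      using sh_in[OF t] g_in[OF t] by (simp add: g_def)
    have "(\<Sum>i<Suc n. \<Sum>j<\<alpha> i. Suc n - 1 - t i j) =
        (\<Sum>i<Suc n. \<Sum>j<z (sh t) i. Suc (n - 1 - snd (g t) i j))"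
    proof (rule sum.cong[OF refl])
      fix i
      have le: "z (sh t) i \<le> \<alpha> i"
        using zI(1)[OF sh_in[OF t]] .
      have "(\<Sum>j<\<alpha> i. Suc n - 1 - t i j) = (\<Sum>j<z (sh t) i. Suc n - 1 - t i j)"
        using le sh_iff[OF t] by (intro sum.mono_neutral_right) (auto simp: not_less, metis not_less)
      also have "\<dots> = (\<Sum>j<z (sh t) i. Suc (n - 1 - snd (g t) i j))"
      proof (rule sum.cong[OF refl])
        fix j assume "j \<in> {..<z (sh t) i}"
        then show "Suc n - 1 - t i j = Suc (n - 1 - snd (g t) i j)"
          using sh_iff[OF t, of j i] le by (auto simp: g_def)
      qed
      finally show "(\<Sum>j<\<alpha> i. Suc n - 1 - t i j) =
          (\<Sum>j<z (sh t) i. Suc (n - 1 - snd (g t) i j))" .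
    qed
    also have "\<dots> = (\<Sum>i<n. sh t i) + (\<Sum>i<n. \<Sum>j<z (sh t) i. n - 1 - snd (g t) i j)"
      by (simp add: sum_Suc z_def sum.distrib)
    finally show "(case g t of (\<mu>, t) \<Rightarrow>
        Q ^ (\<Sum>i<n. \<mu> i) * Q ^ (\<Sum>i<n. \<Sum>j<z \<mu> i. n - 1 - t i j)) =
        Q ^ (\<Sum>i<Suc n. \<Sum>j<\<alpha> i. Suc n - 1 - t i j)"
      by (simp add: g_def power_add)
  next
    fix p assume "p \<in> Sigma I (\<lambda>\<mu>. semistandard n (z \<mu>))"
    then obtain \<mu> t where p: "p = (\<mu>, t)" "\<mu> \<in> I" "t \<in> semistandard n (z \<mu>)"
      by auto
    show fp: "f p \<in> semistandard (Suc n) \<alpha>"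
      using f_in p by simp
    have "{j. j < \<alpha> i \<and> f p i j < n} = {..<z \<mu> i}" for i
      using p zI(1)[OF p(2), of i] by (auto simp: f_def semistandard_def split: if_splits)
    then have sh: "sh (f p) = \<mu>"
      using p by (auto simp: sh_def fun_eq_iff z_def I_def PiE_def extensional_def restrict_def)
    have "g (f p) = (\<mu>, \<lambda>i j. if j < z \<mu> i then f p i j else 0)"
      by (simp only: g_def sh)
    also have "\<dots> = (\<mu>, t)"
      using p by (auto simp: f_def fun_eq_iff semistandard_def)
    finally show "g (f p) = p"
      by (simp only: p)
  qed
  also have "\<dots> = (\<Sum>\<mu>\<in>I. Q ^ (\<Sum>i<n. \<mu> i) * schur_sum Q n (z \<mu>))"
  proof -
    have "finite (semistandard n (z \<mu>))" for \<mu>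
      by (rule finite_semistandard) (rule finite_subset[of _ "{..<n}"], auto simp: z_def)
    moreover have "finite I"
      by (simp add: I_def finite_PiE)
    ultimately show ?thesis
      by (simp add: schur_sum_def sum.Sigma[symmetric] sum_distrib_left)
  qed
  finally show ?thesis
    by (simp add: I_def z_def)
qed

lemma vandermonde_cong:
  "(\<And>i. i < n \<Longrightarrow> x i = y i) \<Longrightarrow> vandermonde n x = vandermonde n y"
  by (auto simp: vandermonde_def intro!: prod.cong)

text \<open>Induction on \<open>n\<close> by removing the largest letter. The shifted exponents
  \<open>\<mu> i + (n - 1 - i)\<close> turn the closed interlacing intervals into the half-open ones
  of \<open>sum_interlacing_vandermonde\<close>, which sums the Vandermonde products of size
  \<open>n\<close> to one of size \<open>n + 1\<close>.\<close>

theorem schur_sum_eq: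
  fixes Q :: real
  assumes Q: "Q > 1" and "antimono \<alpha>" "\<And>i. n \<le> i \<Longrightarrow> \<alpha> i = 0"
  shows "schur_sum Q n \<alpha> * vandermonde n (\<lambda>i. Q ^ (n - 1 - i)) =
    vandermonde n (\<lambda>i. Q ^ (\<alpha> i + (n - 1 - i)))"
  using assms(2,3)
proof (induction n arbitrary: \<alpha>)
  case 0
  have "semistandard 0 \<alpha> = {\<lambda>_ _. 0}"
    using 0 by (auto simp: semistandard_def fun_eq_iff)
  then show ?case
    by (simp add: schur_sum_def vandermonde_def)
next
  case (Suc n)
  define c where "c = (\<Prod>j<n. Q ^ (n - j) - 1)"
  have "Q ^ (n - j) \<noteq> 1" if "j < n" for j
    using one_less_power[OF Q, of "n - j"] that by simp
  then have c: "c \<noteq> 0"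
    by (simp add: c_def)
  define \<delta> where "\<delta> = (\<Prod>i<n. Q ^ (n - 1 - i))"
  have \<delta>: "\<delta> \<noteq> 0"
    using Q by (simp add: \<delta>_def)
  have dec: "\<alpha> (Suc i) \<le> \<alpha> i" for i
    using Suc.prems(1) by (simp add: antimonoD)
  have key: "schur_sum Q (Suc n) \<alpha> * vandermonde n (\<lambda>i. Q ^ (n - 1 - i)) * (\<delta> * c) =
      vandermonde (Suc n) (\<lambda>i. Q ^ (\<alpha> i + (n - i)))"
    if \<alpha>: "antimono \<alpha>" "\<And>i. n < i \<Longrightarrow> \<alpha> i = 0" for \<alpha>
  proof -
    define I where "I = PiE {..<n} (\<lambda>i. {\<alpha> (Suc i)..\<alpha> i})"
    define J where "J = PiE {..<n} (\<lambda>i. {\<alpha> (Suc i) + (n - Suc i)..<\<alpha> i + (n - i)})"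
    have summand: "Q ^ (\<Sum>i<n. \<mu> i) * schur_sum Q n (\<lambda>i. if i < n then \<mu> i else 0) *
        vandermonde n (\<lambda>i. Q ^ (n - 1 - i)) * \<delta> =
        (\<Prod>i<n. Q ^ (\<mu> i + (n - 1 - i))) * vandermonde n (\<lambda>i. Q ^ (\<mu> i + (n - 1 - i)))"
      if \<mu>: "\<mu> \<in> I" for \<mu>
    proof -
      have "antimono (\<lambda>i. if i < n then \<mu> i else 0)"
      proof (rule decseq_SucI)
        fix i
        have ge: "\<alpha> (Suc i) \<le> \<mu> i" and le: "\<mu> i \<le> \<alpha> i" if "i < n" for i
          using that \<mu> by (auto simp: I_def PiE_iff)
        show "(if Suc i < n then \<mu> (Suc i) else 0) \<le> (if i < n then \<mu> i else 0)"
          using ge[of i] le[of "Suc i"] by auto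
      qed
      from Suc.IH[OF this] have "schur_sum Q n (\<lambda>i. if i < n then \<mu> i else 0) *
          vandermonde n (\<lambda>i. Q ^ (n - 1 - i)) = vandermonde n (\<lambda>i. Q ^ (\<mu> i + (n - 1 - i)))"
        by (simp cong: vandermonde_cong)
      moreover have "(\<Prod>i<n. Q ^ (\<mu> i + (n - 1 - i))) = Q ^ (\<Sum>i<n. \<mu> i) * \<delta>"
        by (simp only: power_add prod.distrib power_sum \<delta>_def)
      ultimately show ?thesis
        by (simp only: mult_ac)
    qed
    have "schur_sum Q (Suc n) \<alpha> * vandermonde n (\<lambda>i. Q ^ (n - 1 - i)) * \<delta> =
        (\<Sum>\<mu>\<in>I. (\<Prod>i<n. Q ^ (\<mu> i + (n - 1 - i))) * vandermonde n (\<lambda>i. Q ^ (\<mu> i + (n - 1 - i))))"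
    proof -
      have "schur_sum Q (Suc n) \<alpha> =
          (\<Sum>\<mu>\<in>I. Q ^ (\<Sum>i<n. \<mu> i) * schur_sum Q n (\<lambda>i. if i < n then \<mu> i else 0))"
        unfolding I_def by (rule schur_sum_Suc) (fact \<alpha>)+
      then show ?thesis
        by (simp only: sum_distrib_right summand cong: sum.cong)
    qed
    also have "\<dots> = (\<Sum>m\<in>J. (\<Prod>i<n. Q ^ m i) * vandermonde n (\<lambda>i. Q ^ m i))"
    proof (rule sum.reindex_bij_witness[of _ "\<lambda>m. \<lambda>i\<in>{..<n}. m i - (n - 1 - i)"
          "\<lambda>\<mu>. \<lambda>i\<in>{..<n}. \<mu> i + (n - 1 - i)"])
      fix \<mu> assume \<mu>: "\<mu> \<in> I"
      then have "\<alpha> (Suc i) \<le> \<mu> i" "\<mu> i \<le> \<alpha> i" if "i < n" for i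
        using that by (auto simp: I_def PiE_iff)
      then show "(\<lambda>i\<in>{..<n}. \<mu> i + (n - 1 - i)) \<in> J"
        by (fastforce simp: J_def)
      show "(\<lambda>i\<in>{..<n}. (\<lambda>i\<in>{..<n}. \<mu> i + (n - 1 - i)) i - (n - 1 - i)) = \<mu>"
        using \<mu> by (auto simp: I_def fun_eq_iff PiE_iff extensional_def)
      show "(\<Prod>i<n. Q ^ (\<lambda>i\<in>{..<n}. \<mu> i + (n - 1 - i)) i) *
          vandermonde n (\<lambda>i. Q ^ (\<lambda>i\<in>{..<n}. \<mu> i + (n - 1 - i)) i) =
          (\<Prod>i<n. Q ^ (\<mu> i + (n - 1 - i))) * vandermonde n (\<lambda>i. Q ^ (\<mu> i + (n - 1 - i)))"
        by (simp cong: vandermonde_cong)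
    next
      fix m assume m: "m \<in> J"
      then have ge: "\<alpha> (Suc i) + (n - Suc i) \<le> m i" "m i < \<alpha> i + (n - i)" if "i < n" for i
        using that by (auto simp: J_def PiE_iff)
      have "\<alpha> (Suc i) \<le> m i - (n - 1 - i)" "m i - (n - 1 - i) \<le> \<alpha> i" if "i < n" for i
        using that ge[OF that] by linarith+
      then show "(\<lambda>i\<in>{..<n}. m i - (n - 1 - i)) \<in> I"
        by (fastforce simp: I_def)
      have "m i - (n - 1 - i) + (n - 1 - i) = m i" if "i < n" for i
        using ge(1)[OF that] by linarith
      then show "(\<lambda>i\<in>{..<n}. (\<lambda>i\<in>{..<n}. m i - (n - 1 - i)) i + (n - 1 - i)) = m"
        using m by (auto simp: J_def fun_eq_iff PiE_iff extensional_def)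
    qed
    also have "\<dots> = vandermonde (Suc n) (\<lambda>i. Q ^ (\<alpha> i + (n - i))) / c"
      unfolding J_def c_def
    proof (rule sum_interlacing_vandermonde[OF Q])
      fix i assume "i < n"
      then show "\<alpha> (Suc i) + (n - Suc i) \<le> \<alpha> i + (n - i)"
        using antimonoD[OF \<alpha>(1), of i "Suc i"] by simp
    qed
    finally show ?thesis
      using c by (simp add: mult.assoc[symmetric])
  qed
  \<comment> \<open>For the empty shape the sum is 1, so \<open>key\<close> itself evaluates the
    factor that does not depend on the shape.\<close>
  have "semistandard (Suc n) (\<lambda>_. 0) = {\<lambda>_ _. 0}"
    by (auto simp: semistandard_def fun_eq_iff)
  then have "schur_sum Q (Suc n) (\<lambda>_. 0) = 1"
    by (simp add: schur_sum_def)
  with key[of "\<lambda>_. 0"] have "vandermonde n (\<lambda>i. Q ^ (n - 1 - i)) * (\<delta> * c) =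
      vandermonde (Suc n) (\<lambda>i. Q ^ (n - i))"
    by (simp add: antimono_def)
  with key[of \<alpha>] Suc.prems show ?case
    by (simp add: mult.assoc)
qed

section \<open>Alternating sums over the intervals of a word\<close>

text \<open>If \<open>s\<close> is a letter and the word is what follows it, this collects the
  intervals that begin at that letter. The start value is a parameter because the recursion
  accumulates the partial sum in it.\<close>

fun alternating_sum :: "(nat \<Rightarrow> real) \<Rightarrow> nat \<Rightarrow> nat list \<Rightarrow> real" where
  "alternating_sum h s [] = h s"
| "alternating_sum h s (y # g) = h s - alternating_sum h (s + y) g"

text \<open>The sum of \<open>\<plusminus> h (sum_list I)\<close> over all nonempty intervals \<open>I\<close> of a word, the sign being
  positive for intervals of odd length.\<close>

fun interval_sum :: "(nat \<Rightarrow> real) \<Rightarrow> nat list \<Rightarrow> real" where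
  "interval_sum h [] = 0"
| "interval_sum h (y # g) = interval_sum h g + alternating_sum h y g"

fun even_part :: "nat list \<Rightarrow> nat" where
  "even_part [] = 0"
| "even_part [x] = x"
| "even_part (x # y # g) = x + even_part g"

lemma alternating_sum_snoc:
  "alternating_sum h s (g @ [y]) = alternating_sum h s g - (- 1) ^ length g * h (s + sum_list g + y)"
proof (induction g arbitrary: s)
  case (Cons x g)
  show ?case
    using Cons.IH[of "s + x"] by (simp add: add.assoc)
qed simp

lemma interval_sum_snoc:
  "interval_sum h (g @ [x]) = interval_sum h g + alternating_sum h x (rev g)"
  by (induction g) (auto simp: alternating_sum_snoc ac_simps)

text \<open>Reversal of a word permutes its intervals and keeps their lengths and sums.\<close>

lemma interval_sum_rev: "interval_sum h (rev g) = interval_sum h g"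
  by (induction g) (auto simp: interval_sum_snoc)

text \<open>Only the prefix that ends between the two exchanged letters changes its sum.\<close>

lemma alternating_sum_swap:
  "alternating_sum h s (L @ u # x # R) - alternating_sum h s (L @ x # u # R) =
    (- 1) ^ length L * (h (s + sum_list L + x) - h (s + sum_list L + u))"
proof (induction L arbitrary: s)
  case (Cons y L)
  show ?case
    using Cons.IH[of "s + y"] by (simp add: algebra_simps)
qed (simp add: ac_simps)

text \<open>Intervals that contain both exchanged letters or neither keep their sum and length. The
  others end or begin at the border between the two letters and extend into \<open>L\<close> or into
  \<open>R\<close>.\<close>

lemma interval_sum_swap:
  "interval_sum h (L @ u # x # R) - interval_sum h (L @ x # u # R) =
    alternating_sum h u (rev L) - alternating_sum h x (rev L)
      + alternating_sum h x R - alternating_sum h u R"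
proof (induction L)
  case Nil
  show ?case
    by (simp add: ac_simps)
next
  case (Cons y L)
  show ?case
    using Cons.IH alternating_sum_swap[of h y L u x R]
    by (simp add: alternating_sum_snoc algebra_simps)
qed

text \<open>For \<open>h\<close> the logarithm of \<open>H\<close>, this is the logarithm of the
  product formula for the character; the subtracted term is the denominator
  \<open>H n\<close>.\<close>

definition word_invariant :: "(nat \<Rightarrow> real) \<Rightarrow> nat list \<Rightarrow> real" where
  "word_invariant h g = interval_sum h g - h (even_part g)"

section \<open>Inserting a letter into an alternating word\<close>

definition alternating_word :: "nat \<Rightarrow> 'a \<Rightarrow> 'a \<Rightarrow> 'a list" where
  "alternating_word k x y = concat (replicate k [x, y])"

lemma alternating_word_simps [simp]:
  "alternating_word 0 x y = []"
  "alternating_word (Suc k) x y = x # y # alternating_word k x y"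
  by (simp_all add: alternating_word_def)

lemma alternating_word_shift: "x # alternating_word k y x = alternating_word k x y @ [x]"
  by (induction k) auto

lemma rev_alternating_word: "rev (alternating_word k x y) = alternating_word k y x"
  by (induction k) (auto simp: alternating_word_shift[symmetric])

lemma length_alternating_word [simp]: "length (alternating_word k x y) = 2 * k"
  by (induction k) auto

lemma sum_alternating_word [simp]: "sum_list (alternating_word k x y) = k * (x + y)"
  by (induction k) auto

lemma even_part_alternating_word_append [simp]:
  "even_part (alternating_word k x y @ g) = k * x + even_part g"
  by (induction k) auto

lemma even_part_Cons_alternating_word [simp]:
  "even_part (x # alternating_word k y z) = x + k * z"
  by (induction k arbitrary: x) auto

text \<open>When one of \<open>rev L\<close> and \<open>R\<close> extends the other by a letter, all but one term of the difference in
  \<open>interval_sum_swap\<close> cancel, and the remaining one is the change of the even part.\<close>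

lemma word_invariant_swap:
  assumes LR: "rev L = R @ [y] \<or> R = rev L @ [y]"
    and S: "S = max (sum_list L) (sum_list R)"
    and even: "even_part (L @ u # x # R) = (if even (length L) then u else x) + S"
      "even_part (L @ x # u # R) = (if even (length L) then x else u) + S"
  shows "word_invariant h (L @ u # x # R) = word_invariant h (L @ x # u # R)"
proof -
  have "interval_sum h (L @ u # x # R) - interval_sum h (L @ x # u # R) =
      (- 1) ^ length L * (h (u + S) - h (x + S))"
  proof (cases "rev L = R @ [y]")
    case True
    then have "S = sum_list R + y" "length L = Suc (length R)"
      using S by (metis max.absorb1 le_add1 sum_list.append sum_list_rev sum_list.Cons
          sum_list.Nil add.right_neutral, metis length_append_singleton length_rev)
    then show ?thesis
      unfolding interval_sum_swap True alternating_sum_snoc by (simp add: algebra_simps)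
  next
    case False
    then have R: "R = rev L @ [y]"
      using LR by blast
    then have "S = sum_list L + y"
      using S by simp
    then show ?thesis
      unfolding interval_sum_swap unfolding R alternating_sum_snoc by (simp add: algebra_simps)
  qed
  then show ?thesis
    unfolding word_invariant_def even by (cases "even (length L)") simp_all
qed

lemma alternating_word_Suc: "alternating_word (Suc k) x y = alternating_word k x y @ [x, y]"
  by (induction k) auto

text \<open>In this and the next three lemmas \<open>u\<close> passes one letter. Here both sides
  read \<open>z, v, z, ...\<close> outwards from the exchanged pair, and the left side is longer by
  a final \<open>z\<close>. In the other cases too, one side extends the other by the letter given
  as \<open>y\<close>, and \<open>S\<close> is the sum of the longer side.\<close>

lemma word_invariant_insert_1:
  "word_invariant h (alternating_word (Suc s) z v @ u # alternating_word s z v) =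
   word_invariant h (alternating_word s z v @ z # u # v # alternating_word s z v)"
proof -
  let ?L = "alternating_word s z v @ [z]" and ?R = "alternating_word s z v"
  have "word_invariant h (?L @ v # u # ?R) = word_invariant h (?L @ u # v # ?R)"
    by (rule word_invariant_swap[where y = z and S = "s * (z + v) + z"])
      (simp add: rev_alternating_word alternating_word_shift alternating_word_Suc
        del: alternating_word_simps(2), simp_all add: algebra_simps max_def)
  then show ?thesis
    by (simp only: alternating_word_Suc append_assoc append.simps)
qed

lemma word_invariant_insert_2:
  "word_invariant h (alternating_word s z v @ z # u # v # alternating_word s z v) =
   word_invariant h (alternating_word s z v @ u # alternating_word (Suc s) z v)"
proof -
  let ?L = "alternating_word s z v" and ?R = "v # alternating_word s z v"
  have "word_invariant h (?L @ z # u # ?R) = word_invariant h (?L @ u # z # ?R)"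
    by (rule word_invariant_swap[where y = v and S = "s * (z + v) + v"])
      (simp add: rev_alternating_word alternating_word_shift alternating_word_Suc
        del: alternating_word_simps(2), simp_all add: algebra_simps max_def)
  then show ?thesis
    by simp
qed

lemma word_invariant_insert_3:
  "word_invariant h (alternating_word (Suc s) z v @ z # u # v # alternating_word s z v) =
   word_invariant h (alternating_word (Suc s) z v @ u # alternating_word (Suc s) z v)"
proof -
  let ?L = "alternating_word (Suc s) z v" and ?R = "v # alternating_word s z v"
  have "word_invariant h (?L @ z # u # ?R) = word_invariant h (?L @ u # z # ?R)"
    by (rule word_invariant_swap[where y = z and S = "Suc s * (z + v)"])
      (simp add: rev_alternating_word alternating_word_shift alternating_word_Suc
        del: alternating_word_simps(2), simp_all add: algebra_simps max_def)
  then show ?thesis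
    by simp
qed

lemma word_invariant_insert_4:
  "word_invariant h (alternating_word (Suc s) z v @ u # alternating_word (Suc s) z v) =
   word_invariant h (alternating_word s z v @ z # u # v # alternating_word (Suc s) z v)"
proof -
  let ?L = "alternating_word s z v @ [z]" and ?R = "alternating_word (Suc s) z v"
  have "word_invariant h (?L @ v # u # ?R) = word_invariant h (?L @ u # v # ?R)"
    by (rule word_invariant_swap[where y = v and S = "Suc s * (z + v)"])
      (simp add: rev_alternating_word alternating_word_shift alternating_word_Suc
        del: alternating_word_simps(2), simp_all add: algebra_simps max_def)
  then show ?thesis
    by (simp only: alternating_word_Suc append_assoc append.simps)
qed

text \<open>In a word of odd length, reversal preserves the parity of positions.\<close>

lemma even_part_rev: "odd (length g) \<Longrightarrow> even_part (rev g) = even_part g"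
proof -
  have snoc: "even_part (g @ [x, y]) = even_part g + (if even (length g) then x else y)" for g x y
    by (induction g rule: even_part.induct) auto
  show "odd (length g) \<Longrightarrow> even_part (rev g) = even_part g"
    by (induction g rule: even_part.induct) (auto simp: snoc)
qed

lemma word_invariant_rev: "odd (length g) \<Longrightarrow> word_invariant h (rev g) = word_invariant h g"
  by (simp add: word_invariant_def interval_sum_rev even_part_rev)

text \<open>The first three words are linked by moves of \<open>u\<close>, the last three by the
  same moves with \<open>z\<close> and \<open>v\<close> exchanged. The two groups are joined by one
  reversal, which takes the first word to the last.\<close>

lemma word_invariant_eq_I:
  assumes "w \<in> {alternating_word (Suc s) z v @ u # alternating_word s z v,
      alternating_word s z v @ z # u # v # alternating_word s z v,
      alternating_word s z v @ u # alternating_word (Suc s) z v,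
      alternating_word (Suc s) v z @ u # alternating_word s v z,
      alternating_word s v z @ v # u # z # alternating_word s v z,
      alternating_word s v z @ u # alternating_word (Suc s) v z}"
  shows "word_invariant h w = word_invariant h (alternating_word (Suc s) z v @ u # alternating_word s z v)"
proof -
  have "rev (alternating_word (Suc s) z v @ u # alternating_word s z v) =
      alternating_word s v z @ u # alternating_word (Suc s) v z"
    by (simp only: rev_append rev.simps rev_alternating_word append.simps append_assoc)
  then have "word_invariant h (alternating_word s v z @ u # alternating_word (Suc s) v z) =
      word_invariant h (alternating_word (Suc s) z v @ u # alternating_word s z v)"
    using word_invariant_rev[of "alternating_word (Suc s) z v @ u # alternating_word s z v" h]
    by (simp del: alternating_word_simps)
  then show ?thesis
    using assms word_invariant_insert_1 word_invariant_insert_2 by (elim insertE emptyE) simp_all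
qed

text \<open>Here the reversal that joins the two groups takes the middle word of the first to the
  middle word of the second.\<close>

lemma word_invariant_eq_II:
  assumes "w \<in> {alternating_word (Suc s) z v @ z # u # v # alternating_word s z v,
      alternating_word (Suc s) z v @ u # alternating_word (Suc s) z v,
      alternating_word s z v @ z # u # v # alternating_word (Suc s) z v,
      alternating_word (Suc s) v z @ v # u # z # alternating_word s v z,
      alternating_word (Suc s) v z @ u # alternating_word (Suc s) v z,
      alternating_word s v z @ v # u # z # alternating_word (Suc s) v z}"
  shows "word_invariant h w = word_invariant h (alternating_word (Suc s) z v @ u # alternating_word (Suc s) z v)"
proof -
  have "rev (alternating_word (Suc s) z v @ u # alternating_word (Suc s) z v) =
      alternating_word (Suc s) v z @ u # alternating_word (Suc s) v z"
    by (simp only: rev_append rev.simps rev_alternating_word append.simps append_assoc)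
  then have "word_invariant h (alternating_word (Suc s) v z @ u # alternating_word (Suc s) v z) =
      word_invariant h (alternating_word (Suc s) z v @ u # alternating_word (Suc s) z v)"
    using word_invariant_rev[of "alternating_word (Suc s) z v @ u # alternating_word (Suc s) z v" h]
    by (simp del: alternating_word_simps)
  then show ?thesis
    using assms word_invariant_insert_3 word_invariant_insert_4 by (elim insertE emptyE) simp_all
qed

section \<open>Schur functions of block partitions\<close>

fun pair_sum :: "('a \<Rightarrow> 'a \<Rightarrow> real) \<Rightarrow> 'a list \<Rightarrow> real" where
  "pair_sum f [] = 0"
| "pair_sum f (x # xs) = (\<Sum>y\<leftarrow>xs. f x y) + pair_sum f xs"

lemma pair_sum_append:
  "pair_sum f (xs @ ys) = pair_sum f xs + pair_sum f ys + (\<Sum>x\<leftarrow>xs. \<Sum>y\<leftarrow>ys. f x y)"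
  by (induction xs) auto

lemma pair_sum_nth:
  "pair_sum f xs = (\<Sum>j<length xs. \<Sum>i<j. f (xs ! i) (xs ! j))"
proof (induction xs)
  case (Cons x xs)
  have "(\<Sum>y\<leftarrow>xs. f x y) = (\<Sum>j<length xs. f x (xs ! j))"
    by (simp add: sum_list_sum_nth atLeast0LessThan)
  then show ?case
    by (simp add: Cons.IH sum.lessThan_Suc_shift sum.distrib del: sum.lessThan_Suc)
qed simp

text \<open>A word of odd length encodes a partition with \<open>n\<close> parts (zeros included) through the blocks formed
  by the numbers \<open>l\<^sub>i\<close>, from the top: the letters in even positions are the lengths of the blocks, those
  in odd positions the gaps below them. The list of the \<open>l\<^sub>i\<close> is \<open>beta_of_word\<close>.\<close>

fun parts_of_word :: "nat list \<Rightarrow> nat list" where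
  "parts_of_word [] = []"
| "parts_of_word [b] = replicate b 0"
| "parts_of_word (b # a # g) = replicate b (a + (sum_list g - even_part g)) @ parts_of_word g"

fun beta_of_word :: "nat list \<Rightarrow> nat list" where
  "beta_of_word [] = []"
| "beta_of_word [b] = rev [0..<b]"
| "beta_of_word (b # a # g) = rev [a + sum_list g..<a + sum_list g + b] @ beta_of_word g"

lemma even_part_le: "even_part g \<le> sum_list g"
  by (induction g rule: even_part.induct) auto

lemma length_parts_of_word: "odd (length g) \<Longrightarrow> length (parts_of_word g) = even_part g"
  by (induction g rule: parts_of_word.induct) auto

lemma length_beta_of_word: "odd (length g) \<Longrightarrow> length (beta_of_word g) = even_part g"
  by (induction g rule: beta_of_word.induct) auto

text \<open>This identifies the entries with the exponents \<open>\<alpha> i + (n - 1 - i)\<close>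
  in \<open>schur_sum_eq\<close>.\<close>

lemma beta_of_word_nth:
  "odd (length g) \<Longrightarrow> i < even_part g \<Longrightarrow>
    beta_of_word g ! i = parts_of_word g ! i + (even_part g - 1 - i)"
proof (induction g arbitrary: i rule: beta_of_word.induct)
  case (3 b a g)
  have g: "odd (length g)"
    using 3 by simp
  show ?case
  proof (cases "i < b")
    case True
    then show ?thesis
      using even_part_le[of g] by (simp add: nth_append rev_nth)
  next
    case False
    then show ?thesis
      using 3 g by (simp add: nth_append)
  qed
qed (simp_all add: rev_nth)

lemma sorted_parts_of_word: "odd (length g) \<Longrightarrow> sorted_wrt (\<ge>) (parts_of_word g)"
proof -
  have "x \<le> sum_list g - even_part g" if "odd (length g)" "x \<in> set (parts_of_word g)" for x g
    using that
  proof (induction g rule: parts_of_word.induct)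
    case (3 b a g)
    then show ?case
      using even_part_le[of g] by (auto split: if_splits)
  qed auto
  moreover have "sorted_wrt (\<ge>) (replicate b c)" for b c :: nat
    by (induction b) auto
  ultimately show "odd (length g) \<Longrightarrow> sorted_wrt (\<ge>) (parts_of_word g)"
    by (induction g rule: parts_of_word.induct) (auto simp: sorted_wrt_append trans_le_add2)
qed

text \<open>For \<open>\<phi> d = ln (q ^ d - 1 / q ^ d)\<close> this is the logarithm of
  \<open>H k\<close>.\<close>

definition double_sum :: "(nat \<Rightarrow> real) \<Rightarrow> nat \<Rightarrow> real" where
  "double_sum \<phi> k = (\<Sum>j<k. \<Sum>i<j. \<phi> (j - i))"

lemma sum_reversed_interval:
  fixes f :: "nat \<Rightarrow> real"
  shows "(\<Sum>x\<leftarrow>rev [m..<m + b]. f x) = (\<Sum>i<b. f (m + i))"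
  by (induction b) (auto simp: rev_map[symmetric])

lemma double_sum_Suc: "double_sum \<phi> (Suc k) = double_sum \<phi> k + (\<Sum>d<k. \<phi> (Suc d))"
proof -
  have "(\<Sum>i<k. \<phi> (k - i)) = (\<Sum>d<k. \<phi> (Suc d))"
    by (rule sum.reindex_bij_witness[of _ "\<lambda>d. k - Suc d" "\<lambda>i. k - Suc i"])
      (auto simp: Suc_diff_Suc)
  then show ?thesis
    by (simp add: double_sum_def)
qed

lemma pair_sum_interval: "pair_sum (\<lambda>x y. \<phi> (x - y)) (rev [m..<m + b]) = double_sum \<phi> b"
proof (induction b)
  case (Suc b)
  have "(\<Sum>y\<leftarrow>rev [m..<m + b]. \<phi> (m + b - y)) = (\<Sum>d<b. \<phi> (b - d))"
    by (subst sum_reversed_interval) simp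
  then show ?case
    using Suc by (simp add: double_sum_def)
qed (simp add: double_sum_def)

text \<open>Inclusion-exclusion in a stretch of length \<open>a + b + c\<close>: the pairs inside
  it, minus those inside its parts of length \<open>a + c\<close> and \<open>a + b\<close>, plus
  those inside the gap of length \<open>a\<close>, are the pairs with one member in each outer
  block.\<close>

lemma sum_between_intervals:
  "(\<Sum>x\<leftarrow>rev [m + c + a..<m + c + a + b]. \<Sum>y\<leftarrow>rev [m..<m + c]. \<phi> (x - y)) =
    double_sum \<phi> a - double_sum \<phi> (a + c) - double_sum \<phi> (a + b) + double_sum \<phi> (a + b + c)"
proof -
  have "(\<Sum>j<c. \<phi> (c + k - j)) = (\<Sum>d<k + c. \<phi> (Suc d)) - (\<Sum>d<k. \<phi> (Suc d))" for k
  proof (induction c)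
    case (Suc c)
    have "(\<Sum>j<Suc c. \<phi> (Suc c + k - j)) = \<phi> (Suc (k + c)) + (\<Sum>j<c. \<phi> (c + k - j))"
      by (simp add: sum.lessThan_Suc_shift add.commute del: sum.lessThan_Suc)
    then show ?case
      using Suc by simp
  qed simp
  then have inner: "(\<Sum>j<c. \<phi> (c + a + i - j)) =
      (\<Sum>d<a + i + c. \<phi> (Suc d)) - (\<Sum>d<a + i. \<phi> (Suc d))" for i
    by (simp add: add.assoc)
  have "(\<Sum>x\<leftarrow>rev [m + c + a..<m + c + a + b]. \<Sum>y\<leftarrow>rev [m..<m + c]. \<phi> (x - y)) =
      (\<Sum>i<b. (\<Sum>d<a + i + c. \<phi> (Suc d)) - (\<Sum>d<a + i. \<phi> (Suc d)))"
    unfolding sum_reversed_interval inner[symmetric] by (simp add: add.assoc)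
  also have "\<dots> = double_sum \<phi> a - double_sum \<phi> (a + c) - double_sum \<phi> (a + b) + double_sum \<phi> (a + b + c)"
    by (induction b) (simp_all add: double_sum_Suc)
  finally show ?thesis .
qed

text \<open>Each block of \<open>g\<close> contributes the four terms of
  \<open>sum_between_intervals\<close>, and these are two consecutive terms in each of the two
  alternating sums.\<close>

lemma sum_interval_beta_of_word:
  "odd (length g) \<Longrightarrow>
    (\<Sum>x\<leftarrow>rev [a + sum_list g..<a + sum_list g + b]. \<Sum>y\<leftarrow>beta_of_word g. \<phi> (x - y)) =
    alternating_sum (double_sum \<phi>) a g - alternating_sum (double_sum \<phi>) (a + b) g"
proof (induction g arbitrary: a rule: beta_of_word.induct)
  case (2 c)
  show ?case
    using sum_between_intervals[where m = 0 and c = c and a = a and b = b and \<phi> = \<phi>]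
    by (simp add: ac_simps)
next
  case (3 c d g)
  have g: "odd (length g)"
    using 3 by simp
  have "(\<Sum>x\<leftarrow>rev [a + sum_list (c # d # g)..<a + sum_list (c # d # g) + b].
        \<Sum>y\<leftarrow>beta_of_word (c # d # g). \<phi> (x - y)) =
      (\<Sum>x\<leftarrow>rev [d + sum_list g + c + a..<d + sum_list g + c + a + b].
        \<Sum>y\<leftarrow>rev [d + sum_list g..<d + sum_list g + c]. \<phi> (x - y)) +
      (\<Sum>x\<leftarrow>rev [(a + c + d) + sum_list g..<(a + c + d) + sum_list g + b].
        \<Sum>y\<leftarrow>beta_of_word g. \<phi> (x - y))"
    by (simp add: sum_list_addf ac_simps)
  then show ?case
    unfolding sum_between_intervals "3.IH"[OF g] by (simp add: ac_simps)
qed simp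

text \<open>The intervals that begin at the top block \<open>b\<close> or at the gap
  \<open>a\<close> below it account for the pairs inside the top block and for its pairs with the
  lower blocks.\<close>

lemma pair_sum_beta_of_word:
  "odd (length g) \<Longrightarrow>
    pair_sum (\<lambda>x y. \<phi> (x - y)) (beta_of_word g) = interval_sum (double_sum \<phi>) g"
proof (induction g rule: beta_of_word.induct)
  case (2 b)
  show ?case
    using pair_sum_interval[of \<phi> 0 b] by (simp add: double_sum_def)
next
  case (3 b a g)
  then have g: "odd (length g)"
    by simp
  show ?case
    unfolding beta_of_word.simps pair_sum_append pair_sum_interval sum_interval_beta_of_word[OF g]
      "3.IH"[OF g]
    by (simp add: add.commute[of a b])
qed simp

text \<open>Symmetrising \<open>q\<^sup>2\<^sup>x - q\<^sup>2\<^sup>y\<close> to \<open>q\<^sup>x\<^sup>-\<^sup>y - q\<^sup>y\<^sup>-\<^sup>x\<close> makes the factor depend on \<open>x - y\<close> only.\<close>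

lemma ln_vandermonde:
  fixes q :: real
  assumes q: "q > 1" and l: "\<And>i j. i < j \<Longrightarrow> j < n \<Longrightarrow> l j < l i"
  shows "vandermonde n (\<lambda>i. (q\<^sup>2) ^ l i) > 0"
    and "ln (vandermonde n (\<lambda>i. (q\<^sup>2) ^ l i)) =
      ln q * real (n - 1) * (\<Sum>i<n. real (l i)) +
      (\<Sum>j<n. \<Sum>i<j. ln (q ^ (l i - l j) - 1 / q ^ (l i - l j)))"
proof -
  have fact: "(q\<^sup>2) ^ l i - (q\<^sup>2) ^ l j = q ^ (l i + l j) * (q ^ (l i - l j) - 1 / q ^ (l i - l j))"
    "q ^ (l i - l j) - 1 / q ^ (l i - l j) > 0" if "i < j" "j < n" for i j
  proof -
    define d where "d = l i - l j"
    have d: "l i = l j + d" "d > 0"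
      using l[OF that] by (auto simp: d_def)
    then show "(q\<^sup>2) ^ l i - (q\<^sup>2) ^ l j = q ^ (l i + l j) * (q ^ (l i - l j) - 1 / q ^ (l i - l j))"
      using q by (simp add: power_add power_mult[symmetric] mult_2 mult_2_right field_simps
          power2_eq_square)
    have "1 < q ^ d"
      using q d by (simp add: one_less_power)
    then have "1 / q ^ d < 1"
      using q by (simp add: field_simps)
    then show "q ^ (l i - l j) - 1 / q ^ (l i - l j) > 0"
      using \<open>1 < q ^ d\<close> unfolding d_def[symmetric] by linarith
  qed
  have pos: "0 < (q\<^sup>2) ^ l i - (q\<^sup>2) ^ l j" if "i < j" "j < n" for i j
    unfolding fact(1)[OF that] using q by (intro mult_pos_pos fact(2)[OF that]) simp
  then show "vandermonde n (\<lambda>i. (q\<^sup>2) ^ l i) > 0"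
    unfolding vandermonde_def by (intro prod_pos) auto
  have "ln (vandermonde n (\<lambda>i. (q\<^sup>2) ^ l i)) =
      (\<Sum>j<n. \<Sum>i<j. ln ((q\<^sup>2) ^ l i - (q\<^sup>2) ^ l j))"
  proof -
    have "ln (\<Prod>i<j. (q\<^sup>2) ^ l i - (q\<^sup>2) ^ l j) = (\<Sum>i<j. ln ((q\<^sup>2) ^ l i - (q\<^sup>2) ^ l j))"
      if "j < n" for j
      using pos[OF _ that] by (intro ln_prod) force+
    moreover have "(\<Prod>i<j. (q\<^sup>2) ^ l i - (q\<^sup>2) ^ l j) > 0" if "j < n" for j
      using pos[OF _ that] by (intro prod_pos) auto
    moreover have "ln (\<Prod>j<n. P j) = (\<Sum>j<n. ln (P j))" if "\<And>j. j < n \<Longrightarrow> P j > 0" for P :: "nat \<Rightarrow> real"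
      using that by (intro ln_prod) (auto simp: less_imp_neq[symmetric])
    ultimately show ?thesis
      unfolding vandermonde_def by simp
  qed
  also have "\<dots> = (\<Sum>j<n. \<Sum>i<j. ln q * (real (l i) + real (l j)) +
      ln (q ^ (l i - l j) - 1 / q ^ (l i - l j)))"
  proof (intro sum.cong refl)
    fix i j assume "j \<in> {..<n}" "i \<in> {..<j}"
    then have ij: "i < j" "j < n"
      by auto
    show "ln ((q\<^sup>2) ^ l i - (q\<^sup>2) ^ l j) = ln q * (real (l i) + real (l j)) +
        ln (q ^ (l i - l j) - 1 / q ^ (l i - l j))"
      unfolding fact(1)[OF ij] using q fact(2)[OF ij]
      by (subst ln_mult) (simp_all add: ln_realpow algebra_simps)
  qed
  also have "\<dots> = ln q * (\<Sum>j<n. \<Sum>i<j. real (l i) + real (l j)) +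
      (\<Sum>j<n. \<Sum>i<j. ln (q ^ (l i - l j) - 1 / q ^ (l i - l j)))"
    by (simp only: sum_distrib_left sum.distrib[symmetric])
  \<comment> \<open>Each index belongs to \<open>n - 1\<close> pairs. The induction treats
    \<open>n = 0\<close> apart because \<open>n - 1\<close> is then 0 as a natural number.\<close>
  also have "(\<Sum>j<n. \<Sum>i<j. real (l i) + real (l j)) = real (n - 1) * (\<Sum>i<n. real (l i))"
  proof (induction n)
    case (Suc n)
    have "real (n - 1) * S + S = real n * S" if "n = 0 \<longrightarrow> S = 0" for S
      using that by (cases n) (simp_all add: algebra_simps)
    from this[of "\<Sum>i<n. real (l i)"] show ?case
      using Suc by (simp add: sum.distrib algebra_simps)
  qed simp
  finally show "ln (vandermonde n (\<lambda>i. (q\<^sup>2) ^ l i)) =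
      ln q * real (n - 1) * (\<Sum>i<n. real (l i)) +
      (\<Sum>j<n. \<Sum>i<j. ln (q ^ (l i - l j) - 1 / q ^ (l i - l j)))"
    by (simp add: mult.assoc)
qed

abbreviation nth_or_zero :: "nat list \<Rightarrow> nat \<Rightarrow> nat" where
  "nth_or_zero \<mu> i \<equiv> (if i < length \<mu> then \<mu> ! i else 0)"

text \<open>The quotient of the two Vandermonde products of \<open>schur_sum_eq\<close> at
  \<open>Q = q\<^sup>2\<close>. Symmetrising the factors contributes a power of \<open>q\<close>
  above and below; the staircase parts \<open>n - 1 - i\<close> of the exponents cancel, and
  \<open>(n - 1)\<close> times the size of the partition remains.\<close>

theorem schur_sum_word:
  fixes q :: real
  assumes q: "q > 1" and g: "odd (length g)"
  defines "n \<equiv> even_part g"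
  shows "schur_sum (q\<^sup>2) n (nth_or_zero (parts_of_word g)) =
    q ^ ((n - 1) * sum_list (parts_of_word g)) *
      exp (word_invariant (double_sum (\<lambda>d. ln (q ^ d - 1 / q ^ d))) g)"
proof -
  define \<phi> where "\<phi> = (\<lambda>d. ln (q ^ d - 1 / q ^ d))"
  define p where "p = nth_or_zero (parts_of_word g)"
  have len: "length (parts_of_word g) = n" "length (beta_of_word g) = n"
    by (simp_all add: n_def g length_parts_of_word length_beta_of_word)
  have p_dec: "p j \<le> p i" if "i \<le> j" for i j
    using sorted_parts_of_word[OF g] that
    by (cases "i = j") (auto simp: p_def sorted_wrt_iff_nth_less)
  have beta: "beta_of_word g ! i = p i + (n - 1 - i)" if "i < n" for i
    using that beta_of_word_nth[OF g] len by (simp add: p_def n_def)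
  have eq: "schur_sum (q\<^sup>2) n p * vandermonde n (\<lambda>i. (q\<^sup>2) ^ (n - 1 - i)) =
      vandermonde n (\<lambda>i. (q\<^sup>2) ^ (p i + (n - 1 - i)))"
    using q p_dec by (intro schur_sum_eq) (auto simp: antimono_def p_def len)
  have 1: "vandermonde n (\<lambda>i. (q\<^sup>2) ^ (n - 1 - i)) > 0"
    "ln (vandermonde n (\<lambda>i. (q\<^sup>2) ^ (n - 1 - i))) =
      ln q * real (n - 1) * (\<Sum>i<n. real (n - 1 - i)) + double_sum \<phi> n"
  proof -
    have "(\<Sum>j<n. \<Sum>i<j. ln (q ^ (n - 1 - i - (n - 1 - j)) - 1 / q ^ (n - 1 - i - (n - 1 - j)))) =
        double_sum \<phi> n"
      unfolding double_sum_def \<phi>_def by (intro sum.cong refl) simp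
    then show "vandermonde n (\<lambda>i. (q\<^sup>2) ^ (n - 1 - i)) > 0"
      "ln (vandermonde n (\<lambda>i. (q\<^sup>2) ^ (n - 1 - i))) =
      ln q * real (n - 1) * (\<Sum>i<n. real (n - 1 - i)) + double_sum \<phi> n"
      using ln_vandermonde[OF q, of n "\<lambda>i. n - 1 - i"] by auto
  qed
  have 2: "vandermonde n (\<lambda>i. (q\<^sup>2) ^ (p i + (n - 1 - i))) > 0"
    "ln (vandermonde n (\<lambda>i. (q\<^sup>2) ^ (p i + (n - 1 - i)))) =
      ln q * real (n - 1) * (\<Sum>i<n. real (p i + (n - 1 - i))) + interval_sum (double_sum \<phi>) g"
  proof -
    have "(\<Sum>j<n. \<Sum>i<j. ln (q ^ (p i + (n - 1 - i) - (p j + (n - 1 - j))) -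
        1 / q ^ (p i + (n - 1 - i) - (p j + (n - 1 - j))))) =
        pair_sum (\<lambda>x y. \<phi> (x - y)) (beta_of_word g)"
      unfolding pair_sum_nth len \<phi>_def by (intro sum.cong refl) (simp add: beta)
    moreover have "p j + (n - 1 - j) < p i + (n - 1 - i)" if "i < j" "j < n" for i j
      using p_dec[of i j] that by linarith
    ultimately show "vandermonde n (\<lambda>i. (q\<^sup>2) ^ (p i + (n - 1 - i))) > 0"
      "ln (vandermonde n (\<lambda>i. (q\<^sup>2) ^ (p i + (n - 1 - i)))) =
      ln q * real (n - 1) * (\<Sum>i<n. real (p i + (n - 1 - i))) + interval_sum (double_sum \<phi>) g"
      using ln_vandermonde[OF q, of n "\<lambda>i. p i + (n - 1 - i)"]
      by (auto simp: pair_sum_beta_of_word[OF g])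
  qed
  have pos: "schur_sum (q\<^sup>2) n p > 0"
    using 1(1) 2(1) unfolding eq[symmetric] by (simp add: zero_less_mult_iff)
  have "ln (schur_sum (q\<^sup>2) n p) + ln (vandermonde n (\<lambda>i. (q\<^sup>2) ^ (n - 1 - i))) =
      ln (vandermonde n (\<lambda>i. (q\<^sup>2) ^ (p i + (n - 1 - i))))"
    unfolding eq[symmetric] using pos 1(1) by (simp add: ln_mult)
  moreover have "(\<Sum>i<n. real (p i + (n - 1 - i))) = (\<Sum>i<n. real (p i)) + (\<Sum>i<n. real (n - 1 - i))"
    by (simp only: of_nat_add sum.distrib)
  ultimately have "ln (schur_sum (q\<^sup>2) n p) =
      ln q * real (n - 1) * (\<Sum>i<n. real (p i)) + word_invariant (double_sum \<phi>) g"
    unfolding 1(2) 2(2) word_invariant_def n_def[symmetric] by (simp only: distrib_left)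
  also have "(\<Sum>i<n. real (p i)) = real (sum_list (parts_of_word g))"
    by (simp add: sum_list_sum_nth p_def len atLeast0LessThan)
  finally have "ln (schur_sum (q\<^sup>2) n p) =
      ln (q ^ ((n - 1) * sum_list (parts_of_word g))) + word_invariant (double_sum \<phi>) g"
    using q by (simp add: ln_realpow)
  then have "schur_sum (q\<^sup>2) n p =
      exp (ln (q ^ ((n - 1) * sum_list (parts_of_word g))) + word_invariant (double_sum \<phi>) g)"
    using pos by (metis exp_ln)
  then show ?thesis
    using q by (simp add: exp_add p_def \<phi>_def)
qed

section \<open>Semisimplicity and weights of representations of SL2\<close>

definition diag_sl2 :: "complex \<Rightarrow> complex ^ 2 ^ 2" where
  "diag_sl2 t = vector [vector [t, 0], vector [0, 1 / t]]"

definition upper_sl2 :: "complex \<Rightarrow> complex ^ 2 ^ 2" where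
  "upper_sl2 b = vector [vector [1, b], vector [0, 1]]"

definition adjoint_mat :: "complex ^ 2 ^ 2 \<Rightarrow> complex ^ 2 ^ 2" where
  "adjoint_mat A = (\<chi> i j. cnj (A $ j $ i))"

lemma diag_sl2_in_SL2: "t \<noteq> 0 \<Longrightarrow> diag_sl2 t \<in> SL2"
  by (simp add: SL2_def det_2 diag_sl2_def)

lemma upper_sl2_in_SL2: "upper_sl2 b \<in> SL2"
  by (simp add: SL2_def det_2 upper_sl2_def)

lemma adjoint_mat_in_SL2: "A \<in> SL2 \<Longrightarrow> adjoint_mat A \<in> SL2"
proof -
  have "det (adjoint_mat A) = cnj (det A)"
    by (simp add: det_2 adjoint_mat_def mult.commute)
  then show "A \<in> SL2 \<Longrightarrow> adjoint_mat A \<in> SL2"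
    by (simp add: SL2_def)
qed

lemma matrix_mult_in_SL2: "A \<in> SL2 \<Longrightarrow> B \<in> SL2 \<Longrightarrow> A ** B \<in> SL2"
  by (simp add: SL2_def det_mul)

lemma mat_1_in_SL2: "mat 1 \<in> SL2"
  by (simp add: SL2_def)

lemma adjoint_mat_adjoint [simp]: "adjoint_mat (adjoint_mat A) = A"
  by (simp add: adjoint_mat_def Finite_Cartesian_Product.vec_eq_iff)

text \<open>The lower unipotent factor is written as the adjoint of an upper one, so that in an
  inner product it passes to the other argument as an upper one.\<close>

lemma gauss_decomposition:
  assumes "A \<in> SL2" "A $ 1 $ 1 \<noteq> 0"
  shows "A = adjoint_mat (upper_sl2 (cnj (A $ 2 $ 1 / A $ 1 $ 1))) **
    (diag_sl2 (A $ 1 $ 1) ** upper_sl2 (A $ 1 $ 2 / A $ 1 $ 1))"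
  using assms
  by (simp add: Finite_Cartesian_Product.vec_eq_iff forall_2 adjoint_mat_def upper_sl2_def diag_sl2_def
      matrix_matrix_mult_def sum_2 SL2_def det_2 field_simps)

text \<open>A representation of \<open>SL2\<close> in the functions on an index type, given by its matrix coefficients
  \<open>K A x y\<close> with respect to an orthonormal basis of weight vectors. The basis is partitioned into
  finite classes whose spans are invariant.\<close>

locale sl2_kernel =
  fixes K :: "complex ^ 2 ^ 2 \<Rightarrow> 'a \<Rightarrow> 'a \<Rightarrow> complex"
    and cls :: "'a \<Rightarrow> 'a set"
    and wt :: "'a \<Rightarrow> int"
  assumes finite_cls: "finite (cls x)"
    and cls_refl: "x \<in> cls x"
    and cls_eq: "y \<in> cls x \<Longrightarrow> cls y = cls x"
    and K_cls: "y \<notin> cls x \<Longrightarrow> K A x y = 0"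
    and K_mult: "K (A ** B) x z = (\<Sum>y\<in>cls x. K A x y * K B y z)"
    and K_one: "K (mat 1) x y = (if x = y then 1 else 0)"
    and K_adjoint: "K (adjoint_mat A) x y = cnj (K A y x)"
    and K_diag: "t \<noteq> 0 \<Longrightarrow> K (diag_sl2 t) x y = (if x = y then t powi wt x else 0)"
    and K_upper: "K (upper_sl2 b) x y \<noteq> 0 \<Longrightarrow> x = y \<or> wt y < wt x"
    and K_upper_refl: "K (upper_sl2 b) x x = 1"
    and K_continuous: "continuous_on UNIV (\<lambda>A. K A x y)"
begin

definition rho :: "complex ^ 2 ^ 2 \<Rightarrow> ('a \<Rightarrow> complex) \<Rightarrow> 'a \<Rightarrow> complex" where
  "rho A f = (\<lambda>x. \<Sum>y\<in>cls x. K A x y * f y)"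

definition weight_space :: "int \<Rightarrow> ('a \<Rightarrow> complex) set" where
  "weight_space k = {f. \<forall>x. f x \<noteq> 0 \<longrightarrow> wt x = k}"

definition weight_part :: "int \<Rightarrow> ('a \<Rightarrow> complex) \<Rightarrow> 'a \<Rightarrow> complex" where
  "weight_part k f = (\<lambda>x. if wt x = k then f x else 0)"

lemma rho_add: "rho A (f + g) = rho A f + rho A g"
  by (simp add: rho_def fun_eq_iff distrib_left sum.distrib)

lemma rho_scale: "rho A (cscale c f) = cscale c (rho A f)"
  by (simp add: rho_def cscale_def fun_eq_iff sum_distrib_left mult_ac)

lemma rho_zero: "rho A 0 = 0"
  by (simp add: rho_def fun_eq_iff)

lemma rho_mult: "rho (A ** B) f = rho A (rho B f)"
proof
  fix x
  have "rho (A ** B) f x = (\<Sum>y\<in>cls x. \<Sum>z\<in>cls x. K A x y * (K B y z * f z))"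
    unfolding rho_def K_mult sum_distrib_right by (subst sum.swap) (simp add: mult.assoc)
  also have "\<dots> = rho A (rho B f) x"
    unfolding rho_def by (intro sum.cong refl) (simp add: cls_eq sum_distrib_left)
  finally show "rho (A ** B) f x = rho A (rho B f) x" .
qed

lemma rho_one: "rho (mat 1) f = f"
  by (simp add: rho_def fun_eq_iff K_one cls_refl finite_cls if_distrib[of "\<lambda>c. c * z" for z]
      cong: if_cong)

lemma rho_diag: "t \<noteq> 0 \<Longrightarrow> rho (diag_sl2 t) f = (\<lambda>x. t powi wt x * f x)"
  by (simp add: rho_def fun_eq_iff K_diag cls_refl finite_cls if_distrib[of "\<lambda>c. c * z" for z]
      cong: if_cong)

lemma subspace_weight_space: "cfun.subspace (weight_space k)"
  by (auto simp: cfun.subspace_def weight_space_def cscale_def) (metis add_0)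

lemma weight_part_in: "weight_part k f \<in> weight_space k"
  by (auto simp: weight_part_def weight_space_def)

lemma weight_part_id: "f \<in> weight_space k \<Longrightarrow> weight_part k f = f"
  by (auto simp: weight_part_def weight_space_def fun_eq_iff)

end

text \<open>\<open>X\<close> is a finite union of classes. Functions supported in it form a
  finite-dimensional representation, and one \<open>X\<close> can be large enough for two modules
  that are to be compared.\<close>

locale sl2_space = sl2_kernel +
  fixes X :: "'a set"
  assumes finite_X: "finite X" and X_closed: "x \<in> X \<Longrightarrow> cls x \<subseteq> X"
begin

section \<open>Inner product, projections and dimensions\<close>

definition space :: "('a \<Rightarrow> complex) set" where
  "space = {f. \<forall>x. x \<notin> X \<longrightarrow> f x = 0}"

definition ip :: "('a \<Rightarrow> complex) \<Rightarrow> ('a \<Rightarrow> complex) \<Rightarrow> complex" where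
  "ip f g = (\<Sum>x\<in>X. f x * cnj (g x))"

definition submodule :: "('a \<Rightarrow> complex) set \<Rightarrow> bool" where
  "submodule M \<longleftrightarrow> cfun.subspace M \<and> M \<subseteq> space \<and> (\<forall>A\<in>SL2. \<forall>f\<in>M. rho A f \<in> M)"

definition module_iso ::
    "(('a \<Rightarrow> complex) \<Rightarrow> 'a \<Rightarrow> complex) \<Rightarrow> ('a \<Rightarrow> complex) set \<Rightarrow> ('a \<Rightarrow> complex) set \<Rightarrow> bool" where
  "module_iso \<phi> M N \<longleftrightarrow> bij_betw \<phi> M N \<and> (\<forall>x\<in>M. \<forall>y\<in>M. \<phi> (x + y) = \<phi> x + \<phi> y) \<and>
    (\<forall>c. \<forall>x\<in>M. \<phi> (cscale c x) = cscale c (\<phi> x)) \<and>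
    (\<forall>A\<in>SL2. \<forall>x\<in>M. \<phi> (rho A x) = rho A (\<phi> x))"

lemma ip_simps:
  "ip (f + g) k = ip f k + ip g k" "ip (f - g) k = ip f k - ip g k" "ip (cscale c f) k = c * ip f k"
  "ip k (f + g) = ip k f + ip k g" "ip k (f - g) = ip k f - ip k g"
  "ip k (cscale c f) = cnj c * ip k f" "ip 0 k = 0" "ip k 0 = 0"
  by (simp_all add: ip_def cscale_def algebra_simps sum.distrib sum_subtractf sum_distrib_left)

lemma ip_eq_0D:
  assumes "f \<in> space" "ip f f = 0"
  shows "f = 0"
proof -
  have "of_real (\<Sum>x\<in>X. (cmod (f x))\<^sup>2) = (0 :: complex)"
    using assms(2) unfolding ip_def by (simp only: of_real_sum complex_norm_square)
  then have "(\<Sum>x\<in>X. (cmod (f x))\<^sup>2) = 0"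
    by (simp only: of_real_eq_0_iff)
  then have "\<forall>x\<in>X. f x = 0"
    using finite_X by (simp add: sum_nonneg_eq_0_iff)
  with assms(1) show ?thesis
    by (auto simp: space_def fun_eq_iff)
qed

lemma subspace_space: "cfun.subspace space"
  by (auto simp: cfun.subspace_def space_def cscale_def)

lemma rho_in_space: "f \<in> space \<Longrightarrow> rho A f \<in> space"
proof -
  assume f: "f \<in> space"
  have "y \<notin> X" if "x \<notin> X" "y \<in> cls x" for x y
    using that X_closed[of y] cls_eq[of y x] cls_refl[of x] by blast
  then show "rho A f \<in> space"
    using f by (simp add: space_def rho_def)
qed

lemma rho_eq_sum_X: "x \<in> X \<Longrightarrow> rho A f x = (\<Sum>y\<in>X. K A x y * f y)"
  unfolding rho_def using X_closed by (intro sum.mono_neutral_left) (auto simp: finite_X K_cls)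

text \<open>The basis is orthonormal, so \<open>K_adjoint\<close> is the adjointness of the
  operators. This is what makes orthogonal complements of submodules invariant.\<close>

lemma ip_rho: "ip (rho A f) g = ip f (rho (adjoint_mat A) g)"
proof -
  have "ip (rho A f) g = (\<Sum>x\<in>X. \<Sum>y\<in>X. K A x y * f y * cnj (g x))"
    unfolding ip_def by (intro sum.cong refl) (simp add: rho_eq_sum_X sum_distrib_right)
  also have "\<dots> = (\<Sum>y\<in>X. \<Sum>x\<in>X. f y * cnj (K (adjoint_mat A) y x * g x))"
    by (subst sum.swap) (simp add: K_adjoint mult_ac)
  also have "\<dots> = ip f (rho (adjoint_mat A) g)"
    unfolding ip_def by (intro sum.cong refl) (simp add: rho_eq_sum_X sum_distrib_left)
  finally show ?thesis .
qed

lemma finite_basis: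
  assumes "cfun.subspace U" "U \<subseteq> space"
  obtains B where "finite B" "B \<subseteq> U" "cfun.independent B" "cfun.span B = U" "card B = cfun.dim U"
proof -
  have "space \<subseteq> cfun.span (unit_fun ` X)"
  proof
    fix f assume f: "f \<in> space"
    have "f = (\<Sum>x\<in>X. cscale (f x) (unit_fun x))"
    proof
      fix z
      have "(\<Sum>x\<in>S. g x) z = (\<Sum>x\<in>S. g x z)" if "finite S" for S and g :: "'a \<Rightarrow> 'a \<Rightarrow> complex"
        using that by (induction S rule: finite_induct) auto
      then show "f z = (\<Sum>x\<in>X. cscale (f x) (unit_fun x)) z"
        using f finite_X by (simp add: cscale_def unit_fun_def space_def if_distrib cong: if_cong)
    qed
    also have "\<dots> \<in> cfun.span (unit_fun ` X)"
      by (intro cfun.span_sum cfun.span_scale cfun.span_base) simp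
    finally show "f \<in> cfun.span (unit_fun ` X)" .
  qed
  then have U: "U \<subseteq> cfun.span (unit_fun ` X)"
    using assms by blast
  obtain B where B: "B \<subseteq> U" "cfun.independent B" "U \<subseteq> cfun.span B" "card B = cfun.dim U"
    using cfun.basis_exists by blast
  have "finite B"
    using cfun.independent_span_bound[OF _ B(2)] B(1) U finite_X by blast
  moreover have "cfun.span B = U"
    using B assms(1) by (simp add: cfun.span_subspace)
  ultimately show thesis
    using B that by blast
qed

text \<open>Gram-Schmidt, one spanning vector at a time: \<open>b'\<close> is the part of
  \<open>b\<close> orthogonal to the span of the earlier vectors, and \<open>b' = 0\<close> means
  that \<open>b\<close> adds nothing.\<close>

lemma orthogonal_projection:
  assumes "cfun.subspace L" "L \<subseteq> space" "f \<in> space"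
  shows "\<exists>l\<in>L. \<forall>m\<in>L. ip (f - l) m = 0"
proof -
  obtain B where B: "finite B" "B \<subseteq> L" "cfun.span B = L"
    using finite_basis[OF assms(1,2)] by metis
  have "\<forall>f\<in>space. \<exists>l\<in>cfun.span B. \<forall>m\<in>cfun.span B. ip (f - l) m = 0"
    using B(1) order.trans[OF B(2) assms(2)]
  proof (induction B rule: finite_induct)
    case empty
    then show ?case
      by (simp add: ip_simps del: zero_fun_apply)
  next
    case (insert b B)
    have b: "b \<in> space" and B: "B \<subseteq> space"
      using insert.prems by auto
    have span_B: "cfun.span B \<subseteq> space"
      by (rule cfun.span_minimal[OF B subspace_space])
    obtain l\<^sub>b where lb: "l\<^sub>b \<in> cfun.span B" "\<And>m. m \<in> cfun.span B \<Longrightarrow> ip (b - l\<^sub>b) m = 0"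
      using insert.IH[OF B] b by blast
    define b' where "b' = b - l\<^sub>b"
    show ?case
    proof (cases "ip b' b' = 0")
      case True
      have "b' \<in> space"
        unfolding b'_def using b lb(1) span_B by (intro cfun.subspace_diff[OF subspace_space]) auto
      then have "b = l\<^sub>b"
        using ip_eq_0D[OF _ True] by (simp add: b'_def)
      then have "cfun.span (insert b B) = cfun.span B"
        using lb(1) by (simp add: cfun.span_redundant)
      then show ?thesis
        using insert.IH[OF B] by simp
    next
      case False
      have sub: "cfun.span B \<subseteq> cfun.span (insert b B)"
        by (rule cfun.span_mono) blast
      have b': "b' \<in> cfun.span (insert b B)"
        unfolding b'_def using lb(1) sub by (intro cfun.span_diff) (auto intro: cfun.span_base)
      show ?thesis
      proof
        fix f assume "f \<in> space"
        then obtain l where l: "l \<in> cfun.span B" "\<And>m. m \<in> cfun.span B \<Longrightarrow> ip (f - l) m = 0"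
          using insert.IH[OF B] by blast
        define c where "c = ip (f - l) b' / ip b' b'"
        define l' where "l' = l + cscale c b'"
        have fl: "f - l' = f - l - cscale c b'"
          by (simp add: l'_def)
        have "ip (f - l') m = 0" if m_in: "m \<in> cfun.span (insert b B)" for m
        proof -
          obtain k where k: "m - cscale k b \<in> cfun.span B"
            using iffD1[OF cfun.span_breakdown_eq m_in] by (elim exE)
          define s where "s = m - cscale k b + cscale k l\<^sub>b"
          have s: "s \<in> cfun.span B"
            unfolding s_def using k lb(1) by (intro cfun.span_add cfun.span_scale)
          have m: "m = cscale k b' + s"
            by (simp add: s_def b'_def cscale_def fun_eq_iff algebra_simps)
          have "ip (f - l') s = 0" "ip (f - l') b' = 0"
            unfolding fl using l(2)[OF s] lb(2)[OF s] False
            by (simp_all add: ip_simps(2,3) b'_def[symmetric] c_def)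
          then show ?thesis
            unfolding m by (simp add: ip_simps)
        qed
        moreover have "l' \<in> cfun.span (insert b B)"
          unfolding l'_def using l(1) sub b' by (intro cfun.span_add cfun.span_scale) auto
        ultimately show "\<exists>l\<in>cfun.span (insert b B). \<forall>m\<in>cfun.span (insert b B). ip (f - l) m = 0"
          by blast
      qed
    qed
  qed
  then show ?thesis
    using B(3) assms(3) by blast
qed

lemma dim_eq_0_iff:
  assumes "cfun.subspace U" "U \<subseteq> space"
  shows "cfun.dim U = 0 \<longleftrightarrow> U = {0}"
proof
  assume "cfun.dim U = 0"
  then show "U = {0}"
    using finite_basis[OF assms] by (metis card_0_eq cfun.span_empty)
next
  assume "U = {0}"
  then show "cfun.dim U = 0"
    using cfun.dim_unique[of "{}" U 0] cfun.independent_empty by simp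
qed

lemma dim_direct_sum:
  assumes U: "cfun.subspace U" "U \<subseteq> space" and W: "cfun.subspace W" "W \<subseteq> space"
    and disjoint: "U \<inter> W \<subseteq> {0}" and V: "V = {u + w | u w. u \<in> U \<and> w \<in> W}"
  shows "cfun.dim V = cfun.dim U + cfun.dim W"
proof -
  obtain B where B: "finite B" "B \<subseteq> U" "cfun.independent B" "cfun.span B = U" "card B = cfun.dim U"
    by (rule finite_basis[OF U])
  obtain C where C: "finite C" "C \<subseteq> W" "cfun.independent C" "cfun.span C = W" "card C = cfun.dim W"
    by (rule finite_basis[OF W])
  have "0 \<notin> B"
    using B(3) cfun.dependent_zero by blast
  then have BC: "B \<inter> C = {}"
    using B(2) C(2) disjoint by blast
  have "cfun.independent (B \<union> C)"
  proof (rule cfun.independent_if_scalars_zero)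
    fix f x
    assume sum: "(\<Sum>x\<in>B \<union> C. cscale (f x) x) = 0" and x: "x \<in> B \<union> C"
    define b where "b = (\<Sum>x\<in>B. cscale (f x) x)"
    define c where "c = (\<Sum>x\<in>C. cscale (f x) x)"
    have "b + c = 0"
      using sum B(1) C(1) BC by (simp add: sum.union_disjoint b_def c_def)
    then have "b = - c"
      by (simp add: eq_neg_iff_add_eq_0)
    have "b \<in> U"
      unfolding b_def B(4)[symmetric] by (intro cfun.span_sum cfun.span_scale cfun.span_base)
    have "c \<in> W"
      unfolding c_def C(4)[symmetric] by (intro cfun.span_sum cfun.span_scale cfun.span_base)
    then have "b \<in> W"
      using \<open>b = - c\<close> cfun.subspace_neg[OF W(1)] by simp
    then have "b = 0" "c = 0"
      using \<open>b \<in> U\<close> disjoint \<open>b = - c\<close> by auto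
    then show "f x = 0"
      using x cfun.independentD[OF B(3) B(1) order_refl] cfun.independentD[OF C(3) C(1) order_refl]
      unfolding b_def c_def by blast
  qed (use B C in simp)
  moreover have "cfun.span (B \<union> C) = V"
    unfolding cfun.span_Un B(4) C(4) V by blast
  ultimately have "cfun.dim V = card (B \<union> C)"
    by (metis cfun.dim_span_eq_card_independent)
  then show ?thesis
    using BC B C by (simp add: card_Un_disjoint)
qed

lemma dim_bij_linear:
  assumes U: "cfun.subspace U" "U \<subseteq> space" and \<phi>: "bij_betw \<phi> U V"
    and add: "\<And>x y. x \<in> U \<Longrightarrow> y \<in> U \<Longrightarrow> \<phi> (x + y) = \<phi> x + \<phi> y"
    and scale: "\<And>c x. x \<in> U \<Longrightarrow> \<phi> (cscale c x) = cscale c (\<phi> x)"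
  shows "cfun.dim V = cfun.dim U"
proof -
  obtain B where B: "finite B" "B \<subseteq> U" "cfun.independent B" "cfun.span B = U" "card B = cfun.dim U"
    by (rule finite_basis[OF U])
  have zero: "\<phi> 0 = 0"
    using scale[of 0 0] cfun.subspace_0[OF U(1)] by simp
  have sum: "\<phi> (\<Sum>b\<in>S. cscale (f b) b) = (\<Sum>b\<in>S. cscale (f b) (\<phi> b))" if "S \<subseteq> B" for S f
  proof -
    have "finite S"
      using that B(1) finite_subset by blast
    then show ?thesis
      using that
    proof (induction S rule: finite_induct)
      case (insert b S)
      have "(\<Sum>b\<in>S. cscale (f b) b) \<in> U"
        using insert.prems B(2) by (intro cfun.subspace_sum[OF U(1)] cfun.subspace_scale[OF U(1)]) auto
      moreover have "b \<in> U"
        using insert.prems B(2) by auto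
      ultimately show ?case
        using insert by (simp add: add scale cfun.subspace_scale[OF U(1)] del: plus_fun_apply)
    qed (simp add: zero)
  qed
  have inj: "inj_on \<phi> B"
    using \<phi> B(2) by (meson bij_betw_def inj_on_subset)
  have "cfun.independent (\<phi> ` B)"
  proof (rule cfun.independent_if_scalars_zero)
    fix f x
    assume "(\<Sum>y\<in>\<phi> ` B. cscale (f y) y) = 0" and x: "x \<in> \<phi> ` B"
    then have "\<phi> (\<Sum>b\<in>B. cscale (f (\<phi> b)) b) = \<phi> 0"
      using sum[of B "\<lambda>b. f (\<phi> b)"] by (simp add: sum.reindex[OF inj] zero)
    moreover have "(\<Sum>b\<in>B. cscale (f (\<phi> b)) b) \<in> U"
      using B(2) by (intro cfun.subspace_sum[OF U(1)] cfun.subspace_scale[OF U(1)]) auto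
    ultimately have "(\<Sum>b\<in>B. cscale (f (\<phi> b)) b) = 0"
      using \<phi> cfun.subspace_0[OF U(1)] by (meson bij_betw_def inj_onD)
    then show "f x = 0"
      using x cfun.independentD[OF B(3) B(1) order_refl, of "\<lambda>b. f (\<phi> b)"] by blast
  qed (use B in simp)
  moreover have "\<phi> ` B \<subseteq> V"
    using B(2) \<phi> by (auto simp: bij_betw_def)
  moreover have "V \<subseteq> cfun.span (\<phi> ` B)"
  proof
    fix v assume "v \<in> V"
    then obtain u where "u \<in> U" "v = \<phi> u"
      using \<phi> by (auto simp: bij_betw_def)
    moreover obtain f where "u = (\<Sum>b\<in>B. cscale (f b) b)"
      using \<open>u \<in> U\<close> unfolding B(4)[symmetric] cfun.span_finite[OF B(1)] by blast
    ultimately have "v = (\<Sum>b\<in>B. cscale (f b) (\<phi> b))"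
      using sum[of B f] by simp
    also have "\<dots> \<in> cfun.span (\<phi> ` B)"
      by (intro cfun.span_sum cfun.span_scale cfun.span_base) simp
    finally show "v \<in> cfun.span (\<phi> ` B)" .
  qed
  ultimately have "cfun.dim V = card (\<phi> ` B)"
    by (metis cfun.dim_unique)
  then show ?thesis
    using inj B(5) by (simp add: card_image)
qed

text \<open>Lagrange interpolation in the operator \<open>rho (diag_sl2 2)\<close>. Its eigenvalues
  \<open>2 powi wt x\<close> are distinct for distinct weights, so the product over the other
  weights of \<open>X\<close> kills all components but one, which it scales by a nonzero
  number.\<close>

lemma weight_part_in_submodule:
  assumes M: "submodule M" and f: "f \<in> M"
  shows "weight_part k f \<in> M"
proof -
  have sub: "cfun.subspace M" and "f \<in> space"
    using M f by (auto simp: submodule_def)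
  have "(\<lambda>x. (\<Prod>j\<in>J. 2 powi wt x - 2 powi j) * f x) \<in> M" if "finite J" for J
    using that
  proof (induction J rule: finite_induct)
    case (insert j J)
    let ?g = "\<lambda>x. (\<Prod>j\<in>J. 2 powi wt x - 2 powi j) * f x"
    have "rho (diag_sl2 2) ?g - cscale (2 powi j) ?g \<in> M"
      using M insert.IH diag_sl2_in_SL2[of 2]
      by (intro cfun.subspace_diff[OF sub] cfun.subspace_scale[OF sub]) (auto simp: submodule_def)
    also have "rho (diag_sl2 2) ?g - cscale (2 powi j) ?g =
        (\<lambda>x. (\<Prod>j\<in>insert j J. 2 powi wt x - 2 powi j) * f x)"
      using insert.hyps by (simp add: rho_diag cscale_def fun_eq_iff algebra_simps)
    finally show ?case .
  qed (use f in simp)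
  from this[of "wt ` X - {k}"] have
    "(\<lambda>x. (\<Prod>j\<in>wt ` X - {k}. 2 powi wt x - 2 powi j) * f x) \<in> M"
    using finite_X by simp
  also have "(\<lambda>x. (\<Prod>j\<in>wt ` X - {k}. 2 powi wt x - 2 powi j) * f x) =
      cscale (\<Prod>j\<in>wt ` X - {k}. 2 powi k - 2 powi j) (weight_part k f)"
  proof
    fix x
    show "(\<Prod>j\<in>wt ` X - {k}. 2 powi wt x - 2 powi j) * f x =
        cscale (\<Prod>j\<in>wt ` X - {k}. 2 powi k - 2 powi j) (weight_part k f) x"
    proof (cases "wt x = k \<or> f x = 0")
      case False
      then have "wt x \<in> wt ` X - {k}"
        using \<open>f \<in> space\<close> by (auto simp: space_def)
      then have "(\<Prod>j\<in>wt ` X - {k}. 2 powi wt x - 2 powi j) = (0 :: complex)"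
        using finite_X by (intro prod_zero) auto
      then show ?thesis
        using False by (simp add: cscale_def weight_part_def)
    qed (auto simp: cscale_def weight_part_def)
  qed
  finally have *: "cscale (\<Prod>j\<in>wt ` X - {k}. 2 powi k - 2 powi j) (weight_part k f) \<in> M" .
  have "2 powi k - 2 powi j \<noteq> (0 :: complex)" if "j \<noteq> k" for j k :: int
  proof
    assume "2 powi k - 2 powi j = (0 :: complex)"
    then have "of_real (2 powi k) = (of_real (2 powi j) :: complex)"
      by simp
    then have "2 powi k = (2 powi j :: real)"
      by (simp only: of_real_eq_iff)
    then show False
      using that power_int_strict_increasing[of k j "2 :: real"]
        power_int_strict_increasing[of j k "2 :: real"] by (cases "j < k") auto
  qed
  then have "(\<Prod>j\<in>wt ` X - {k}. 2 powi k - 2 powi j) \<noteq> (0 :: complex)"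
    using finite_X by (auto simp: prod_zero_iff)
  with cfun.subspace_scale[OF sub *, of "inverse (\<Prod>j\<in>wt ` X - {k}. 2 powi k - 2 powi j)"]
  show ?thesis
    by simp
qed

text \<open>An upper unipotent matrix changes \<open>x\<close> only by components of weight above
  \<open>k\<close>. These are weight parts of an element of \<open>M\<close>, hence 0 by
  \<open>top\<close>.\<close>

lemma rho_upper_highest:
  assumes M: "submodule M" and x: "x \<in> M" "x \<in> weight_space k"
    and top: "\<And>j. k < j \<Longrightarrow> M \<inter> weight_space j = {0}"
  shows "rho (upper_sl2 b) x = x"
proof -
  let ?g = "rho (upper_sl2 b) x - x"
  have "?g \<in> M"
    using M x upper_sl2_in_SL2 by (auto simp: submodule_def intro!: cfun.subspace_diff)
  have low: "?g y = 0" if "wt y \<le> k" for y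
  proof -
    have "K (upper_sl2 b) y z * x z = (if y = z then x z else 0)" if "z \<in> cls y" for z
    proof (cases "y = z \<or> x z = 0")
      case False
      then have "wt z = k"
        using x(2) by (simp add: weight_space_def)
      then have "K (upper_sl2 b) y z = 0"
        using K_upper[of b y z] False \<open>wt y \<le> k\<close> by linarith
      then show ?thesis
        using False by simp
    qed (auto simp: K_upper_refl)
    then show ?thesis
      by (simp add: rho_def cls_refl finite_cls cong: sum.cong)
  qed
  have "?g y = 0" for y
  proof (cases "wt y \<le> k")
    case False
    have "weight_part (wt y) ?g \<in> M \<inter> weight_space (wt y)"
      using weight_part_in_submodule[OF M \<open>?g \<in> M\<close>] weight_part_in by blast
    then have "weight_part (wt y) ?g y = 0"
      using top[of "wt y"] False by (metis not_le singletonD zero_fun_apply)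
    then show ?thesis
      by (simp add: weight_part_def)
  qed (rule low)
  then show ?thesis
    by (simp add: fun_eq_iff)
qed

text \<open>In the Gauss decomposition the upper factor fixes \<open>x\<close>, the diagonal factor
  scales it, and the lower factor moves to the second argument, where it becomes an upper factor and
  fixes \<open>x\<close> again.\<close>

lemma matrix_coefficient_highest:
  assumes "A \<in> SL2" "A $ 1 $ 1 \<noteq> 0" "x \<in> weight_space k" "\<And>b. rho (upper_sl2 b) x = x"
  shows "ip (rho A x) x = (A $ 1 $ 1) powi k * ip x x"
proof -
  have "rho (diag_sl2 (A $ 1 $ 1)) x = cscale ((A $ 1 $ 1) powi k) x"
    using assms(2,3) by (auto simp: rho_diag weight_space_def cscale_def fun_eq_iff)
  then show ?thesis
    by (subst gauss_decomposition[OF assms(1,2)]) (simp add: rho_mult ip_rho assms(4) ip_simps)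
qed

text \<open>Both sides are continuous in \<open>A\<close>, and the matrices with nonzero first entry are dense.\<close>

lemma matrix_coefficients_proportional:
  assumes A: "A \<in> SL2" and x: "x \<in> weight_space k" "\<And>b. rho (upper_sl2 b) x = x"
    and y: "y \<in> weight_space k" "\<And>b. rho (upper_sl2 b) y = y"
  shows "ip (rho A x) x * ip y y = ip (rho A y) y * ip x x"
proof -
  define F where "F = (\<lambda>A. ip (rho A x) x * ip y y - ip (rho A y) y * ip x x)"
  have F0: "F B = 0" if "B \<in> SL2" "B $ 1 $ 1 \<noteq> 0" for B
    unfolding F_def matrix_coefficient_highest[OF that x] matrix_coefficient_highest[OF that y] by simp
  have "F A = 0"
  proof (cases "A $ 1 $ 1 = 0")
    case True
    \<comment> \<open>\<open>B \<epsilon>\<close> has the first entry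
      \<open>A $ 1 $ 2 * cnj \<epsilon>\<close>, where \<open>A $ 1 $ 2\<close> is nonzero because
      \<open>det A = 1\<close>. It tends to \<open>A\<close> as \<epsilon> tends to 0.\<close>
    define B where "B = (\<lambda>\<epsilon>. A ** adjoint_mat (upper_sl2 \<epsilon>))"
    have "A $ 1 $ 2 \<noteq> 0"
      using A True by (auto simp: SL2_def det_2)
    then have "B \<epsilon> $ 1 $ 1 \<noteq> 0" if "\<epsilon> \<noteq> 0" for \<epsilon>
      using True that
      by (simp add: B_def matrix_matrix_mult_def sum_2 adjoint_mat_def upper_sl2_def)
    moreover have "B \<epsilon> \<in> SL2" for \<epsilon>
      using A by (simp add: B_def matrix_mult_in_SL2 adjoint_mat_in_SL2 upper_sl2_in_SL2)
    ultimately have zero: "F (B \<epsilon>) = 0" if "\<epsilon> \<noteq> 0" for \<epsilon>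
      using F0 that by blast
    have "continuous_on UNIV (\<lambda>\<epsilon>. adjoint_mat (upper_sl2 \<epsilon>) $ i $ j)" for i j
      using exhaust_2[of i] exhaust_2[of j]
      by (elim disjE) (simp_all add: adjoint_mat_def upper_sl2_def continuous_on_cnj)
    note entry = this
    have "continuous_on UNIV B"
      unfolding B_def matrix_matrix_mult_def
      by (intro continuous_on_vec_lambda continuous_on_sum continuous_on_mult continuous_on_const entry)
    moreover have "continuous_on UNIV F"
      unfolding F_def ip_def rho_def by (intro continuous_intros K_continuous)
    ultimately have "continuous_on UNIV (\<lambda>\<epsilon>. F (B \<epsilon>))"
      by (metis continuous_on_compose2 subset_UNIV)
    then have "((\<lambda>\<epsilon>. F (B \<epsilon>)) \<longlongrightarrow> F (B 0)) (at 0)"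
      by (simp add: continuous_on_def)
    moreover have "((\<lambda>\<epsilon>. F (B \<epsilon>)) \<longlongrightarrow> 0) (at 0)"
      using zero by (intro tendsto_eventually) (auto simp: eventually_at_filter)
    ultimately have "F (B 0) = 0"
      by (metis tendsto_unique at_neq_bot)
    moreover have "adjoint_mat (upper_sl2 0) = mat 1"
      by (simp add: Finite_Cartesian_Product.vec_eq_iff forall_2 adjoint_mat_def upper_sl2_def Finite_Cartesian_Product.mat_def)
    ultimately show ?thesis
      by (simp add: B_def)
  qed (use F0 A in blast)
  then show ?thesis
    by (simp add: F_def)
qed

section \<open>Cyclic submodules\<close>

definition combination :: "(complex \<times> (complex ^ 2 ^ 2)) list \<Rightarrow> ('a \<Rightarrow> complex) \<Rightarrow> 'a \<Rightarrow> complex" where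
  "combination cs x = (\<Sum>(c, A)\<leftarrow>cs. cscale c (rho A x))"

text \<open>A list of pairs stands for an element of the group algebra of \<open>SL2\<close>. The
  same list can be applied to another vector, and this is how cyclic modules are mapped to each
  other.\<close>

definition cyclic :: "('a \<Rightarrow> complex) \<Rightarrow> ('a \<Rightarrow> complex) set" where
  "cyclic x = {combination cs x | cs. snd ` set cs \<subseteq> SL2}"

lemma combination_simps:
  "combination [] x = 0"
  "combination ((c, A) # cs) x = cscale c (rho A x) + combination cs x"
  "combination (cs @ ds) x = combination cs x + combination ds x"
  by (simp_all add: combination_def del: plus_fun_apply zero_fun_apply)

lemma combination_scale: "combination (map (\<lambda>(c, A). (d * c, A)) cs) x = cscale d (combination cs x)"
  by (induction cs) (auto simp: combination_simps cscale_def fun_eq_iff algebra_simps)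

lemma combination_rho: "combination (map (\<lambda>(c, A). (c, B ** A)) cs) x = rho B (combination cs x)"
  by (induction cs) (auto simp: combination_simps rho_zero rho_add rho_scale rho_mult
      simp del: plus_fun_apply zero_fun_apply)

lemma ip_combination:
  "ip (combination cs x) (combination ds x) =
    (\<Sum>(c, A)\<leftarrow>cs. \<Sum>(d, D)\<leftarrow>ds. c * cnj d * ip (rho (adjoint_mat D ** A) x) x)"
proof (induction cs)
  case (Cons p cs)
  obtain c A where p: "p = (c, A)"
    by (cases p)
  have "ip (rho A x) (combination ds x) =
      (\<Sum>(d, D)\<leftarrow>ds. cnj d * ip (rho (adjoint_mat D ** A) x) x)"
  proof (induction ds)
    case (Cons p ds)
    have "ip (rho A x) (rho D x) = ip (rho (adjoint_mat D ** A) x) x" for D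
      by (simp add: rho_mult ip_rho[of "adjoint_mat D"])
    then show ?case
      using Cons by (cases p) (simp add: combination_simps ip_simps del: plus_fun_apply)
  qed (simp add: combination_simps ip_simps del: zero_fun_apply)
  then show ?case
    using Cons
    by (simp add: p combination_simps ip_simps sum_list_const_mult[symmetric] case_prod_unfold mult.assoc
        del: plus_fun_apply zero_fun_apply)
qed (simp add: combination_simps ip_simps del: zero_fun_apply)

lemma submodule_cyclic:
  assumes "x \<in> space"
  shows "submodule (cyclic x)" and "x \<in> cyclic x"
proof -
  have "combination cs x \<in> space" for cs
    by (induction cs) (auto simp: combination_simps rho_in_space assms
        intro!: cfun.subspace_add cfun.subspace_0 cfun.subspace_scale subspace_space
        simp del: plus_fun_apply zero_fun_apply)
  moreover have "cfun.subspace (cyclic x)"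
    unfolding cfun.subspace_def
  proof (intro conjI ballI allI)
    show "0 \<in> cyclic x"
      unfolding cyclic_def by (force simp: combination_simps(1) intro: exI[of _ "[]"])
    fix f assume "f \<in> cyclic x"
    then obtain cs where cs: "f = combination cs x" "snd ` set cs \<subseteq> SL2"
      by (auto simp: cyclic_def)
    show "cscale c f \<in> cyclic x" for c
      unfolding cyclic_def cs(1) combination_scale[symmetric] using cs(2) by force
    fix g assume "g \<in> cyclic x"
    then obtain ds where ds: "g = combination ds x" "snd ` set ds \<subseteq> SL2"
      by (auto simp: cyclic_def)
    have "snd ` set (cs @ ds) \<subseteq> SL2"
      using cs ds by auto
    then show "f + g \<in> cyclic x"
      unfolding cyclic_def cs(1) ds(1) combination_simps(3)[symmetric] by blast
  qed
  moreover have "rho B f \<in> cyclic x" if "B \<in> SL2" "f \<in> cyclic x" for B f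
  proof -
    obtain cs where cs: "f = combination cs x" "snd ` set cs \<subseteq> SL2"
      using \<open>f \<in> cyclic x\<close> by (auto simp: cyclic_def)
    have "snd ` set (map (\<lambda>(c, A). (c, B ** A)) cs) \<subseteq> SL2"
      using cs(2) that(1) by (force intro: matrix_mult_in_SL2)
    then show ?thesis
      unfolding cyclic_def cs(1) combination_rho[symmetric] by blast
  qed
  ultimately show "submodule (cyclic x)"
    by (auto simp: submodule_def cyclic_def)
  have "x = combination [(1, mat 1)] x"
    by (simp add: combination_simps rho_one del: plus_fun_apply zero_fun_apply)
  then show "x \<in> cyclic x"
    unfolding cyclic_def using mat_1_in_SL2 by force
qed

text \<open>Proportional matrix coefficients give isomorphic cyclic modules: a combination of translates
  of \<open>x\<close> vanishes iff its norm does, and the norm is a sum of matrix coefficients.\<close>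

lemma module_iso_cyclic:
  assumes x: "x \<in> space" "x \<noteq> 0" and y: "y \<in> space" "y \<noteq> 0"
    and coeff: "\<And>A. A \<in> SL2 \<Longrightarrow> ip (rho A x) x * ip y y = ip (rho A y) y * ip x x"
  shows "\<exists>\<phi>. module_iso \<phi> (cyclic x) (cyclic y)"
proof -
  have nz: "ip x x \<noteq> 0" "ip y y \<noteq> 0"
    using ip_eq_0D x y by blast+
  have norm: "ip (combination cs x) (combination cs x) * ip y y =
      ip (combination cs y) (combination cs y) * ip x x" if "snd ` set cs \<subseteq> SL2" for cs
  proof -
    have "ip (combination cs x) (combination ds x) * ip y y =
        ip (combination cs y) (combination ds y) * ip x x"
      if "snd ` set cs \<subseteq> SL2" "snd ` set ds \<subseteq> SL2" for cs ds
      unfolding ip_combination sum_list_mult_const[symmetric] case_prod_unfold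
      using that by (intro arg_cong[of _ _ sum_list] map_cong refl)
        (auto simp: coeff matrix_mult_in_SL2 adjoint_mat_in_SL2 mult.assoc image_subset_iff)
    then show ?thesis
      using that by blast
  qed
  have space: "combination cs x \<in> space" "combination cs y \<in> space" if "snd ` set cs \<subseteq> SL2" for cs
    using submodule_cyclic(1)[OF x(1)] submodule_cyclic(1)[OF y(1)] that
    unfolding submodule_def cyclic_def by blast+
  have zero: "combination cs x = 0 \<longleftrightarrow> combination cs y = 0" if "snd ` set cs \<subseteq> SL2" for cs
    using norm[OF that] nz ip_eq_0D[OF space(1)[OF that]] ip_eq_0D[OF space(2)[OF that]]
    by (metis ip_simps(7) mult_eq_0_iff)
  define neg :: "(complex \<times> (complex ^ 2 ^ 2)) list \<Rightarrow> _" where "neg = map (\<lambda>(c, A). (- 1 * c, A))"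
  have neg: "combination (cs @ neg ds) z = combination cs z - combination ds z" for cs ds z
    unfolding combination_simps(3) neg_def combination_scale by (simp add: fun_eq_iff cscale_def)
  have eq_iff: "combination cs x = combination ds x \<longleftrightarrow> combination cs y = combination ds y"
    if "snd ` set cs \<subseteq> SL2" "snd ` set ds \<subseteq> SL2" for cs ds
  proof -
    have "snd ` set (cs @ neg ds) \<subseteq> SL2"
      using that by (force simp: neg_def)
    from zero[OF this] show ?thesis
      unfolding neg by (metis right_minus_eq)
  qed
  \<comment> \<open>By \<open>eq_iff\<close> the value does not depend on which representing list is
    chosen.\<close>
  define \<phi> where
    "\<phi> f = combination (SOME cs. snd ` set cs \<subseteq> SL2 \<and> f = combination cs x) y" for f
  have \<phi>: "\<phi> (combination cs x) = combination cs y" if cs: "snd ` set cs \<subseteq> SL2" for cs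
  proof -
    define ds where "ds = (SOME ds. snd ` set ds \<subseteq> SL2 \<and> combination cs x = combination ds x)"
    have "snd ` set ds \<subseteq> SL2 \<and> combination cs x = combination ds x"
      unfolding ds_def by (rule someI[of _ cs]) (use cs in blast)
    then show ?thesis
      using eq_iff[OF cs, of ds] by (simp add: \<phi>_def ds_def)
  qed
  have "bij_betw \<phi> (cyclic x) (cyclic y)"
    unfolding bij_betw_def inj_on_def
  proof (intro conjI ballI impI)
    fix f g assume "f \<in> cyclic x" "g \<in> cyclic x" "\<phi> f = \<phi> g"
    then show "f = g"
      unfolding cyclic_def using \<phi> eq_iff by auto
  next
    show "\<phi> ` cyclic x = cyclic y"
    proof safe
      show "\<phi> f \<in> cyclic y" if "f \<in> cyclic x" for f
        using that \<phi> unfolding cyclic_def by auto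
      show "g \<in> \<phi> ` cyclic x" if g: "g \<in> cyclic y" for g
      proof -
        obtain cs where cs: "snd ` set cs \<subseteq> SL2" "g = combination cs y"
          using g unfolding cyclic_def by blast
        then have "combination cs x \<in> cyclic x"
          unfolding cyclic_def by blast
        then show ?thesis
          using \<phi>[OF cs(1)] cs(2) by (metis imageI)
      qed
    qed
  qed
  moreover have "\<phi> (f + g) = \<phi> f + \<phi> g" if fg: "f \<in> cyclic x" "g \<in> cyclic x" for f g
  proof -
    obtain cs ds where c: "snd ` set cs \<subseteq> SL2" "f = combination cs x"
      and d: "snd ` set ds \<subseteq> SL2" "g = combination ds x"
      using fg unfolding cyclic_def by blast
    have "snd ` set (cs @ ds) \<subseteq> SL2"
      using c d by auto
    from \<phi>[OF this] show ?thesis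
      unfolding c(2) d(2) \<phi>[OF c(1)] \<phi>[OF d(1)] combination_simps(3) .
  qed
  moreover have "\<phi> (cscale c f) = cscale c (\<phi> f)" if f: "f \<in> cyclic x" for c f
  proof -
    obtain cs where cs: "snd ` set cs \<subseteq> SL2" "f = combination cs x"
      using f unfolding cyclic_def by blast
    have "snd ` set (map (\<lambda>(d, A). (c * d, A)) cs) \<subseteq> SL2"
      using cs(1) by force
    from \<phi>[OF this] show ?thesis
      unfolding cs(2) \<phi>[OF cs(1)] combination_scale .
  qed
  moreover have "\<phi> (rho B f) = rho B (\<phi> f)" if B: "B \<in> SL2" and f: "f \<in> cyclic x" for B f
  proof -
    obtain cs where cs: "snd ` set cs \<subseteq> SL2" "f = combination cs x"
      using f unfolding cyclic_def by blast
    have "snd ` set (map (\<lambda>(d, A). (d, B ** A)) cs) \<subseteq> SL2"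
      using cs(1) B by (force intro: matrix_mult_in_SL2)
    from \<phi>[OF this] show ?thesis
      unfolding cs(2) \<phi>[OF cs(1)] combination_rho .
  qed
  ultimately show ?thesis
    unfolding module_iso_def by blast
qed

text \<open>A weight space is an eigenspace of the single group element \<open>diag_sl2 2\<close>,
  so a module isomorphism maps it onto the weight space of the same weight.\<close>

lemma module_iso_dim_weight:
  assumes \<phi>: "module_iso \<phi> M N" and M: "submodule M" and N: "submodule N"
  shows "cfun.dim (N \<inter> weight_space k) = cfun.dim (M \<inter> weight_space k)"
proof -
  have iff: "f \<in> weight_space k \<longleftrightarrow> rho (diag_sl2 2) f = cscale (2 powi k) f" for f
  proof -
    have "2 powi wt x = (2 powi k :: complex) \<longleftrightarrow> wt x = k" for x
    proof
      assume "2 powi wt x = (2 powi k :: complex)"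
      then have "of_real (2 powi wt x) = (of_real (2 powi k) :: complex)"
        by simp
      then have "2 powi wt x = (2 powi k :: real)"
        by (simp only: of_real_eq_iff)
      then show "wt x = k"
        using power_int_strict_increasing[of k "wt x" "2 :: real"]
          power_int_strict_increasing[of "wt x" k "2 :: real"] by (cases "wt x < k"; cases "k < wt x") auto
    qed simp
    then show ?thesis
      by (auto simp: rho_diag cscale_def fun_eq_iff weight_space_def)
  qed
  have M': "cfun.subspace M" "M \<subseteq> space"
    using M by (auto simp: submodule_def)
  have \<phi>': "bij_betw \<phi> M N" "\<And>x y. x \<in> M \<Longrightarrow> y \<in> M \<Longrightarrow> \<phi> (x + y) = \<phi> x + \<phi> y"
    "\<And>c x. x \<in> M \<Longrightarrow> \<phi> (cscale c x) = cscale c (\<phi> x)"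
    "\<And>A x. A \<in> SL2 \<Longrightarrow> x \<in> M \<Longrightarrow> \<phi> (rho A x) = rho A (\<phi> x)"
    using \<phi> by (auto simp: module_iso_def)
  have "\<phi> x \<in> weight_space k \<longleftrightarrow> x \<in> weight_space k" if "x \<in> M" for x
  proof -
    have "rho (diag_sl2 2) x \<in> M" "cscale (2 powi k) x \<in> M"
      using M that diag_sl2_in_SL2[of 2] by (auto simp: submodule_def cfun.subspace_scale)
    then have "\<phi> (rho (diag_sl2 2) x) = \<phi> (cscale (2 powi k) x) \<longleftrightarrow> rho (diag_sl2 2) x = cscale (2 powi k) x"
      by (rule inj_on_eq_iff[OF bij_betw_imp_inj_on[OF \<phi>'(1)]])
    then show ?thesis
      unfolding iff using that \<phi>' diag_sl2_in_SL2[of 2] by simp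
  qed
  then have "bij_betw \<phi> (M \<inter> weight_space k) (N \<inter> weight_space k)"
    using \<phi>'(1) unfolding bij_betw_def inj_on_def by blast
  then show ?thesis
    by (rule dim_bij_linear[rotated 2])
      (use \<phi>' M' cfun.subspace_inter[OF M'(1) subspace_weight_space] in auto)
qed

text \<open>\<open>rho A\<close> passes to the other side of the inner product as
  \<open>rho (adjoint_mat A)\<close>, which preserves \<open>L\<close> because \<open>SL2\<close> is
  closed under adjoints.\<close>

lemma submodule_complement:
  assumes M: "submodule M" and L: "submodule L" and LM: "L \<subseteq> M"
  defines "M' \<equiv> {f \<in> M. \<forall>l\<in>L. ip f l = 0}"
  shows "submodule M'" "L \<inter> M' \<subseteq> {0}" "M = {l + m | l m. l \<in> L \<and> m \<in> M'}"
proof -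
  have M1: "cfun.subspace M" "M \<subseteq> space" and L1: "cfun.subspace L" "L \<subseteq> space"
    using M L by (auto simp: submodule_def)
  have "rho A f \<in> M'" if "A \<in> SL2" "f \<in> M'" for A f
    using that M L adjoint_mat_in_SL2[of A] by (auto simp: M'_def submodule_def ip_rho)
  moreover have "cfun.subspace M'"
    using M1(1) by (auto simp: M'_def cfun.subspace_def ip_simps simp del: plus_fun_apply zero_fun_apply)
  ultimately show "submodule M'"
    using M1 by (auto simp: submodule_def M'_def)
  show "L \<inter> M' \<subseteq> {0}"
    using L1 ip_eq_0D by (auto simp: M'_def)
  show "M = {l + m | l m. l \<in> L \<and> m \<in> M'}"
  proof safe
    fix f assume f: "f \<in> M"
    then obtain l where l: "l \<in> L" "\<forall>m\<in>L. ip (f - l) m = 0"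
      using orthogonal_projection[OF L1, of f] M1 by blast
    moreover have "f - l \<in> M"
      using f l LM by (intro cfun.subspace_diff[OF M1(1)]) auto
    ultimately show "\<exists>l m. f = l + m \<and> l \<in> L \<and> m \<in> M'"
      by (intro exI[of _ l] exI[of _ "f - l"]) (auto simp: M'_def)
  next
    fix l m assume "l \<in> L" "m \<in> M'"
    then show "l + m \<in> M"
      using LM by (auto simp: M'_def intro: cfun.subspace_add[OF M1(1)] simp del: plus_fun_apply)
  qed
qed

text \<open>Both summands contain the weight parts of their elements, so the decomposition restricts
  to each weight space.\<close>

lemma dim_weight_direct_sum:
  assumes L: "submodule L" and M': "submodule M'" and disjoint: "L \<inter> M' \<subseteq> {0}"
    and M: "M = {l + m | l m. l \<in> L \<and> m \<in> M'}"
  shows "cfun.dim (M \<inter> weight_space k) =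
    cfun.dim (L \<inter> weight_space k) + cfun.dim (M' \<inter> weight_space k)"
proof (rule dim_direct_sum)
  show "M \<inter> weight_space k =
      {u + w | u w. u \<in> L \<inter> weight_space k \<and> w \<in> M' \<inter> weight_space k}"
  proof safe
    fix f assume "f \<in> M" "f \<in> weight_space k"
    then obtain l m where lm: "f = l + m" "l \<in> L" "m \<in> M'"
      unfolding M by blast
    have "f = weight_part k f"
      using \<open>f \<in> weight_space k\<close> by (simp add: weight_part_id)
    also have "\<dots> = weight_part k l + weight_part k m"
      by (simp add: lm weight_part_def fun_eq_iff)
    finally show "\<exists>u w. f = u + w \<and> u \<in> L \<inter> weight_space k \<and> w \<in> M' \<inter> weight_space k"
      using weight_part_in_submodule L M' lm weight_part_in by blast
  next
    fix u w assume "u \<in> L" "w \<in> M'" "u \<in> weight_space k" "w \<in> weight_space k"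
    then show "u + w \<in> M" "u + w \<in> weight_space k"
      unfolding M using cfun.subspace_add[OF subspace_weight_space] by blast+
  qed
qed (use L M' disjoint subspace_weight_space in \<open>auto simp: submodule_def intro!: cfun.subspace_inter\<close>)

lemma module_iso_direct_sum:
  assumes \<phi>: "module_iso \<phi> L L'" and \<psi>: "module_iso \<psi> W W'"
    and sub: "submodule L" "submodule W" "submodule L'" "submodule W'"
    and disjoint: "L \<inter> W \<subseteq> {0}" "L' \<inter> W' \<subseteq> {0}"
    and M: "M = {l + w | l w. l \<in> L \<and> w \<in> W}" and N: "N = {l + w | l w. l \<in> L' \<and> w \<in> W'}"
  shows "\<exists>\<eta>. module_iso \<eta> M N"
proof -
  have unique: "l = l' \<and> w = w'"
    if "l \<in> L" "l' \<in> L" "w \<in> W" "w' \<in> W" "l + w = l' + w'" "L \<inter> W \<subseteq> {0}"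
      "submodule L" "submodule W" for l l' w w' L W
  proof -
    have eq: "l - l' = w' - w"
      using \<open>l + w = l' + w'\<close> by (simp add: fun_eq_iff algebra_simps)
    have "l - l' \<in> L" "w' - w \<in> W"
      using that by (auto simp: submodule_def cfun.subspace_diff)
    then have "l - l' \<in> L \<inter> W"
      unfolding eq by simp
    then have "l - l' = 0"
      using that(6) by blast
    moreover from this have "w' - w = 0"
      by (rule trans[OF eq[symmetric]])
    ultimately show ?thesis
      by (simp only: right_minus_eq)
  qed
  define P where "P f g \<longleftrightarrow> (\<exists>l\<in>L. \<exists>w\<in>W. f = l + w \<and> g = \<phi> l + \<psi> w)" for f g
  define \<eta> where "\<eta> f = (SOME g. P f g)" for f
  have \<eta>: "\<eta> (l + w) = \<phi> l + \<psi> w" if "l \<in> L" "w \<in> W" for l w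
  proof -
    have "P (l + w) (\<phi> l + \<psi> w)"
      unfolding P_def using that by blast
    then have "P (l + w) (\<eta> (l + w))"
      unfolding \<eta>_def by (rule someI[of "P (l + w)"])
    then obtain l' w' where lw: "l' \<in> L" "w' \<in> W" "l + w = l' + w'" "\<eta> (l + w) = \<phi> l' + \<psi> w'"
      unfolding P_def by blast
    with unique[OF that(1) lw(1) that(2) lw(2) lw(3) disjoint(1) sub(1,2)] show ?thesis
      by simp
  qed
  have p: "bij_betw \<phi> L L'" "\<And>x y. x \<in> L \<Longrightarrow> y \<in> L \<Longrightarrow> \<phi> (x + y) = \<phi> x + \<phi> y"
    "\<And>c x. x \<in> L \<Longrightarrow> \<phi> (cscale c x) = cscale c (\<phi> x)"
    "\<And>A x. A \<in> SL2 \<Longrightarrow> x \<in> L \<Longrightarrow> \<phi> (rho A x) = rho A (\<phi> x)"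
    using \<phi> by (auto simp: module_iso_def)
  have s: "bij_betw \<psi> W W'" "\<And>x y. x \<in> W \<Longrightarrow> y \<in> W \<Longrightarrow> \<psi> (x + y) = \<psi> x + \<psi> y"
    "\<And>c x. x \<in> W \<Longrightarrow> \<psi> (cscale c x) = cscale c (\<psi> x)"
    "\<And>A x. A \<in> SL2 \<Longrightarrow> x \<in> W \<Longrightarrow> \<psi> (rho A x) = rho A (\<psi> x)"
    using \<psi> by (auto simp: module_iso_def)
  have L: "cfun.subspace L" "\<And>A x. A \<in> SL2 \<Longrightarrow> x \<in> L \<Longrightarrow> rho A x \<in> L"
    and W: "cfun.subspace W" "\<And>A x. A \<in> SL2 \<Longrightarrow> x \<in> W \<Longrightarrow> rho A x \<in> W"
    using sub by (auto simp: submodule_def)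
  have im: "\<phi> l \<in> L'" "\<psi> w \<in> W'" if "l \<in> L" "w \<in> W" for l w
    using that p(1) s(1) by (auto simp: bij_betw_def)
  have "inj_on \<eta> M"
  proof (rule inj_onI)
    fix f g assume "f \<in> M" "g \<in> M" "\<eta> f = \<eta> g"
    then obtain l w l' w' where lw: "f = l + w" "g = l' + w'" "l \<in> L" "w \<in> W" "l' \<in> L" "w' \<in> W"
      unfolding M by blast
    have "\<phi> l + \<psi> w = \<phi> l' + \<psi> w'"
      using \<open>\<eta> f = \<eta> g\<close> lw \<eta> by simp
    then have "\<phi> l = \<phi> l' \<and> \<psi> w = \<psi> w'"
      by (rule unique[OF im(1)[OF lw(3,4)] im(1)[OF lw(5,6)] im(2)[OF lw(3,4)] im(2)[OF lw(5,6)] _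
            disjoint(2) sub(3,4)])
    then show "f = g"
      using p(1) s(1) lw by (metis bij_betw_def inj_onD)
  qed
  moreover have "\<eta> ` M = N"
  proof safe
    fix f assume "f \<in> M"
    then show "\<eta> f \<in> N"
      unfolding M N using \<eta> im by blast
  next
    fix g assume "g \<in> N"
    then obtain l' w' where "g = l' + w'" "l' \<in> \<phi> ` L" "w' \<in> \<psi> ` W"
      unfolding N using p(1) s(1) by (auto simp: bij_betw_def)
    then obtain l w where "g = \<phi> l + \<psi> w" "l \<in> L" "w \<in> W"
      by blast
    then show "g \<in> \<eta> ` M"
      using \<eta> unfolding M by (intro image_eqI[of _ _ "l + w"]) auto
  qed
  moreover have "\<eta> (f + g) = \<eta> f + \<eta> g" if fg: "f \<in> M" "g \<in> M" for f g
  proof -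
    obtain l w l' w' where lw: "f = l + w" "g = l' + w'" "l \<in> L" "w \<in> W" "l' \<in> L" "w' \<in> W"
      using fg unfolding M by blast
    have fg_eq: "f + g = (l + l') + (w + w')"
      unfolding lw by (simp only: ac_simps)
    have "\<eta> (f + g) = \<phi> (l + l') + \<psi> (w + w')"
      unfolding fg_eq using lw L W by (intro \<eta> cfun.subspace_add)
    also have "\<dots> = (\<phi> l + \<psi> w) + (\<phi> l' + \<psi> w')"
      using lw p(2) s(2) by (simp only: ac_simps)
    also have "\<dots> = \<eta> f + \<eta> g"
      using lw \<eta> by (simp only:)
    finally show ?thesis .
  qed
  moreover have "\<eta> (cscale c f) = cscale c (\<eta> f)" if f: "f \<in> M" for c f
  proof -
    obtain l w where lw: "f = l + w" "l \<in> L" "w \<in> W"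
      using f unfolding M by blast
    have "cscale c f = cscale c l + cscale c w"
      by (simp add: lw cfun.scale_right_distrib)
    moreover have "\<eta> \<dots> = \<phi> (cscale c l) + \<psi> (cscale c w)"
      using lw L W by (intro \<eta> cfun.subspace_scale)
    moreover have "\<eta> f = \<phi> l + \<psi> w"
      using lw \<eta> by simp
    ultimately show ?thesis
      using lw p(3) s(3) by (simp add: cfun.scale_right_distrib)
  qed
  moreover have "\<eta> (rho A f) = rho A (\<eta> f)" if A: "A \<in> SL2" and f: "f \<in> M" for A f
  proof -
    obtain l w where lw: "f = l + w" "l \<in> L" "w \<in> W"
      using f unfolding M by blast
    have "rho A f = rho A l + rho A w"
      by (simp add: lw rho_add)
    moreover have "\<eta> \<dots> = \<phi> (rho A l) + \<psi> (rho A w)"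
      using lw L W A by (intro \<eta>)
    moreover have "\<eta> f = \<phi> l + \<psi> w"
      using lw \<eta> by simp
    ultimately show ?thesis
      using lw p(4) s(4) A by (simp add: rho_add)
  qed
  ultimately show ?thesis
    unfolding module_iso_def bij_betw_def by blast
qed

text \<open>Induction on the dimension of \<open>M\<close>. Both modules have the same highest
  weight, and each contains the cyclic submodule of a vector of that weight. These submodules are
  isomorphic by their matrix coefficients, and their orthogonal complements again have equal weight
  multiplicities.\<close>

theorem module_iso_if_same_weights:
  assumes "submodule M" "submodule N"
    and "\<And>k. cfun.dim (M \<inter> weight_space k) = cfun.dim (N \<inter> weight_space k)"
  shows "\<exists>\<phi>. module_iso \<phi> M N"
  using assms
proof (induction "cfun.dim M" arbitrary: M N rule: less_induct)
  case less
  have M: "cfun.subspace M" "M \<subseteq> space" and N: "cfun.subspace N" "N \<subseteq> space"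
    using less.prems by (auto simp: submodule_def)
  have trivial_iff: "U \<inter> weight_space k = {0} \<longleftrightarrow> cfun.dim (U \<inter> weight_space k) = 0"
    if "submodule U" for U k
    using that by (subst dim_eq_0_iff)
      (auto simp: submodule_def intro!: cfun.subspace_inter subspace_weight_space)
  have same: "M \<inter> weight_space k = {0} \<longleftrightarrow> N \<inter> weight_space k = {0}" for k
    using less.prems trivial_iff by simp
  have all_trivial: "U = {0}" if U: "submodule U" and "\<And>k. k \<in> wt ` X \<Longrightarrow> U \<inter> weight_space k = {0}" for U
  proof -
    have "f x = 0" if "f \<in> U" for f x
    proof (cases "x \<in> X")
      case True
      have "weight_part (wt x) f \<in> U \<inter> weight_space (wt x)"
        using weight_part_in_submodule[OF U that] weight_part_in by blast
      then have "weight_part (wt x) f x = 0"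
        using \<open>\<And>k. k \<in> wt ` X \<Longrightarrow> _\<close>[of "wt x"] True by (metis imageI singletonD zero_fun_apply)
      then show ?thesis
        by (simp add: weight_part_def)
    qed (use U that in \<open>auto simp: submodule_def space_def\<close>)
    then have "U \<subseteq> {0}"
      by (auto simp: fun_eq_iff)
    then show ?thesis
      using U cfun.subspace_0 by (auto simp: submodule_def)
  qed
  define J where "J = {k \<in> wt ` X. M \<inter> weight_space k \<noteq> {0}}"
  have "finite J"
    using finite_X by (simp add: J_def)
  show ?case
  proof (cases "J = {}")
    case True
    then have trivial: "M \<inter> weight_space j = {0}" if "j \<in> wt ` X" for j
      using that unfolding J_def by blast
    have "M = {0}"
      by (rule all_trivial[OF less.prems(1) trivial])
    moreover have "N = {0}"
      by (rule all_trivial[OF less.prems(2) iffD1[OF same trivial]])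
    ultimately have "module_iso id M N"
      by (simp add: module_iso_def del: zero_fun_apply)
    then show ?thesis
      by blast
  next
    case False
    \<comment> \<open>The highest weight of \<open>M\<close>; by \<open>same\<close> it is also that
      of \<open>N\<close>.\<close>
    define k where "k = Max J"
    have k: "M \<inter> weight_space k \<noteq> {0}"
      using Max_in[OF \<open>finite J\<close> False] by (auto simp: k_def J_def)
    have top: "M \<inter> weight_space j = {0}" if "k < j" for j
    proof (cases "j \<in> wt ` X")
      case True
      have "j \<notin> J"
        using Max_ge[OF \<open>finite J\<close>, of j] that by (auto simp: k_def)
      with True show ?thesis
        by (simp add: J_def)
    next
      case False
      then have "M \<inter> weight_space j \<subseteq> {0}"
        using M(2) by (fastforce simp: weight_space_def space_def fun_eq_iff)
      then show ?thesis
        using M(1) cfun.subspace_0 subspace_weight_space by blast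
    qed
    have "0 \<in> M \<inter> weight_space k" "0 \<in> N \<inter> weight_space k"
      using M(1) N(1) cfun.subspace_0 subspace_weight_space by blast+
    then obtain x y where x: "x \<in> M" "x \<in> weight_space k" "x \<noteq> 0" and y: "y \<in> N" "y \<in> weight_space k" "y \<noteq> 0"
      using k same[of k] by blast
    have fix_x: "rho (upper_sl2 b) x = x" for b
      by (rule rho_upper_highest[OF less.prems(1) x(1,2) top])
    have fix_y: "rho (upper_sl2 b) y = y" for b
      by (rule rho_upper_highest[OF less.prems(2) y(1,2) iffD1[OF same top]])
    have xy: "x \<in> space" "y \<in> space"
      using x y M N by auto
    define L L' where "L = cyclic x" and "L' = cyclic y"
    have L: "submodule L" "x \<in> L" and L': "submodule L'" "y \<in> L'"
      unfolding L_def L'_def using xy submodule_cyclic by auto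
    obtain \<phi> where \<phi>: "module_iso \<phi> L L'"
      using module_iso_cyclic[OF xy(1) x(3) xy(2) y(3)]
        matrix_coefficients_proportional[OF _ x(2) fix_x y(2) fix_y] unfolding L_def L'_def by blast
    have cyclic_sub: "cyclic z \<subseteq> U" if "submodule U" "z \<in> U" for z U
    proof -
      have "combination cs z \<in> U" if "snd ` set cs \<subseteq> SL2" for cs
        using that \<open>submodule U\<close> \<open>z \<in> U\<close>
        by (induction cs) (auto simp: combination_simps submodule_def
            intro!: cfun.subspace_add cfun.subspace_0 cfun.subspace_scale
            simp del: plus_fun_apply zero_fun_apply)
      then show ?thesis
        by (auto simp: cyclic_def)
    qed
    have sub: "L \<subseteq> M" "L' \<subseteq> N"
      unfolding L_def L'_def using less.prems x y cyclic_sub by auto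
    define M' where "M' = {f \<in> M. \<forall>l\<in>L. ip f l = 0}"
    define N' where "N' = {f \<in> N. \<forall>l\<in>L'. ip f l = 0}"
    note compl = submodule_complement[OF less.prems(1) L(1) sub(1), folded M'_def]
      submodule_complement[OF less.prems(2) L'(1) sub(2), folded N'_def]
    have "cfun.dim L \<noteq> 0"
      using dim_eq_0_iff[of L] L x(3) by (auto simp: submodule_def)
    moreover have "cfun.dim M = cfun.dim L + cfun.dim M'"
      using compl L by (intro dim_direct_sum) (auto simp: submodule_def)
    moreover have "cfun.dim (M' \<inter> weight_space j) = cfun.dim (N' \<inter> weight_space j)" for j
      using dim_weight_direct_sum[OF L(1) compl(1-3), of j] dim_weight_direct_sum[OF L'(1) compl(4-6), of j]
        module_iso_dim_weight[OF \<phi> L(1) L'(1), of j] less.prems(3)[of j] by simp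
    ultimately obtain \<psi> where "module_iso \<psi> M' N'"
      using less.hyps[of M' N'] compl(1,4) by auto
    from module_iso_direct_sum[OF \<phi> this L(1) compl(1) L'(1) compl(4) compl(2,5,3,6)]
    show ?thesis .
  qed
qed

end

section \<open>Tensor powers of representations\<close>

definition standard_kernel :: "complex ^ 2 ^ 2 \<Rightarrow> 2 \<Rightarrow> 2 \<Rightarrow> complex" where
  "standard_kernel A x y = A $ x $ y"

definition standard_weight :: "2 \<Rightarrow> int" where
  "standard_weight x = (if x = 1 then 1 else - 1)"

lemma standard_sl2_kernel: "sl2_kernel standard_kernel (\<lambda>_. UNIV) standard_weight"
proof
  fix t :: complex and x y :: 2
  assume "t \<noteq> 0"
  then show "standard_kernel (diag_sl2 t) x y = (if x = y then t powi standard_weight x else 0)"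
    using exhaust_2[of x] exhaust_2[of y]
    by (elim disjE) (simp_all add: standard_kernel_def diag_sl2_def standard_weight_def
        power_int_minus field_simps)
next
  fix b :: complex and x y :: 2
  show "standard_kernel (upper_sl2 b) x x = 1"
    using exhaust_2[of x] by (elim disjE) (simp_all add: standard_kernel_def upper_sl2_def)
  show "x = y \<or> standard_weight y < standard_weight x" if "standard_kernel (upper_sl2 b) x y \<noteq> 0"
    using that exhaust_2[of x] exhaust_2[of y]
    by (elim disjE) (simp_all add: standard_kernel_def upper_sl2_def standard_weight_def)
next
  fix x y :: 2
  show "continuous_on UNIV (\<lambda>A. standard_kernel A x y)"
    unfolding standard_kernel_def by (intro continuous_intros)
qed (simp_all add: standard_kernel_def matrix_matrix_mult_def Finite_Cartesian_Product.mat_def adjoint_mat_def)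

text \<open>Lists of all lengths are treated at once, so this is the action on the whole tensor
  algebra; the tensor powers are separated by the classes. Applied twice it covers every tensor
  power of every symmetric power, hence all brackets.\<close>

fun list_kernel :: "('m \<Rightarrow> 'a \<Rightarrow> 'a \<Rightarrow> complex) \<Rightarrow> 'm \<Rightarrow> 'a list \<Rightarrow> 'a list \<Rightarrow> complex" where
  "list_kernel K A [] [] = 1"
| "list_kernel K A (x # xs) (y # ys) = K A x y * list_kernel K A xs ys"
| "list_kernel K A _ _ = 0"

fun list_class :: "('a \<Rightarrow> 'a set) \<Rightarrow> 'a list \<Rightarrow> 'a list set" where
  "list_class cls [] = {[]}"
| "list_class cls (x # xs) = (\<lambda>(y, ys). y # ys) ` (cls x \<times> list_class cls xs)"

definition list_weight :: "('a \<Rightarrow> int) \<Rightarrow> 'a list \<Rightarrow> int" where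
  "list_weight wt xs = (\<Sum>x\<leftarrow>xs. wt x)"

lemma sum_list_class_Cons:
  "(\<Sum>ys\<in>list_class cls (x # xs). f ys) = (\<Sum>y\<in>cls x. \<Sum>ys\<in>list_class cls xs. f (y # ys))"
proof -
  have "inj_on (\<lambda>(y, ys). y # ys) (cls x \<times> list_class cls xs)"
    by (auto simp: inj_on_def)
  then show ?thesis
    by (simp add: sum.reindex sum.cartesian_product case_prod_unfold o_def)
qed

lemma list_class_iff: "ys \<in> list_class cls xs \<longleftrightarrow> list_all2 (\<lambda>x y. y \<in> cls x) xs ys"
  by (induction xs arbitrary: ys) (auto simp: list_all2_Cons1)

lemma list_sl2_kernel:
  assumes "sl2_kernel K cls wt"
  shows "sl2_kernel (list_kernel K) (list_class cls) (list_weight wt)"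
proof -
  interpret sl2_kernel K cls wt
    by fact
  show ?thesis
  proof
    fix xs :: "'a list"
    show "finite (list_class cls xs)"
      by (induction xs) (auto simp: finite_cls)
    show "xs \<in> list_class cls xs"
      by (induction xs) (auto simp: cls_refl)
    show "list_class cls ys = list_class cls xs" if "ys \<in> list_class cls xs" for ys
      using that
    proof (induction xs arbitrary: ys)
      case (Cons x xs)
      then obtain y ys' where ys: "ys = y # ys'" and "y \<in> cls x" "ys' \<in> list_class cls xs"
        by auto
      with Cons.IH[of ys'] cls_eq[of y x] show ?case
        by simp
    qed simp
    show "list_kernel K A xs ys = 0" if "ys \<notin> list_class cls xs" for ys and A
      using that
    proof (induction xs arbitrary: ys)
      case Nil
      then show ?case
        by (cases ys) (auto simp: K_cls image_iff)
    next
      case (Cons x xs)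
      then show ?case
        by (cases ys) (auto simp: K_cls image_iff)
    qed
    show "list_kernel K (mat 1) xs ys = (if xs = ys then 1 else 0)" for ys
    proof (induction xs arbitrary: ys)
      case Nil
      then show ?case
        by (cases ys) (auto simp: K_one)
    next
      case (Cons x xs)
      then show ?case
        by (cases ys) (auto simp: K_one)
    qed
    show "list_kernel K (adjoint_mat A) xs ys = cnj (list_kernel K A ys xs)" for A ys
    proof (induction xs arbitrary: ys)
      case Nil
      then show ?case
        by (cases ys) (auto simp: K_adjoint)
    next
      case (Cons x xs)
      then show ?case
        by (cases ys) (auto simp: K_adjoint)
    qed
    show "list_kernel K (upper_sl2 b) xs xs = 1" for b
      by (induction xs) (auto simp: K_upper_refl)
    show "continuous_on UNIV (\<lambda>A. list_kernel K A xs ys)" for ys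
    proof (induction xs arbitrary: ys)
      case Nil
      then show ?case
        by (cases ys) (auto intro!: continuous_intros K_continuous)
    next
      case (Cons x xs)
      then show ?case
        by (cases ys) (auto intro!: continuous_intros K_continuous)
    qed
  next
    fix A B :: "complex ^ 2 ^ 2" and xs zs :: "'a list"
    show "list_kernel K (A ** B) xs zs =
        (\<Sum>ys\<in>list_class cls xs. list_kernel K A xs ys * list_kernel K B ys zs)"
    proof (induction xs arbitrary: zs)
      case Nil
      show ?case
        by (cases zs) auto
    next
      case (Cons x xs)
      show ?case
      proof (cases zs)
        case (Cons z zs')
        have "list_kernel K (A ** B) (x # xs) zs =
            (\<Sum>y\<in>cls x. \<Sum>ys\<in>list_class cls xs.
              K A x y * K B y z * (list_kernel K A xs ys * list_kernel K B ys zs'))"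
          by (simp add: Cons K_mult Cons.IH sum_product)
        also have "\<dots> = (\<Sum>ys\<in>list_class cls (x # xs). list_kernel K A (x # xs) ys * list_kernel K B ys zs)"
          unfolding sum_list_class_Cons by (simp add: Cons mult_ac)
        finally show ?thesis .
      qed (unfold sum_list_class_Cons, simp)
    qed
  next
    fix t :: complex and xs ys :: "'a list"
    assume t: "t \<noteq> 0"
    show "list_kernel K (diag_sl2 t) xs ys = (if xs = ys then t powi list_weight wt xs else 0)"
    proof (induction xs arbitrary: ys)
      case Nil
      then show ?case
        by (cases ys) (auto simp: K_diag t list_weight_def power_int_add)
    next
      case (Cons x xs)
      then show ?case
        by (cases ys) (auto simp: K_diag t list_weight_def power_int_add)
    qed
  next
    fix b :: complex and xs ys :: "'a list"
    assume "list_kernel K (upper_sl2 b) xs ys \<noteq> 0"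
    then show "xs = ys \<or> list_weight wt ys < list_weight wt xs"
    proof (induction xs arbitrary: ys)
      case Nil
      then show ?case
        by (cases ys) auto
    next
      case (Cons x xs)
      then obtain y ys' where ys: "ys = y # ys'" "K (upper_sl2 b) x y \<noteq> 0"
        "list_kernel K (upper_sl2 b) xs ys' \<noteq> 0"
        by (cases ys) auto
      with Cons.IH[of ys'] K_upper[of b x y] show ?case
        by (auto simp: list_weight_def)
    qed
  qed
qed

lemma list_kernel_eq_pure_tensor:
  "list_kernel K A xs ys = pure_tensor (map (\<lambda>y x. K A x y) ys) xs"
  by (induction K A xs ys rule: list_kernel.induct)
    (auto simp: pure_tensor_Nil pure_tensor_Cons_Nil pure_tensor_Cons_Cons)

text \<open>\<open>tensor_map\<close> sums over the support of \<open>T\<close>, \<open>rho\<close>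
  over the class of the argument. Both sums extend by zeros to the union of these sets, provided
  that the support is finite; over an infinite support the sum would be 0 by convention.\<close>

lemma tensor_map_eq_rho:
  assumes "sl2_kernel K cls wt"
    and F: "\<And>y. F A (unit_fun y) = (\<lambda>x. K A x y)" and fin: "finite {ys. T ys \<noteq> 0}"
  shows "tensor_map (F A) T = sl2_kernel.rho (list_kernel K) (list_class cls) A T"
proof
  fix xs
  interpret L: sl2_kernel "list_kernel K" "list_class cls" "list_weight wt"
    by (rule list_sl2_kernel) fact
  have "tensor_map (F A) T xs = (\<Sum>ys | T ys \<noteq> 0. T ys * list_kernel K A xs ys)"
    by (simp add: tensor_map_apply F list_kernel_eq_pure_tensor)
  also have "\<dots> = (\<Sum>ys\<in>{ys. T ys \<noteq> 0} \<union> list_class cls xs. T ys * list_kernel K A xs ys)"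
    using fin by (intro sum.mono_neutral_left) (auto simp: L.finite_cls)
  also have "\<dots> = (\<Sum>ys\<in>list_class cls xs. T ys * list_kernel K A xs ys)"
    using fin by (intro sum.mono_neutral_right) (auto simp: L.finite_cls L.K_cls)
  finally show "tensor_map (F A) T xs = L.rho A T xs"
    by (simp add: L.rho_def mult.commute)
qed

lemma tensor_map_unit_fun:
  assumes "\<And>y. F A (unit_fun y) = (\<lambda>x. K A x y)"
  shows "tensor_map (F A) (unit_fun ys) = (\<lambda>xs. list_kernel K A xs ys)"
proof -
  have "{zs. unit_fun ys zs \<noteq> 0} = {ys}"
    by (auto simp: unit_fun_def)
  then show ?thesis
    by (simp add: fun_eq_iff tensor_map_apply assms list_kernel_eq_pure_tensor) (simp add: unit_fun_def)
qed

lemma list_kernel_permute: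
  assumes "length xs = n" "length ys = n" "\<sigma> permutes {..<n}"
  shows "list_kernel K A (permute_list \<sigma> xs) (permute_list \<sigma> ys) = list_kernel K A xs ys"
proof -
  have prod: "list_kernel K A xs ys = (\<Prod>i<n. K A (xs ! i) (ys ! i))"
    if "length xs = n" "length ys = n" for xs ys
    using that by (simp add: list_kernel_eq_pure_tensor pure_tensor_def)
  have "(\<Prod>i<n. K A (xs ! \<sigma> i) (ys ! \<sigma> i)) = (\<Prod>i<n. K A (xs ! i) (ys ! i))"
    using prod.permute[OF assms(3), of "\<lambda>i. K A (xs ! i) (ys ! i)"] by (simp add: o_def)
  then show ?thesis
    using assms by (simp add: prod permute_list_nth)
qed

lemma list_class_permute:
  assumes "length xs = n" "\<sigma> permutes {..<n}"
  shows "ys \<in> list_class cls xs \<longleftrightarrow> length ys = n \<and> permute_list \<sigma> ys \<in> list_class cls (permute_list \<sigma> xs)"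
proof -
  have all: "(\<forall>i<n. P (\<sigma> i)) \<longleftrightarrow> (\<forall>i<n. P i)" for P
  proof -
    have "(\<forall>i<n. P (\<sigma> i)) \<longleftrightarrow> (\<forall>i\<in>\<sigma> ` {..<n}. P i)"
      by blast
    also have "\<dots> \<longleftrightarrow> (\<forall>i<n. P i)"
      unfolding permutes_image[OF assms(2)] by blast
    finally show ?thesis .
  qed
  show ?thesis
  proof (cases "length ys = n")
    case True
    have "ys \<in> list_class cls xs \<longleftrightarrow> (\<forall>i<n. ys ! i \<in> cls (xs ! i))"
      using True assms(1) by (auto simp: list_class_iff list_all2_conv_all_nth)
    also have "\<dots> \<longleftrightarrow> (\<forall>i<n. ys ! \<sigma> i \<in> cls (xs ! \<sigma> i))"
      by (rule all[symmetric])
    also have "\<dots> \<longleftrightarrow> (\<forall>i<n. permute_list \<sigma> ys ! i \<in> cls (permute_list \<sigma> xs ! i))"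
      using True assms by (simp add: permute_list_nth)
    also have "\<dots> \<longleftrightarrow> permute_list \<sigma> ys \<in> list_class cls (permute_list \<sigma> xs)"
      using True assms(1) by (auto simp: list_class_iff list_all2_conv_all_nth)
    finally show ?thesis
      using True by simp
  next
    case False
    then show ?thesis
      using assms by (auto simp: list_class_iff list_all2_conv_all_nth)
  qed
qed

text \<open>The group acts on all factors alike, so it commutes with permutations of places; hence
  images of Young symmetrizers are invariant. \<open>T\<close> has to vanish on lists of other
  lengths because \<open>permute_list (inv \<sigma>)\<close> need not be a rearrangement
  there.\<close>

lemma rho_permute_tensor:
  assumes "sl2_kernel K cls wt" and \<sigma>: "\<sigma> permutes {..<n}"
    and T: "\<And>xs. length xs \<noteq> n \<Longrightarrow> T xs = 0"
  shows "sl2_kernel.rho (list_kernel K) (list_class cls) A (permute_tensor \<sigma> T) =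
    permute_tensor \<sigma> (sl2_kernel.rho (list_kernel K) (list_class cls) A T)"
proof
  fix xs
  interpret L: sl2_kernel "list_kernel K" "list_class cls" "list_weight wt"
    by (rule list_sl2_kernel) fact
  have inv: "inv \<sigma> permutes {..<n}"
    using \<sigma> by (rule permutes_inv)
  have len: "length ys = length xs" if "ys \<in> list_class cls xs" for xs ys
    using that by (simp add: list_class_iff list_all2_lengthD)
  show "L.rho A (permute_tensor \<sigma> T) xs = permute_tensor \<sigma> (L.rho A T) xs"
  proof (cases "length xs = n")
    case True
    have eq: "permute_list \<sigma> (permute_list (inv \<sigma>) ys) = ys" "permute_list (inv \<sigma>) (permute_list \<sigma> ys) = ys"
      if "length ys = n" for ys :: "'a list"
      using that \<sigma> inv by (simp_all add: permute_list_compose[symmetric] permutes_inv_o)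
    show ?thesis
      unfolding L.rho_def permute_tensor_def
    proof (rule sum.reindex_bij_witness[of _ "permute_list \<sigma>" "permute_list (inv \<sigma>)"])
      fix ys assume ys: "ys \<in> list_class cls xs"
      then show "permute_list \<sigma> (permute_list (inv \<sigma>) ys) = ys"
        using eq True len by simp
      show "permute_list (inv \<sigma>) ys \<in> list_class cls (permute_list (inv \<sigma>) xs)"
        using ys list_class_permute[OF True inv] by blast
      show "list_kernel K A (permute_list (inv \<sigma>) xs) (permute_list (inv \<sigma>) ys) * T (permute_list (inv \<sigma>) ys) =
          list_kernel K A xs ys * T (permute_list (inv \<sigma>) ys)"
        using ys len True by (simp add: list_kernel_permute[OF _ _ inv])
    next
      fix ys assume ys: "ys \<in> list_class cls (permute_list (inv \<sigma>) xs)"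
      then have "length ys = n"
        using len True by fastforce
      then show "permute_list (inv \<sigma>) (permute_list \<sigma> ys) = ys"
        using eq by simp
      show "permute_list \<sigma> ys \<in> list_class cls xs"
        using ys \<open>length ys = n\<close> True eq(2)[of ys] by (subst list_class_permute[OF True inv]) simp
    qed
  next
    case False
    have "T (permute_list (inv \<sigma>) ys) = 0" if "length ys \<noteq> n" for ys
      using that T by simp
    then have "L.rho A (permute_tensor \<sigma> T) xs = 0"
      using False len by (auto simp: L.rho_def permute_tensor_def intro!: sum.neutral)
    moreover have "L.rho A T (permute_list (inv \<sigma>) xs) = 0"
      using False len T by (auto simp: L.rho_def intro!: sum.neutral)
    ultimately show ?thesis
      by (simp add: permute_tensor_def)
  qed
qed

lemma rho_pure_tensor:
  assumes "sl2_kernel K cls wt"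
  shows "sl2_kernel.rho (list_kernel K) (list_class cls) A (pure_tensor vs) =
    pure_tensor (map (sl2_kernel.rho K cls A) vs)"
proof
  interpret sl2_kernel K cls wt
    by fact
  interpret L: sl2_kernel "list_kernel K" "list_class cls" "list_weight wt"
    by (rule list_sl2_kernel) fact
  fix xs
  show "L.rho A (pure_tensor vs) xs = pure_tensor (map (rho A) vs) xs"
  proof (induction vs arbitrary: xs)
    case Nil
    show ?case
      by (cases xs) (simp_all add: L.rho_def pure_tensor_Nil sum_list_class_Cons del: list_class.simps(2))
  next
    case (Cons v vs)
    show ?case
    proof (cases xs)
      case Nil
      then show ?thesis
        by (simp add: L.rho_def pure_tensor_Cons_Nil)
    next
      case (Cons x xs')
      have "L.rho A (pure_tensor (v # vs)) xs =
          (\<Sum>y\<in>cls x. \<Sum>ys\<in>list_class cls xs'. (K A x y * v y) * (list_kernel K A xs' ys * pure_tensor vs ys))"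
        unfolding L.rho_def Cons sum_list_class_Cons by (simp add: pure_tensor_Cons_Cons mult_ac)
      also have "\<dots> = rho A v x * L.rho A (pure_tensor vs) xs'"
        by (simp add: rho_def L.rho_def sum_product)
      finally show ?thesis
        by (simp add: Cons Cons.IH pure_tensor_Cons_Cons)
    qed
  qed
qed

section \<open>Fillings of a Young diagram\<close>

locale young_diagram =
  fixes \<mu> :: "nat list"
  assumes decreasing: "sorted_wrt (\<ge>) \<mu>"
begin

abbreviation "N \<equiv> sum_list \<mu>"
abbreviation "box_row k \<equiv> fst (boxes \<mu> ! k)"
abbreviation "box_col k \<equiv> snd (boxes \<mu> ! k)"
abbreviation "box_rows \<equiv> map fst (boxes \<mu>)"

lemma boxes_prefix:
  fixes n
  defines "B \<equiv> concat (map (\<lambda>i. map (Pair i) [0..<\<mu> ! i]) [0..<n])"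
  assumes "n \<le> length \<mu>"
  shows "length B = sum_list (take n \<mu>)" "set B = {(i, j). i < n \<and> j < \<mu> ! i}"
    "sorted_wrt (\<lambda>a b. fst a < fst b \<or> fst a = fst b \<and> snd a < snd b) B"
proof -
  have "length B = sum_list (take n \<mu>) \<and> set B = {(i, j). i < n \<and> j < \<mu> ! i} \<and>
    sorted_wrt (\<lambda>a b. fst a < fst b \<or> fst a = fst b \<and> snd a < snd b) B"
    using assms(2) unfolding B_def
  proof (induction n)
    case (Suc n)
    have "sorted_wrt (\<lambda>a b. fst a < fst b \<or> fst a = fst b \<and> snd a < snd b) (map (Pair n) [0..<m])" for m
      by (induction m) (auto simp: sorted_wrt_append)
    then show ?case
      using Suc by (auto simp: take_Suc_conv_app_nth sorted_wrt_append less_Suc_eq)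
  qed simp
  then show "length B = sum_list (take n \<mu>)" "set B = {(i, j). i < n \<and> j < \<mu> ! i}"
    "sorted_wrt (\<lambda>a b. fst a < fst b \<or> fst a = fst b \<and> snd a < snd b) B"
    by blast+
qed

lemma length_boxes [simp]: "length (boxes \<mu>) = N"
  using boxes_prefix(1)[of "length \<mu>"] by (simp add: boxes_def)

lemma set_boxes: "set (boxes \<mu>) = {(i, j). i < length \<mu> \<and> j < \<mu> ! i}"
  using boxes_prefix(2)[of "length \<mu>"] by (simp add: boxes_def)

lemma boxes_less: "k < k' \<Longrightarrow> k' < N \<Longrightarrow> box_row k < box_row k' \<or> box_row k = box_row k' \<and> box_col k < box_col k'"
  using boxes_prefix(3)[of "length \<mu>"] by (simp add: boxes_def[symmetric] sorted_wrt_iff_nth_less)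

lemma box_inj: "k < N \<Longrightarrow> k' < N \<Longrightarrow> box_row k = box_row k' \<Longrightarrow> box_col k = box_col k' \<Longrightarrow> k = k'"
  using boxes_less[of k k'] boxes_less[of k' k] by (cases k k' rule: linorder_cases) auto

lemma box_bound: "k < N \<Longrightarrow> box_row k < length \<mu>" "k < N \<Longrightarrow> box_col k < \<mu> ! box_row k"
  using set_boxes nth_mem[of k "boxes \<mu>"] by (auto simp: prod_eq_iff split: prod.splits)

lemma box_exists: "i < length \<mu> \<Longrightarrow> j < \<mu> ! i \<Longrightarrow> \<exists>k<N. box_row k = i \<and> box_col k = j"
  using set_boxes by (metis (no_types, lifting) case_prodI fst_conv in_set_conv_nth length_boxes
      mem_Collect_eq snd_conv)

lemma sorted_rows: "sorted box_rows"
  unfolding sorted_iff_nth_mono_less using boxes_less by fastforce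

lemma finite_groups: "finite (row_group \<mu>)" "finite (column_group \<mu>)"
  by (auto simp: row_group_def column_group_def intro: finite_subset[OF _ finite_permutations[of "{..<N}"]])

lemma row_groupD: "p \<in> row_group \<mu> \<Longrightarrow> p permutes {..<N}" "p \<in> row_group \<mu> \<Longrightarrow> k < N \<Longrightarrow> box_row (p k) = box_row k"
  by (auto simp: row_group_def)

lemma column_groupD:
  "q \<in> column_group \<mu> \<Longrightarrow> q permutes {..<N}" "q \<in> column_group \<mu> \<Longrightarrow> k < N \<Longrightarrow> box_col (q k) = box_col k"
  by (auto simp: column_group_def)

lemma permutes_less: "p permutes {..<N} \<Longrightarrow> k < N \<Longrightarrow> p k < N"
  by (metis lessThan_iff permutes_in_image)

lemma row_group_comp: "p \<in> row_group \<mu> \<Longrightarrow> p' \<in> row_group \<mu> \<Longrightarrow> p \<circ> p' \<in> row_group \<mu>"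
  using permutes_less by (auto simp: row_group_def permutes_compose)

lemma column_group_comp: "p \<in> column_group \<mu> \<Longrightarrow> p' \<in> column_group \<mu> \<Longrightarrow> p \<circ> p' \<in> column_group \<mu>"
  using permutes_less by (auto simp: column_group_def permutes_compose)

lemma row_group_inv: "p \<in> row_group \<mu> \<Longrightarrow> inv p \<in> row_group \<mu>"
proof -
  assume p: "p \<in> row_group \<mu>"
  then have inv: "inv p permutes {..<N}"
    using row_groupD(1) permutes_inv by blast
  have "box_row (inv p k) = box_row k" if "k < N" for k
    using row_groupD(2)[OF p permutes_less[OF inv that]] permutes_inverses(1)[OF row_groupD(1)[OF p]]
    by simp
  with inv show "inv p \<in> row_group \<mu>"
    by (simp add: row_group_def)
qed

lemma id_in_groups: "id \<in> row_group \<mu>" "id \<in> column_group \<mu>"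
  by (auto simp: row_group_def column_group_def permutes_id)

text \<open>It grows when large entries move to lower rows. Straightening raises it step by step,
  and the independence of the semistandard vectors is triangular with respect to it.\<close>

definition row_weight :: "nat list \<Rightarrow> nat" where
  "row_weight T = (\<Sum>k<N. box_row k * T ! k)"

definition semistandard_fillings :: "nat \<Rightarrow> nat list set" where
  "semistandard_fillings n = {T. length T = N \<and> set T \<subseteq> {..<n} \<and>
     (\<forall>k k'. k \<le> k' \<longrightarrow> k' < N \<longrightarrow> box_row k = box_row k' \<longrightarrow> T ! k \<le> T ! k') \<and>
     (\<forall>k k'. k < N \<longrightarrow> k' < N \<longrightarrow> box_col k = box_col k' \<longrightarrow> box_row k' = Suc (box_row k) \<longrightarrow> T ! k < T ! k')}"

lemma row_weight_permute:
  assumes p: "p \<in> row_group \<mu>" and T: "length T = N"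
  shows "row_weight (permute_list p T) = row_weight T"
proof -
  have perm: "p permutes {..<N}"
    using p by (rule row_groupD)
  have "row_weight (permute_list p T) = (\<Sum>k<N. box_row (p k) * T ! p k)"
    unfolding row_weight_def using p perm T by (intro sum.cong refl) (simp add: permute_list_nth row_groupD(2))
  also have "\<dots> = row_weight T"
    unfolding row_weight_def using sum.permute[OF perm, of "\<lambda>k. box_row k * T ! k"] by (simp add: o_def)
  finally show ?thesis .
qed

text \<open>The multiset of pairs (row, entry) is the tabloid of a filling, and row permutations act
  transitively on the fillings with a given tabloid.\<close>

lemma row_equivalent_permute:
  assumes T: "length T = N" "length S = N" and eq: "mset (zip box_rows S) = mset (zip box_rows T)"
  obtains p where "p \<in> row_group \<mu>" "permute_list p T = S"
proof -
  have "length (zip box_rows T) = N"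
    using T by simp
  then obtain p where p: "p permutes {..<N}" "permute_list p (zip box_rows T) = zip box_rows S"
    using mset_eq_permutation[OF eq] by auto
  have nth: "(box_rows ! p k, T ! p k) = (box_rows ! k, S ! k)" if "k < N" for k
  proof -
    have "permute_list p (zip box_rows T) ! k = zip box_rows T ! p k"
      using p(1) T that by (intro permute_list_nth) auto
    then show ?thesis
      using p T that permutes_less[OF p(1) that] by simp
  qed
  then have "p \<in> row_group \<mu>"
    using p permutes_less by (auto simp: row_group_def)
  moreover have "permute_list p T = S"
    using nth p(1) T by (intro nth_equalityI) (auto simp: permute_list_nth)
  ultimately show thesis
    by (rule that)
qed

lemma row_sort:
  fixes n :: nat
  assumes T: "length T = N" "set T \<subseteq> {..<n}"
  obtains S where "length S = N" "set S \<subseteq> {..<n}" "mset (zip box_rows S) = mset (zip box_rows T)"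
    "\<And>k k'. k \<le> k' \<Longrightarrow> k' < N \<Longrightarrow> box_row k = box_row k' \<Longrightarrow> S ! k \<le> S ! k'"
proof -
  \<comment> \<open>Entries are below \<open>n\<close>, so this number orders the pairs
    lexicographically, and division by \<open>n\<close> recovers the row. Sorting by it keeps the
    rows in place and sorts inside each of them.\<close>
  define key where "key = (\<lambda>(r, t). r * n + t :: nat)"
  define L where "L = sort_key key (zip box_rows T)"
  define S where "S = map snd L"
  have mset: "mset L = mset (zip box_rows T)"
    by (simp add: L_def)
  have len: "length L = N"
    using mset T by (metis length_boxes length_map length_zip min.idem size_mset)
  have set: "set L = set (zip box_rows T)"
    using mset by (metis set_mset_mset)
  then have less: "snd x < n" if "x \<in> set L" for x
    using that T(2) set_zip_rightD[of "fst x" "snd x" box_rows T] by auto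
  have key: "key (L ! k) \<le> key (L ! k')" if "k \<le> k'" "k' < N" for k k'
  proof -
    have "sorted (map key L)"
      by (simp add: L_def)
    from sorted_nth_mono[OF this, of k k'] show ?thesis
      using that len by simp
  qed
  have "fst (L ! k) \<le> fst (L ! k')" if "k \<le> k'" "k' < N" for k k'
  proof -
    have "key (L ! k) div n \<le> key (L ! k') div n"
      using key[OF that] by (rule div_le_mono)
    moreover have "key (L ! j) div n = fst (L ! j)" if "j < N" for j
      using less[of "L ! j"] that len by (simp add: key_def case_prod_unfold)
    ultimately show ?thesis
      using that by simp
  qed
  then have "sorted (map fst L)"
    using len by (simp add: sorted_iff_nth_mono)
  moreover have "mset (map fst L) = mset (map fst (zip box_rows T))"
    by (simp only: mset_map mset)
  ultimately have fst: "map fst L = box_rows"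
    using sorted_rows T by (metis length_boxes length_map map_fst_zip properties_for_sort)
  then have zip: "zip box_rows S = L"
    by (metis S_def zip_map_fst_snd)
  show thesis
  proof (rule that)
    show "length S = N"
      by (simp add: S_def len)
    show "set S \<subseteq> {..<n}"
      using less by (auto simp: S_def)
    show "mset (zip box_rows S) = mset (zip box_rows T)"
      by (simp add: zip mset)
    show "S ! k \<le> S ! k'" if "k \<le> k'" "k' < N" "box_row k = box_row k'" for k k'
    proof -
      have "fst (L ! j) = box_row j" if "j < N" for j
        using fst that len by (metis length_boxes nth_map)
      then show ?thesis
        using key[OF that(1,2)] that len by (simp add: key_def case_prod_unfold S_def)
    qed
  qed
qed

text \<open>This is the rearrangement inequality. A maximiser of the left-hand side must preserve the order
  in each column, so it is the identity.\<close>

lemma row_weight_column_permutation: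
  assumes S: "S \<in> semistandard_fillings n" and q: "q \<in> column_group \<mu>"
  shows "(\<Sum>k<N. box_row k * S ! q k) \<le> row_weight S"
    and "(\<Sum>k<N. box_row k * S ! q k) = row_weight S \<Longrightarrow> q = id"
proof -
  define F where "F = (\<lambda>q. \<Sum>k<N. box_row k * S ! q k)"
  have strict: "S ! k < S ! k'" if "k < N" "k' < N" "box_col k = box_col k'" "box_row k < box_row k'" for k k'
    using that
  proof (induction "box_row k'" arbitrary: k' rule: less_induct)
    case less
    obtain i where i: "box_row k' = Suc i"
      using less.prems(4) by (cases "box_row k'") auto
    have "\<mu> ! Suc i \<le> \<mu> ! i" "i < length \<mu>"
      using decreasing box_bound(1)[OF less.prems(2)] i by (auto simp: sorted_wrt_iff_nth_less)
    then obtain j where j: "j < N" "box_row j = i" "box_col j = box_col k'"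
      using box_exists[of i "box_col k'"] box_bound[OF less.prems(2)] i by auto
    have "S ! j < S ! k'"
      using S j less.prems i by (auto simp: semistandard_fillings_def)
    moreover have "S ! k \<le> S ! j"
    proof (cases "box_row k = i")
      case True
      then have "k = j"
        using box_inj[of k j] j less.prems by simp
      then show ?thesis
        by simp
    next
      case False
      then show ?thesis
        using less.hyps[of j] j less.prems i by auto
    qed
    ultimately show ?case
      by simp
  qed
  have maximal: "q = id" if q: "q \<in> column_group \<mu>" and max: "\<And>q'. q' \<in> column_group \<mu> \<Longrightarrow> F q' \<le> F q" for q
  proof -
    have perm: "q permutes {..<N}"
      using q by (rule column_groupD)
    have mono: "box_row (q a) < box_row (q b)" if ab: "a < N" "b < N" "box_col a = box_col b" "box_row a < box_row b" for a b
    proof (rule ccontr)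
      assume neg: "\<not> box_row (q a) < box_row (q b)"
      have qab: "q a < N" "q b < N" "box_col (q a) = box_col (q b)"
        using ab q perm permutes_less by (auto simp: column_groupD(2))
      have "a \<noteq> b"
        using ab by auto
      then have "q a \<noteq> q b"
        using perm by (metis permutes_inj injD)
      then have "box_row (q b) < box_row (q a)"
        using neg qab box_inj by (metis linorder_neqE_nat)
      then have S_less: "S ! q b < S ! q a"
        using strict qab by simp
      \<comment> \<open>Undoing the inversion at \<open>a\<close> and \<open>b\<close> would raise
        \<open>F\<close> by the product of the difference of the rows and the difference of the two
        entries.\<close>
      define t where "t = Transposition.transpose a b"
      have "t \<in> column_group \<mu>"
        using ab by (auto simp: column_group_def t_def permutes_swap_id Transposition.transpose_def)
      then have "q \<circ> t \<in> column_group \<mu>"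
        using q column_group_comp by blast
      from max[OF this] have le: "F (q \<circ> t) \<le> F q" .
      have split: "F p = box_row a * S ! p a + box_row b * S ! p b + (\<Sum>k\<in>{..<N} - {a, b}. box_row k * S ! p k)" for p
      proof -
        have "F p = (\<Sum>k\<in>{a, b}. box_row k * S ! p k) + (\<Sum>k\<in>{..<N} - {a, b}. box_row k * S ! p k)"
          unfolding F_def using ab by (subst sum.subset_diff[of "{a, b}"]) auto
        then show ?thesis
          using \<open>a \<noteq> b\<close> by simp
      qed
      have "(\<Sum>k\<in>{..<N} - {a, b}. box_row k * S ! (q \<circ> t) k) = (\<Sum>k\<in>{..<N} - {a, b}. box_row k * S ! q k)"
        by (intro sum.cong refl) (auto simp: t_def Transposition.transpose_def)
      then have "box_row a * S ! q b + box_row b * S ! q a \<le> box_row a * S ! q a + box_row b * S ! q b"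
        using le unfolding split by (simp add: t_def)
      moreover define d where "d = box_row b - box_row a"
      ultimately have "d * S ! q a \<le> d * S ! q b"
        using ab by (simp add: d_def diff_mult_distrib)
      moreover have "d > 0"
        using ab by (simp add: d_def)
      ultimately show False
        using S_less by simp
    qed
    \<comment> \<open>By \<open>mono\<close>, \<open>q\<close> preserves the order in each column.
      The first box of a column that it moves would go down, and the box mapped to its place lies
      further down, which contradicts the order.\<close>
    have fixed: "q k = k" if "k < N" for k
      using that
    proof (induction "box_row k" arbitrary: k rule: less_induct)
      case less
      show ?case
      proof (rule ccontr)
        assume ne: "q k \<noteq> k"
        have qk: "q k < N" "box_col (q k) = box_col k"
          using less.prems perm q permutes_less by (auto simp: column_groupD(2))
        then have "box_row (q k) \<noteq> box_row k"
          using ne less.prems box_inj by blast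
        moreover have "\<not> box_row (q k) < box_row k"
          using less.hyps[of "q k"] qk ne perm by (metis permutes_inj injD)
        ultimately have gt: "box_row k < box_row (q k)"
          by simp
        obtain b where b: "b < N" "q b = k"
          using less.prems perm by (metis imageE lessThan_iff permutes_image)
        have "box_col b = box_col k"
          using column_groupD(2)[OF q b(1)] b(2) by simp
        moreover have "b \<noteq> k"
          using b ne by auto
        ultimately have "box_row b \<noteq> box_row k"
          using box_inj b less.prems by blast
        moreover have "\<not> box_row b < box_row k"
          using less.hyps[of b] b \<open>b \<noteq> k\<close> by auto
        ultimately have "box_row (q k) < box_row (q b)"
          using mono[of k b] less.prems b \<open>box_col b = box_col k\<close> by simp
        then show False
          using b gt by simp
      qed
    qed
    show "q = id"
    proof
      fix k
      show "q k = id k"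
        using fixed perm by (cases "k < N") (auto simp: permutes_def)
    qed
  qed
  have "Max (F ` column_group \<mu>) \<in> F ` column_group \<mu>"
    using finite_groups(2) id_in_groups(2) by (intro Max_in) auto
  then obtain m where m: "m \<in> column_group \<mu>" "F m = Max (F ` column_group \<mu>)"
    by auto
  have max: "F q' \<le> F m" if "q' \<in> column_group \<mu>" for q'
    unfolding m(2) using finite_groups(2) that by (intro Max_ge) auto
  have "m = id"
    by (rule maximal[OF m(1) max])
  then have F_le: "F q' \<le> F id" if "q' \<in> column_group \<mu>" for q'
    using max[OF that] by simp
  moreover have "F id = row_weight S"
    by (simp add: F_def row_weight_def)
  ultimately show "(\<Sum>k<N. box_row k * S ! q k) \<le> row_weight S"
    using q by (simp add: F_def)
  show "q = id" if "(\<Sum>k<N. box_row k * S ! q k) = row_weight S"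
    using maximal[OF q] F_le that \<open>F id = row_weight S\<close> by (simp add: F_def)
qed

text \<open>A semistandard filling is the sorted representative of its tabloid: the keys increase
  along the reading order, and a sorted list is determined by its multiset.\<close>

lemma semistandard_row_equivalent_eq:
  assumes T: "T \<in> semistandard_fillings n" and S: "S \<in> semistandard_fillings n"
    and p: "p \<in> row_group \<mu>" "permute_list p T = S"
  shows "S = T"
proof -
  define key where "key = (\<lambda>U. map (\<lambda>k. box_row k * n + U ! k) [0..<N])"
  have len: "length T = N" "length S = N"
    using T S by (auto simp: semistandard_fillings_def)
  have bound: "U ! k < n" if "U \<in> semistandard_fillings n" "k < N" for U k
    using that by (auto simp: semistandard_fillings_def subset_eq)
  have "sorted (key U)" if U: "U \<in> semistandard_fillings n" for U
    unfolding sorted_iff_nth_mono_less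
  proof (intro allI impI)
    fix i j assume "i < j" "j < length (key U)"
    then have ij: "i < j" "j < N"
      by (auto simp: key_def)
    have "box_row i * n + U ! i \<le> box_row j * n + U ! j"
    proof (cases "box_row i = box_row j")
      case True
      then show ?thesis
        using U ij by (auto simp: semistandard_fillings_def)
    next
      case False
      then have "Suc (box_row i) \<le> box_row j"
        using boxes_less[OF ij] by auto
      then have "Suc (box_row i) * n \<le> box_row j * n"
        by (rule mult_le_mono1)
      then show ?thesis
        using bound[OF U, of i] ij by simp
    qed
    then show "key U ! i \<le> key U ! j"
      using ij by (simp add: key_def)
  qed
  moreover have "mset (key S) = mset (key T)"
  proof -
    have perm: "p permutes {..<N}"
      using p row_groupD by blast
    have "key S = permute_list p (key T)"
      using p perm len
      by (intro nth_equalityI)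
        (auto simp: key_def permute_list_nth permutes_less row_groupD(2)[OF p(1)])
    then show ?thesis
      using perm by (simp add: key_def)
  qed
  ultimately have eq: "key S = key T"
    using S T by (metis properties_for_sort)
  have "S ! k = T ! k" if "k < N" for k
    using arg_cong[OF eq, of "\<lambda>xs. xs ! k"] that by (simp add: key_def)
  then show ?thesis
    using len by (intro nth_equalityI) auto
qed

end

section \<open>Garnir relations\<close>

context young_diagram
begin

definition basis_tensor :: "(nat \<Rightarrow> 'a \<Rightarrow> complex) \<Rightarrow> nat list \<Rightarrow> 'a list \<Rightarrow> complex" where
  "basis_tensor v T = pure_tensor (map v T)"

definition filling_vector :: "(nat \<Rightarrow> 'a \<Rightarrow> complex) \<Rightarrow> nat list \<Rightarrow> 'a list \<Rightarrow> complex" where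
  "filling_vector v T = young_symmetrizer \<mu> (basis_tensor v T)"

lemma filling_vector_eq:
  assumes T: "length T = N"
  shows "filling_vector v T = (\<Sum>p\<in>row_group \<mu>. \<Sum>q\<in>column_group \<mu>.
    cscale (of_int (sign q)) (basis_tensor v (permute_list (p \<circ> q) T)))"
  unfolding filling_vector_def young_symmetrizer_def basis_tensor_def
proof (intro sum.cong refl arg_cong[of _ _ "cscale _"])
  fix p q assume "p \<in> row_group \<mu>" "q \<in> column_group \<mu>"
  then have pq: "p \<circ> q permutes {..<N}"
    using row_groupD(1) column_groupD(1) permutes_compose by blast
  then show "permute_tensor (p \<circ> q) (pure_tensor (map v T)) = pure_tensor (map v (permute_list (p \<circ> q) T))"
    using T by (subst permute_tensor_pure_tensor) (simp_all add: permute_list_map)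
qed

text \<open>In the right action \<open>p\<close> acts before \<open>q\<close>, so the sum over the
  row group absorbs \<open>r\<close>. The vectors are thus symmetric in the rows of the filling, and
  this is why the relations below are sums without signs.\<close>

lemma filling_vector_row_permute:
  assumes T: "length T = N" and r: "r \<in> row_group \<mu>"
  shows "filling_vector v (permute_list r T) = filling_vector v T"
proof -
  define f where "f p = (\<Sum>q\<in>column_group \<mu>.
    cscale (of_int (sign q)) (basis_tensor v (permute_list (p \<circ> q) T)))" for p
  have "filling_vector v (permute_list r T) = (\<Sum>p\<in>row_group \<mu>. f (r \<circ> p))"
    unfolding filling_vector_eq[OF trans[OF length_permute_list T]] f_def
  proof (intro sum.cong refl arg_cong[of _ _ "cscale _"] arg_cong[of _ _ "basis_tensor v"])
    fix p q assume "p \<in> row_group \<mu>" "q \<in> column_group \<mu>"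
    then have "p \<circ> q permutes {..<N}"
      using row_groupD(1) column_groupD(1) permutes_compose by blast
    then show "permute_list (p \<circ> q) (permute_list r T) = permute_list (r \<circ> p \<circ> q) T"
      using T by (subst permute_list_compose[symmetric]) (simp_all add: comp_assoc)
  qed
  also have "\<dots> = (\<Sum>p\<in>row_group \<mu>. f p)"
  proof (rule sum.reindex_bij_witness[of _ "\<lambda>p. inv r \<circ> p" "\<lambda>p. r \<circ> p"])
    have "r permutes {..<N}"
      using r row_groupD by blast
    then show "inv r \<circ> (r \<circ> p) = p" "r \<circ> (inv r \<circ> p) = p" for p
      by (simp_all add: comp_assoc[symmetric] permutes_inv_o)
    show "r \<circ> p \<in> row_group \<mu>" "inv r \<circ> p \<in> row_group \<mu>" if "p \<in> row_group \<mu>" for p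
      using that r row_group_comp row_group_inv by blast+
  qed simp
  also have "\<dots> = filling_vector v T"
    by (simp add: filling_vector_eq[OF T] f_def)
  finally show ?thesis .
qed

lemma filling_vector_row_equivalent:
  assumes "length T = N" "length S = N" "mset (zip box_rows S) = mset (zip box_rows T)"
  shows "filling_vector v S = filling_vector v T"
proof -
  obtain p where "p \<in> row_group \<mu>" "permute_list p T = S"
    by (rule row_equivalent_permute[OF assms])
  then show ?thesis
    using filling_vector_row_permute[OF assms(1)] by metis
qed

text \<open>After any row permutation, two boxes of \<open>X\<close> lie in the same column, and the transposition of
  these boxes flips the sign.\<close>

lemma garnir_relation:
  assumes T: "length T = N" and i: "Suc i < length \<mu>"
    and X: "X \<subseteq> {k. k < N \<and> (box_row k = i \<or> box_row k = Suc i)}" and card: "card X > \<mu> ! i"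
  shows "(\<Sum>\<tau> | \<tau> permutes X. filling_vector v (permute_list \<tau> T)) = 0"
proof -
  have XN: "X \<subseteq> {..<N}" and "finite X"
    using X by (auto intro: finite_subset[of X "{..<N}"])
  have perm: "\<tau> permutes {..<N}" if "\<tau> permutes X" for \<tau>
    using that XN by (rule permutes_subset)
  define g where "g p \<tau> q =
    cscale (of_int (sign q)) (basis_tensor v (permute_list (\<tau> \<circ> p \<circ> q) T))" for p \<tau> q :: "nat \<Rightarrow> nat"
  have inner: "(\<Sum>\<tau> | \<tau> permutes X. \<Sum>q\<in>column_group \<mu>. g p \<tau> q) = 0" if p: "p \<in> row_group \<mu>" for p
  proof -
    have pp: "p permutes {..<N}" "inv p permutes {..<N}"
      using row_groupD(1)[OF p] permutes_inv by auto
    \<comment> \<open>\<open>inv p\<close> keeps the rows, so the moved set still lies in the rows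
      \<open>i\<close> and \<open>i + 1\<close> and meets at most \<open>\<mu> ! i\<close> columns.
      By the pigeonhole principle two of its boxes share a column.\<close>
    have "box_col k < \<mu> ! i" if k: "k \<in> inv p ` X" for k
    proof -
      obtain x where x: "x \<in> X" "k = inv p x"
        using k by blast
      then have "k < N" "box_row k = box_row x"
        using XN permutes_less[OF pp(2), of x] row_groupD(2)[OF row_group_inv[OF p], of x] by auto
      moreover have "\<mu> ! Suc i \<le> \<mu> ! i"
        using decreasing i by (auto simp: sorted_wrt_iff_nth_less)
      ultimately show ?thesis
        using box_bound(2)[of k] X x by auto
    qed
    then have "box_col ` (inv p ` X) \<subseteq> {..<\<mu> ! i}"
      by blast
    then have "card (box_col ` (inv p ` X)) \<le> \<mu> ! i"
      using card_mono[of "{..<\<mu> ! i}"] by fastforce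
    moreover have "card (inv p ` X) = card X"
      using pp(2) by (intro card_image) (meson inj_on_subset permutes_inj subset_UNIV)
    ultimately have "\<not> inj_on box_col (inv p ` X)"
      using card card_image by force
    then obtain x y where xy: "x \<in> X" "y \<in> X" "inv p x \<noteq> inv p y" "box_col (inv p x) = box_col (inv p y)"
      by (auto simp: inj_on_def)
    define a b where "a = inv p x" and "b = inv p y"
    have ab: "a < N" "b < N" "a \<noteq> b" "box_col a = box_col b" "p a = x" "p b = y"
      using xy XN permutes_less[OF pp(2)] by (auto simp: a_def b_def permutes_inverses[OF pp(1)])
    define t where "t = Transposition.transpose a b"
    define t' where "t' = Transposition.transpose x y"
    have t: "t \<in> column_group \<mu>" "sign t = - 1" "t \<circ> t = id"
      using ab by (auto simp: column_group_def t_def permutes_swap_id Transposition.transpose_def sign_swap_id)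
    have t': "t' permutes X" "t' \<circ> t' = id"
      using xy by (auto simp: t'_def permutes_swap_id)
    have tp: "t' \<circ> p = p \<circ> t"
    proof
      fix k
      show "(t' \<circ> p) k = (p \<circ> t) k"
        using ab permutes_inj[OF pp(1)]
        by (auto simp: t_def t'_def Transposition.transpose_def dest: injD)
    qed
    \<comment> \<open>The two transpositions cancel through \<open>tp\<close>, so the tensor stays
      the same while the sign of \<open>q\<close> changes. Reindexing by this involution shows that
      the sum equals its own negative.\<close>
    have flip: "g p (\<tau> \<circ> t') (t \<circ> q) = - g p \<tau> q" if q: "q \<in> column_group \<mu>" for \<tau> q
    proof -
      have "\<tau> \<circ> t' \<circ> p \<circ> (t \<circ> q) = \<tau> \<circ> (t' \<circ> p) \<circ> t \<circ> q"
        by (simp add: comp_assoc)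
      also have "\<dots> = \<tau> \<circ> p \<circ> (t \<circ> t) \<circ> q"
        by (simp add: tp comp_assoc)
      finally have eq: "\<tau> \<circ> t' \<circ> p \<circ> (t \<circ> q) = \<tau> \<circ> p \<circ> q"
        by (simp add: t)
      have "sign (t \<circ> q) = - sign q"
      proof -
        have "permutation t" "permutation q"
          using column_groupD(1)[OF t(1)] column_groupD(1)[OF q] permutes_imp_permutation by blast+
        then show ?thesis
          by (simp add: sign_compose t)
      qed
      then show ?thesis
        unfolding g_def eq by (simp add: cscale_def fun_eq_iff)
    qed
    let ?Z = "\<Sum>(\<tau>, q)\<in>{\<tau>. \<tau> permutes X} \<times> column_group \<mu>. g p \<tau> q"
    have "?Z = (\<Sum>(\<tau>, q)\<in>{\<tau>. \<tau> permutes X} \<times> column_group \<mu>. - g p \<tau> q)"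
    proof (rule sum.reindex_bij_witness[of _ "\<lambda>(\<tau>, q). (\<tau> \<circ> t', t \<circ> q)" "\<lambda>(\<tau>, q). (\<tau> \<circ> t', t \<circ> q)"])
      fix z assume "z \<in> {\<tau>. \<tau> permutes X} \<times> column_group \<mu>"
      then obtain \<tau> q where z: "z = (\<tau>, q)" "\<tau> permutes X" "q \<in> column_group \<mu>"
        by auto
      show "(case case z of (\<tau>, q) \<Rightarrow> (\<tau> \<circ> t', t \<circ> q) of (\<tau>, q) \<Rightarrow> (\<tau> \<circ> t', t \<circ> q)) = z"
        using t t' by (simp add: z comp_assoc) (simp add: comp_assoc[symmetric])
      then show "(case case z of (\<tau>, q) \<Rightarrow> (\<tau> \<circ> t', t \<circ> q) of (\<tau>, q) \<Rightarrow> (\<tau> \<circ> t', t \<circ> q)) = z" .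
      show "(case z of (\<tau>, q) \<Rightarrow> (\<tau> \<circ> t', t \<circ> q)) \<in> {\<tau>. \<tau> permutes X} \<times> column_group \<mu>"
        using t(1) t'(1) z(2,3) by (auto simp: z(1) permutes_compose column_group_comp)
      then show "(case z of (\<tau>, q) \<Rightarrow> (\<tau> \<circ> t', t \<circ> q)) \<in> {\<tau>. \<tau> permutes X} \<times> column_group \<mu>" .
      show "(case case z of (\<tau>, q) \<Rightarrow> (\<tau> \<circ> t', t \<circ> q) of (\<tau>, q) \<Rightarrow> - g p \<tau> q) = (case z of (\<tau>, q) \<Rightarrow> g p \<tau> q)"
        using flip[OF z(3)] by (simp add: z)
    qed
    then have "?Z = - ?Z"
      by (simp add: sum_negf case_prod_unfold)
    then have "?Z = 0"
      by (simp add: fun_eq_iff)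
    then show ?thesis
      by (simp only: sum.cartesian_product)
  qed
  have "(\<Sum>\<tau> | \<tau> permutes X. filling_vector v (permute_list \<tau> T)) =
      (\<Sum>\<tau> | \<tau> permutes X. \<Sum>p\<in>row_group \<mu>. \<Sum>q\<in>column_group \<mu>. g p \<tau> q)"
  proof (intro sum.cong refl)
    fix \<tau> assume "\<tau> \<in> {\<tau>. \<tau> permutes X}"
    show "filling_vector v (permute_list \<tau> T) = (\<Sum>p\<in>row_group \<mu>. \<Sum>q\<in>column_group \<mu>. g p \<tau> q)"
      unfolding filling_vector_eq[OF trans[OF length_permute_list T]] g_def
    proof (intro sum.cong refl arg_cong[of _ _ "cscale _"] arg_cong[of _ _ "basis_tensor v"])
      fix p q assume "p \<in> row_group \<mu>" "q \<in> column_group \<mu>"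
      then have "p \<circ> q permutes {..<N}"
        using row_groupD(1) column_groupD(1) permutes_compose by blast
      then show "permute_list (p \<circ> q) (permute_list \<tau> T) = permute_list (\<tau> \<circ> p \<circ> q) T"
        using T by (subst permute_list_compose[symmetric]) (simp_all add: comp_assoc)
    qed
  qed
  also have "\<dots> = (\<Sum>p\<in>row_group \<mu>. \<Sum>\<tau> | \<tau> permutes X. \<Sum>q\<in>column_group \<mu>. g p \<tau> q)"
    by (rule sum.swap)
  also have "\<dots> = 0"
    by (rule sum.neutral) (use inner in blast)
  finally show ?thesis .
qed

text \<open>At a violation of column strictness in the rows \<open>i\<close> and \<open>i + 1\<close>, the entries of the exchanged
  boxes in row \<open>i\<close> are at least those in row \<open>i + 1\<close>, so that exchanges only move weight downwards.\<close>

lemma row_weight_exchange: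
  assumes T: "length T = N" and \<tau>: "\<tau> permutes {..<N}"
    and rows: "\<And>k. k < N \<Longrightarrow> box_row (\<tau> k) = box_row k \<or> {box_row k, box_row (\<tau> k)} = {i, Suc i}"
    and down: "\<And>k. k < N \<Longrightarrow> box_row k = Suc i \<Longrightarrow> box_row (\<tau> k) = i \<Longrightarrow> c \<le> T ! \<tau> k"
    and up: "\<And>k. k < N \<Longrightarrow> box_row k = i \<Longrightarrow> box_row (\<tau> k) = Suc i \<Longrightarrow> T ! \<tau> k \<le> c"
  shows "row_weight T \<le> row_weight (permute_list \<tau> T)"
    and "row_weight (permute_list \<tau> T) = row_weight T \<Longrightarrow>
      mset (zip box_rows (permute_list \<tau> T)) = mset (zip box_rows T)"
proof -
  define D where "D = {k. k < N \<and> box_row k = Suc i \<and> box_row (\<tau> k) = i}"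
  define U where "U = {k. k < N \<and> box_row k = i \<and> box_row (\<tau> k) = Suc i}"
  define R where "R = {..<N} - D - U"
  have split: "{..<N} = R \<union> (D \<union> U)" "R \<inter> (D \<union> U) = {}" "D \<inter> U = {}" "finite R" "finite D" "finite U"
    by (auto simp: R_def D_def U_def)
  have R: "box_row (\<tau> k) = box_row k" if "k \<in> R" for k
    using that rows[of k] by (auto simp: R_def D_def U_def doubleton_eq_iff)
  have sum_split: "(\<Sum>k<N. f k) = sum f R + (sum f D + sum f U)" for f :: "nat \<Rightarrow> int"
    unfolding split(1) using split by (simp add: sum.union_disjoint)
  have permute_sum: "(\<Sum>k<N. f (\<tau> k)) = (\<Sum>k<N. f k)" for f :: "nat \<Rightarrow> int"
    using sum.permute[OF \<tau>, of f] by (simp add: o_def)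
  have nth: "permute_list \<tau> T ! k = T ! \<tau> k" if "k < N" for k
    using \<tau> T that by (simp add: permute_list_nth)
  \<comment> \<open>The sum of the row numbers over all boxes is invariant under
    \<open>\<tau>\<close>, so as many entries come down as go up.\<close>
  have "(\<Sum>k<N. int (box_row k) - int (box_row (\<tau> k))) = int (card D) - int (card U)"
    unfolding sum_split by (simp add: R D_def U_def)
  then have card: "card D = card U"
    using permute_sum[of "\<lambda>k. int (box_row k)"] by (simp add: sum_subtractf)
  have "int (row_weight (permute_list \<tau> T)) - int (row_weight T) =
      (\<Sum>k<N. int (box_row k) * int (T ! \<tau> k)) - (\<Sum>k<N. int (box_row (\<tau> k)) * int (T ! \<tau> k))"
    unfolding permute_sum[of "\<lambda>k. int (box_row k) * int (T ! k)"] by (simp add: row_weight_def nth)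
  also have "\<dots> = (\<Sum>k<N. (int (box_row k) - int (box_row (\<tau> k))) * int (T ! \<tau> k))"
    by (simp add: sum_subtractf left_diff_distrib)
  also have "\<dots> = (\<Sum>k\<in>D. int (T ! \<tau> k)) - (\<Sum>k\<in>U. int (T ! \<tau> k))"
    unfolding sum_split by (simp add: R D_def U_def sum_negf)
  \<comment> \<open>Since \<open>D\<close> and \<open>U\<close> have the same size, the threshold
    \<open>c\<close> can be inserted, and both sums become nonnegative term by term.\<close>
  also have "\<dots> = (\<Sum>k\<in>D. int (T ! \<tau> k) - int c) + (\<Sum>k\<in>U. int c - int (T ! \<tau> k))"
    by (simp add: sum_subtractf card)
  finally have diff: "int (row_weight (permute_list \<tau> T)) - int (row_weight T) =
      (\<Sum>k\<in>D. int (T ! \<tau> k) - int c) + (\<Sum>k\<in>U. int c - int (T ! \<tau> k))" .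
  have nonneg: "\<And>k. k \<in> D \<Longrightarrow> 0 \<le> int (T ! \<tau> k) - int c" "\<And>k. k \<in> U \<Longrightarrow> 0 \<le> int c - int (T ! \<tau> k)"
    using down up by (auto simp: D_def U_def)
  then have "0 \<le> (\<Sum>k\<in>D. int (T ! \<tau> k) - int c)" "0 \<le> (\<Sum>k\<in>U. int c - int (T ! \<tau> k))"
    by (auto intro!: sum_nonneg)
  then show "row_weight T \<le> row_weight (permute_list \<tau> T)"
    using diff by linarith
  assume "row_weight (permute_list \<tau> T) = row_weight T"
  then have "(\<Sum>k\<in>D. int (T ! \<tau> k) - int c) = 0" "(\<Sum>k\<in>U. int c - int (T ! \<tau> k)) = 0"
    using diff \<open>0 \<le> (\<Sum>k\<in>D. int (T ! \<tau> k) - int c)\<close> \<open>0 \<le> (\<Sum>k\<in>U. int c - int (T ! \<tau> k))\<close> by linarith+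
  \<comment> \<open>In the case of equality only copies of \<open>c\<close> have changed rows, so
    the tabloid is the same.\<close>
  then have const: "\<And>k. k \<in> D \<Longrightarrow> T ! \<tau> k = c" "\<And>k. k \<in> U \<Longrightarrow> T ! \<tau> k = c"
    using nonneg split by (auto simp: sum_nonneg_eq_0_iff)
  have mset_zip: "mset (zip box_rows S) = image_mset (\<lambda>k. (box_row k, S ! k)) (mset_set {..<N})"
    if "length S = N" for S :: "nat list"
  proof -
    have "zip box_rows S = map (\<lambda>k. (box_row k, S ! k)) [0..<N]"
      using that by (intro nth_equalityI) auto
    then show ?thesis
      by (simp add: atLeast0LessThan)
  qed
  have mset_split: "mset_set {..<N} = mset_set R + (mset_set D + mset_set U)"
    unfolding split(1) using split by (simp add: mset_set_Union)
  have "mset (zip box_rows T) = image_mset (\<lambda>k. (box_row k, T ! k)) (image_mset \<tau> (mset_set {..<N}))"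
    using T \<tau> permutes_inj[OF \<tau>]
    by (simp only: mset_zip) (subst image_mset_mset_set, auto simp: permutes_image intro: inj_on_subset)
  also have "\<dots> = image_mset (\<lambda>k. (box_row (\<tau> k), T ! \<tau> k)) (mset_set {..<N})"
    by (simp add: image_mset.compositionality o_def)
  also have "\<dots> = image_mset (\<lambda>k. (box_row k, T ! \<tau> k)) (mset_set R) +
      (image_mset (\<lambda>k. (i, c)) (mset_set D) + image_mset (\<lambda>k. (Suc i, c)) (mset_set U))"
    unfolding mset_split image_mset_union
    using split const R by (intro arg_cong2[of _ _ _ _ "(+)"] image_mset_cong) (auto simp: D_def U_def)
  also have "\<dots> = image_mset (\<lambda>k. (box_row k, T ! \<tau> k)) (mset_set R) +
      (image_mset (\<lambda>k. (Suc i, c)) (mset_set D) + image_mset (\<lambda>k. (i, c)) (mset_set U))"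
    by (simp add: image_mset_const_eq card)
  also have "\<dots> = image_mset (\<lambda>k. (box_row k, T ! \<tau> k)) (mset_set {..<N})"
    unfolding mset_split image_mset_union
    using split const by (intro arg_cong2[of _ _ _ _ "(+)"] image_mset_cong) (auto simp: D_def U_def)
  also have "\<dots> = mset (zip box_rows (permute_list \<tau> T))"
    using T by (subst mset_zip) (auto simp: nth intro!: image_mset_cong)
  finally show "mset (zip box_rows (permute_list \<tau> T)) = mset (zip box_rows T)"
    by simp
qed

lemma row_weight_eq_mset: "length T = N \<Longrightarrow> row_weight T = (\<Sum>(r, t)\<in>#mset (zip box_rows T). r * t)"
proof -
  assume T: "length T = N"
  have "zip box_rows T = map (\<lambda>k. (box_row k, T ! k)) [0..<N]"
    using T by (intro nth_equalityI) auto
  then show ?thesis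
    by (simp add: row_weight_def sum_unfold_sum_mset atLeast0LessThan image_mset.compositionality o_def)
qed

text \<open>Induction on the distance of \<open>row_weight\<close> from an upper bound. Once its
  rows are sorted, a filling that is not semistandard violates strictness in a column, and the
  Garnir relation there expresses it through fillings of larger weight.\<close>

lemma straightening:
  assumes "length T = N" "set T \<subseteq> {..<n}"
  shows "filling_vector v T \<in> cfun.span (filling_vector v ` semistandard_fillings n)"
  using assms
proof (induction "N * length \<mu> * n - row_weight T" arbitrary: T rule: less_induct)
  case less
  obtain S where S: "length S = N" "set S \<subseteq> {..<n}" "mset (zip box_rows S) = mset (zip box_rows T)"
    and sorted: "\<And>k k'. k \<le> k' \<Longrightarrow> k' < N \<Longrightarrow> box_row k = box_row k' \<Longrightarrow> S ! k \<le> S ! k'"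
    by (rule row_sort[OF less.prems]) blast
  have weight: "row_weight S = row_weight T"
    using S less.prems by (simp add: row_weight_eq_mset)
  have vec: "filling_vector v S = filling_vector v T"
    by (rule filling_vector_row_equivalent[OF less.prems(1) S(1,3)])
  have bound: "row_weight U \<le> N * length \<mu> * n" if "length U = N" "set U \<subseteq> {..<n}" for U
  proof -
    have "box_row k * U ! k \<le> length \<mu> * n" if "k < N" for k
    proof (rule mult_le_mono)
      show "box_row k \<le> length \<mu>"
        using box_bound(1)[OF that] by simp
      have "U ! k \<in> set U"
        using that \<open>length U = N\<close> by simp
      then show "U ! k \<le> n"
        using \<open>set U \<subseteq> {..<n}\<close> by auto
    qed
    then have "row_weight U \<le> (\<Sum>k<N. length \<mu> * n)"
      unfolding row_weight_def by (intro sum_mono) auto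
    then show ?thesis
      by (simp add: mult.assoc)
  qed
  show ?case
  proof (cases "S \<in> semistandard_fillings n")
    case True
    then show ?thesis
      unfolding vec[symmetric] by (intro cfun.span_base) blast
  next
    case False
    then obtain a b where ab: "a < N" "b < N" "box_col a = box_col b" "box_row b = Suc (box_row a)"
      "S ! b \<le> S ! a"
      using S sorted by (auto simp: semistandard_fillings_def not_less)
    define i where "i = box_row a"
    \<comment> \<open>For a violation in column \<open>c\<close> these sets have
      \<open>\<mu> ! i - c\<close> and \<open>c + 1\<close> boxes, one more in total than row
      \<open>i\<close>. As the rows are sorted, the entries on \<open>Z\<close> are at most
      \<open>S ! b \<le> S ! a\<close>, and those on \<open>Y\<close> are at least
      \<open>S ! a\<close>, the threshold used for the exchange.\<close>
    define Y where "Y = {k. k < N \<and> box_row k = i \<and> box_col a \<le> box_col k}"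
    define Z where "Z = {k. k < N \<and> box_row k = Suc i \<and> box_col k \<le> box_col a}"
    define X where "X = Y \<union> Z"
    have i: "Suc i < length \<mu>" "i < length \<mu>"
      using box_bound(1)[OF ab(2)] ab(4) by (auto simp: i_def)
    have "card X = card Y + card Z"
      unfolding X_def by (rule card_Un_disjoint) (auto simp: Y_def Z_def)
    also have "card Y = \<mu> ! i - box_col a"
    proof -
      have "j \<in> box_col ` Y" if "box_col a \<le> j" "j < \<mu> ! i" for j
      proof -
        obtain k where "k < N" "box_row k = i" "box_col k = j"
          using box_exists[OF i(2)] \<open>j < \<mu> ! i\<close> by auto
        then show ?thesis
          using that by (auto simp: Y_def)
      qed
      moreover have "box_col k < \<mu> ! i" if "k \<in> Y" for k
        using that box_bound(2)[of k] by (auto simp: Y_def)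
      ultimately have "box_col ` Y = {box_col a..<\<mu> ! i}"
        by (auto simp: Y_def)
      moreover have "inj_on box_col Y"
        using box_inj by (auto simp: inj_on_def Y_def)
      ultimately show ?thesis
        by (metis card_atLeastLessThan card_image)
    qed
    also have "card Z = Suc (box_col a)"
    proof -
      have "box_col a < \<mu> ! Suc i"
        using box_bound(2)[OF ab(2)] ab by (simp add: i_def)
      have "j \<in> box_col ` Z" if j: "j \<le> box_col a" for j
      proof -
        obtain k where "k < N" "box_row k = Suc i" "box_col k = j"
          using box_exists[OF i(1), of j] j \<open>box_col a < \<mu> ! Suc i\<close> by auto
        then show ?thesis
          using that by (auto simp: Z_def)
      qed
      then have "box_col ` Z = {..box_col a}"
        by (auto simp: Z_def)
      moreover have "inj_on box_col Z"
        using box_inj by (auto simp: inj_on_def Z_def)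
      ultimately show ?thesis
        by (metis card_atMost card_image)
    qed
    finally have card: "card X > \<mu> ! i"
      using box_bound(2)[OF ab(1)] by (simp add: i_def)
    have XN: "X \<subseteq> {k. k < N \<and> (box_row k = i \<or> box_row k = Suc i)}" "X \<subseteq> {..<N}"
      by (auto simp: X_def Y_def Z_def)
    define P where "P = {\<tau>. \<tau> permutes X}"
    have "finite X"
      using XN(2) finite_subset by blast
    then have "finite P"
      by (simp add: P_def finite_permutations)
    have exchange: "row_weight S \<le> row_weight (permute_list \<tau> S)"
      "row_weight (permute_list \<tau> S) = row_weight S \<Longrightarrow>
        mset (zip box_rows (permute_list \<tau> S)) = mset (zip box_rows S)" if "\<tau> \<in> P" for \<tau>
    proof -
      have \<tau>: "\<tau> permutes X"
        using that by (simp add: P_def)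
      then have perm: "\<tau> permutes {..<N}"
        using XN(2) by (rule permutes_subset)
      have moved: "k \<in> X \<and> \<tau> k \<in> X" if "box_row (\<tau> k) \<noteq> box_row k" for k
        using that \<tau> by (metis permutes_in_image permutes_not_in)
      have 1: "box_row (\<tau> k) = box_row k \<or> {box_row k, box_row (\<tau> k)} = {i, Suc i}" if "k < N" for k
      proof (cases "box_row (\<tau> k) = box_row k")
        case False
        then show ?thesis
          using subsetD[OF XN(1), of k] subsetD[OF XN(1), of "\<tau> k"] moved[of k] by auto
      qed simp
      have 2: "S ! a \<le> S ! \<tau> k" if "k < N" "box_row k = Suc i" "box_row (\<tau> k) = i" for k
      proof -
        have "\<tau> k \<in> Y"
          using moved[of k] that by (auto simp: X_def Z_def)
        then have "\<tau> k < N" "box_row (\<tau> k) = box_row a" "box_col a \<le> box_col (\<tau> k)"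
          by (auto simp: Y_def i_def)
        then show ?thesis
          using sorted[of a "\<tau> k"] boxes_less[of "\<tau> k" a] ab(1) by (cases "\<tau> k < a") auto
      qed
      have 3: "S ! \<tau> k \<le> S ! a" if "k < N" "box_row k = i" "box_row (\<tau> k) = Suc i" for k
      proof -
        have "\<tau> k \<in> Z"
          using moved[of k] that by (auto simp: X_def Y_def)
        then have "\<tau> k < N" "box_row (\<tau> k) = box_row b" "box_col (\<tau> k) \<le> box_col b"
          using ab by (auto simp: Z_def i_def)
        then have "S ! \<tau> k \<le> S ! b"
          using sorted[of "\<tau> k" b] boxes_less[of b "\<tau> k"] ab(2) by (cases "b < \<tau> k") auto
        then show ?thesis
          using ab(5) by simp
      qed
      show "row_weight S \<le> row_weight (permute_list \<tau> S)"
        by (rule row_weight_exchange(1)[OF S(1) perm 1 2 3])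
      show "mset (zip box_rows (permute_list \<tau> S)) = mset (zip box_rows S)"
        if "row_weight (permute_list \<tau> S) = row_weight S"
        by (rule row_weight_exchange(2)[OF S(1) perm 1 2 3 that])
    qed
    \<comment> \<open>The permutations that keep the weight, \<open>id\<close> among them, all give
      the vector of \<open>S\<close>. In the relation this vector therefore has the coefficient
      \<open>card A\<close>, which is invertible.\<close>
    define A where "A = {\<tau> \<in> P. row_weight (permute_list \<tau> S) = row_weight S}"
    have "id \<in> A"
      by (simp add: A_def P_def permutes_id)
    then have "card A \<noteq> 0"
      using \<open>finite P\<close> by (auto simp: A_def)
    have "(\<Sum>\<tau>\<in>P. filling_vector v (permute_list \<tau> S)) = 0"
      unfolding P_def by (rule garnir_relation[OF S(1) i(1) XN(1) card])
    also have "(\<Sum>\<tau>\<in>P. filling_vector v (permute_list \<tau> S)) =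
        (\<Sum>\<tau>\<in>A. filling_vector v (permute_list \<tau> S)) + (\<Sum>\<tau>\<in>P - A. filling_vector v (permute_list \<tau> S))"
      using \<open>finite P\<close> sum.subset_diff[of A P] by (simp add: A_def add.commute)
    also have "(\<Sum>\<tau>\<in>A. filling_vector v (permute_list \<tau> S)) = (\<Sum>\<tau>\<in>A. filling_vector v S)"
      using exchange(2) S(1)
      by (intro sum.cong refl filling_vector_row_equivalent) (auto simp: A_def)
    finally have "(\<Sum>\<tau>\<in>A. filling_vector v S) = - (\<Sum>\<tau>\<in>P - A. filling_vector v (permute_list \<tau> S))"
      by (simp only: eq_neg_iff_add_eq_0)
    moreover have "(\<Sum>\<tau>\<in>A. filling_vector v S) = cscale (of_nat (card A)) (filling_vector v S)"
      by (induction A rule: infinite_finite_induct) (auto simp: cscale_def fun_eq_iff algebra_simps)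
    ultimately have "cscale (of_nat (card A)) (filling_vector v S) =
        - (\<Sum>\<tau>\<in>P - A. filling_vector v (permute_list \<tau> S))"
      by simp
    moreover have "filling_vector v (permute_list \<tau> S) \<in> cfun.span (filling_vector v ` semistandard_fillings n)"
      if "\<tau> \<in> P - A" for \<tau>
    proof (rule less.hyps)
      have perm: "\<tau> permutes {..<length S}"
        using that XN(2) S(1) permutes_subset by (auto simp: P_def)
      have "row_weight T < row_weight (permute_list \<tau> S)"
        using exchange(1)[of \<tau>] that weight by (auto simp: A_def)
      moreover show "length (permute_list \<tau> S) = N" "set (permute_list \<tau> S) \<subseteq> {..<n}"
        using S perm by simp_all
      moreover note bound[of "permute_list \<tau> S"]
      ultimately show "N * length \<mu> * n - row_weight (permute_list \<tau> S) < N * length \<mu> * n - row_weight T"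
        by simp
    qed
    ultimately have "cscale (of_nat (card A)) (filling_vector v S) \<in>
        cfun.span (filling_vector v ` semistandard_fillings n)"
      by (auto intro!: cfun.span_neg cfun.span_sum)
    from cfun.span_scale[OF this, of "inverse (of_nat (card A))"] show ?thesis
      using \<open>card A \<noteq> 0\<close> by (simp add: vec)
  qed
qed

end

section \<open>The semistandard basis of a Schur functor\<close>

lemma sum_fun_apply: "(\<Sum>x\<in>S. g x) z = (\<Sum>x\<in>S. g x z)" for g :: "'b \<Rightarrow> 'a \<Rightarrow> complex"
  by (induction S rule: infinite_finite_induct) auto

lemma module_hom_young_symmetrizer: "module_hom cscale cscale (young_symmetrizer \<mu>)"
proof
  show "young_symmetrizer \<mu> (f + g) = young_symmetrizer \<mu> f + young_symmetrizer \<mu> g" for f g :: "'a list \<Rightarrow> complex"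
    by (simp add: young_symmetrizer_def fun_eq_iff sum_fun_apply cscale_def permute_tensor_def
        distrib_left sum.distrib)
  show "young_symmetrizer \<mu> (cscale c f) = cscale c (young_symmetrizer \<mu> f)" for c and f :: "'a list \<Rightarrow> complex"
    by (simp add: young_symmetrizer_def fun_eq_iff sum_fun_apply cscale_def permute_tensor_def
        sum_distrib_left mult_ac)
qed

lemma tensor_power_span:
  "tensor_power m (cfun.span (v ` I)) = cfun.span {pure_tensor (map v T) | T. length T = m \<and> set T \<subseteq> I}"
    (is "_ = cfun.span ?B")
proof
  show "cfun.span ?B \<subseteq> tensor_power m (cfun.span (v ` I))"
    unfolding tensor_power_def
  proof (rule cfun.span_mono)
    show "?B \<subseteq> {pure_tensor vs | vs. length vs = m \<and> set vs \<subseteq> cfun.span (v ` I)}"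
      by (force intro: cfun.span_base)
  qed
  \<comment> \<open>Tensoring with one factor on the left, linear in each argument, so that a pure
    tensor can be expanded one factor at a time.\<close>
  define cons :: "('a \<Rightarrow> complex) \<Rightarrow> ('a list \<Rightarrow> complex) \<Rightarrow> 'a list \<Rightarrow> complex" where
    "cons a t xs = (case xs of [] \<Rightarrow> 0 | x # xs \<Rightarrow> a x * t xs)" for a t xs
  have cons_left: "module_hom cscale cscale (\<lambda>a. cons a t)" for t
    by unfold_locales (auto simp: cons_def fun_eq_iff cscale_def algebra_simps split: list.split)
  have cons_right: "module_hom cscale cscale (cons a)" for a
    by unfold_locales (auto simp: cons_def fun_eq_iff cscale_def algebra_simps split: list.split)
  have cons: "pure_tensor (a # vs) = cons a (pure_tensor vs)" for a vs
    by (auto simp: cons_def fun_eq_iff pure_tensor_Cons_Nil pure_tensor_Cons_Cons split: list.split)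
  have "pure_tensor vs \<in> cfun.span {pure_tensor (map v T) | T. length T = length vs \<and> set T \<subseteq> I}"
    if "set vs \<subseteq> cfun.span (v ` I)" for vs
    using that
  proof (induction vs)
    case Nil
    show ?case
      by (intro cfun.span_base) auto
  next
    case (Cons a vs)
    let ?S = "{pure_tensor (map v T) | T. length T = length vs \<and> set T \<subseteq> I}"
    let ?S' = "{pure_tensor (map v T) | T. length T = length (a # vs) \<and> set T \<subseteq> I}"
    have "cons (v i) t \<in> cfun.span ?S'" if "i \<in> I" "t \<in> cfun.span ?S" for i t
    proof -
      have "cons (v i) t \<in> cfun.span (cons (v i) ` ?S)"
        using module_hom.span_image[OF cons_right] that(2) by blast
      moreover have "cons (v i) ` ?S \<subseteq> ?S'"
      proof safe
        fix T assume "length T = length vs" "set T \<subseteq> I"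
        then show "\<exists>T'. cons (v i) (pure_tensor (map v T)) = pure_tensor (map v T') \<and>
            length T' = length (a # vs) \<and> set T' \<subseteq> I"
          using that(1) by (intro exI[of _ "i # T"]) (simp add: cons)
      qed
      ultimately show ?thesis
        using cfun.span_mono by blast
    qed
    moreover have "pure_tensor vs \<in> cfun.span ?S"
      using Cons by simp
    ultimately have sub: "(\<lambda>a. cons a (pure_tensor vs)) ` (v ` I) \<subseteq> cfun.span ?S'"
      by auto
    have "cons a (pure_tensor vs) \<in> cfun.span ((\<lambda>a. cons a (pure_tensor vs)) ` (v ` I))"
      using module_hom.span_image[OF cons_left] Cons.prems by auto
    also have "\<dots> \<subseteq> cfun.span ?S'"
      using sub by (simp add: cfun.span_minimal)
    finally show ?case
      by (simp add: cons)
  qed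
  then show "tensor_power m (cfun.span (v ` I)) \<subseteq> cfun.span ?B"
    unfolding tensor_power_def by (intro cfun.span_minimal) auto
qed

lemma tensor_power_support:
  assumes "f \<in> tensor_power m V" "f xs \<noteq> 0" and V: "\<And>g x. g \<in> V \<Longrightarrow> g x \<noteq> 0 \<Longrightarrow> x \<in> X"
  shows "length xs = m \<and> set xs \<subseteq> X"
proof -
  let ?P = "{f :: 'a list \<Rightarrow> complex. \<forall>xs. f xs \<noteq> 0 \<longrightarrow> length xs = m \<and> set xs \<subseteq> X}"
  have "cfun.subspace ?P"
    unfolding cfun.subspace_def
  proof (intro conjI ballI allI)
    fix f g assume fg: "f \<in> ?P" "g \<in> ?P"
    have "f xs \<noteq> 0 \<or> g xs \<noteq> 0" if "(f + g) xs \<noteq> 0" for xs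
      using that by auto
    then show "f + g \<in> ?P"
      using fg by blast
  qed (auto simp: cscale_def)
  moreover have "{pure_tensor vs | vs. length vs = m \<and> set vs \<subseteq> V} \<subseteq> ?P"
  proof safe
    fix vs :: "('a \<Rightarrow> complex) list" and xs
    assume vs: "set vs \<subseteq> V" "pure_tensor vs xs \<noteq> 0" "m = length vs"
    then show len: "length xs = length vs"
      by (auto simp: pure_tensor_def split: if_splits)
    fix x assume "x \<in> set xs"
    then obtain i where "i < length vs" "x = xs ! i"
      using len by (metis in_set_conv_nth)
    moreover have "(vs ! i) (xs ! i) \<noteq> 0"
      using vs(2) len \<open>i < length vs\<close> by (auto simp: pure_tensor_def split: if_splits)
    moreover have "vs ! i \<in> V"
      using vs(1) nth_mem[OF \<open>i < length vs\<close>] by blast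
    ultimately show "x \<in> X"
      using V[of "vs ! i"] by simp
  qed
  ultimately have "tensor_power m V \<subseteq> ?P"
    unfolding tensor_power_def by (intro cfun.span_minimal)
  then show ?thesis
    using assms by blast
qed

lemma schur_space_support:
  assumes "f \<in> schur_space \<mu> V" "f xs \<noteq> 0" and V: "\<And>g x. g \<in> V \<Longrightarrow> g x \<noteq> 0 \<Longrightarrow> x \<in> X"
  shows "length xs = sum_list \<mu> \<and> set xs \<subseteq> X"
proof -
  obtain T where T: "T \<in> tensor_power (sum_list \<mu>) V" "f = young_symmetrizer \<mu> T"
    using assms(1) by (auto simp: schur_space_def)
  have "(\<Sum>p\<in>row_group \<mu>. \<Sum>q\<in>column_group \<mu>. of_int (sign q) * permute_tensor (p \<circ> q) T xs) \<noteq> 0"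
    using assms(2) T(2) by (simp add: young_symmetrizer_def sum_fun_apply cscale_def)
  then obtain p q where pq: "p \<in> row_group \<mu>" "q \<in> column_group \<mu>" "permute_tensor (p \<circ> q) T xs \<noteq> 0"
    by (metis (no_types, lifting) mult_zero_right sum.neutral)
  then have "T (permute_list (inv (p \<circ> q)) xs) \<noteq> 0"
    by (simp add: permute_tensor_def)
  then have *: "length (permute_list (inv (p \<circ> q)) xs) = sum_list \<mu> \<and> set (permute_list (inv (p \<circ> q)) xs) \<subseteq> X"
    using T(1) V tensor_power_support by blast
  moreover have "inv (p \<circ> q) permutes {..<sum_list \<mu>}"
    using pq by (intro permutes_inv permutes_compose) (auto simp: row_group_def column_group_def)
  ultimately have "length xs = sum_list \<mu>" "inv (p \<circ> q) permutes {..<length xs}"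
    by simp_all
  then show ?thesis
    using * by (metis set_permute_list)
qed

lemma subspace_schur_space: "cfun.subspace (schur_space \<mu> V)"
  unfolding schur_space_def tensor_power_def
  by (subst module_hom.span_image[OF module_hom_young_symmetrizer, symmetric]) (rule cfun.subspace_span)

lemma schur_space_invariant:
  assumes K: "sl2_kernel K cls wt" and V: "\<And>g. g \<in> V \<Longrightarrow> sl2_kernel.rho K cls A g \<in> V"
    and f: "f \<in> schur_space \<mu> V"
  shows "sl2_kernel.rho (list_kernel K) (list_class cls) A f \<in> schur_space \<mu> V"
proof -
  interpret sl2_kernel K cls wt
    by fact
  interpret L: sl2_kernel "list_kernel K" "list_class cls" "list_weight wt"
    by (rule list_sl2_kernel) fact
  have hom: "module_hom cscale cscale (L.rho A)"
    by unfold_locales (simp_all add: L.rho_add L.rho_scale)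
  obtain T where T: "T \<in> tensor_power (sum_list \<mu>) V" "f = young_symmetrizer \<mu> T"
    using f by (auto simp: schur_space_def)
  have "L.rho A ` tensor_power (sum_list \<mu>) V \<subseteq> tensor_power (sum_list \<mu>) V"
    unfolding tensor_power_def module_hom.span_image[OF hom, symmetric]
  proof (rule cfun.span_mono, rule subsetI)
    fix g assume "g \<in> L.rho A ` {pure_tensor vs | vs. length vs = sum_list \<mu> \<and> set vs \<subseteq> V}"
    then obtain vs where vs: "g = L.rho A (pure_tensor vs)" "length vs = sum_list \<mu>" "set vs \<subseteq> V"
      by blast
    have "g = pure_tensor (map (rho A) vs)" "set (map (rho A) vs) \<subseteq> V"
      using vs V by (auto simp: rho_pure_tensor[OF K])
    then show "g \<in> {pure_tensor vs | vs. length vs = sum_list \<mu> \<and> set vs \<subseteq> V}"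
      using vs(2) by (metis (mono_tags, lifting) length_map mem_Collect_eq)
  qed
  then have "L.rho A T \<in> tensor_power (sum_list \<mu>) V"
    using T by blast
  moreover have "L.rho A f = young_symmetrizer \<mu> (L.rho A T)"
  proof -
    have comm: "L.rho A (permute_tensor (p \<circ> q) T) = permute_tensor (p \<circ> q) (L.rho A T)"
      if "p \<in> row_group \<mu>" "q \<in> column_group \<mu>" for p q
    proof (rule rho_permute_tensor[OF K])
      show "p \<circ> q permutes {..<sum_list \<mu>}"
        using that by (intro permutes_compose) (auto simp: row_group_def column_group_def)
      show "T xs = 0" if "length xs \<noteq> sum_list \<mu>" for xs
        using tensor_power_support[OF T(1), of xs UNIV] that by auto
    qed
    show ?thesis
      unfolding T(2) young_symmetrizer_def
      by (simp add: module_hom.sum[OF hom] L.rho_scale comm)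
  qed
  ultimately show ?thesis
    by (simp add: schur_space_def)
qed

context young_diagram
begin

section \<open>Independence and weights of the semistandard vectors\<close>

lemma column_group_inv: "q \<in> column_group \<mu> \<Longrightarrow> inv q \<in> column_group \<mu>"
proof -
  assume q: "q \<in> column_group \<mu>"
  then have inv: "inv q permutes {..<N}"
    using column_groupD(1) permutes_inv by blast
  have "box_col (inv q k) = box_col k" if "k < N" for k
    using column_groupD(2)[OF q permutes_less[OF inv that]] permutes_inverses(1)[OF column_groupD(1)[OF q]]
    by simp
  with inv show "inv q \<in> column_group \<mu>"
    by (simp add: column_group_def)
qed

text \<open>Moving \<open>q\<close> to the other side gives
  \<open>permute_list (inv q) S = permute_list p T\<close>. The row permutation keeps the weight of
  \<open>T\<close>, and the column permutation can only lower that of the semistandard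
  \<open>S\<close>.\<close>

lemma filling_permute_triangular:
  assumes T: "T \<in> semistandard_fillings n" and S: "S \<in> semistandard_fillings n"
    and p: "p \<in> row_group \<mu>" and q: "q \<in> column_group \<mu>" and eq: "permute_list (p \<circ> q) T = S"
  shows "row_weight T \<le> row_weight S" "row_weight T = row_weight S \<Longrightarrow> q = id \<and> S = T"
proof -
  have len: "length T = N" "length S = N"
    using T S by (auto simp: semistandard_fillings_def)
  have perm: "p permutes {..<N}" "q permutes {..<N}" "inv q permutes {..<N}"
    using p q row_groupD column_groupD permutes_inv by blast+
  have "permute_list (inv q) S = permute_list (inv q) (permute_list q (permute_list p T))"
    using eq perm len by (simp add: permute_list_compose)
  also have "\<dots> = permute_list p T"
    using perm len by (subst permute_list_compose[symmetric]) (simp_all add: permutes_inv_o)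
  finally have eq': "permute_list (inv q) S = permute_list p T" .
  have "row_weight T = row_weight (permute_list (inv q) S)"
    unfolding eq' by (rule row_weight_permute[OF p len(1), symmetric])
  also have "\<dots> = (\<Sum>k<N. box_row k * S ! inv q k)"
    unfolding row_weight_def using perm len by (intro sum.cong refl) (simp add: permute_list_nth)
  finally have weight: "row_weight T = (\<Sum>k<N. box_row k * S ! inv q k)" .
  show "row_weight T \<le> row_weight S"
    unfolding weight by (rule row_weight_column_permutation(1)[OF S column_group_inv[OF q]])
  assume "row_weight T = row_weight S"
  then have "inv q = id"
    using row_weight_column_permutation(2)[OF S column_group_inv[OF q]] weight by simp
  then have "q = id"
    using perm(2) by (metis inv_id inv_inv_eq permutes_bij)
  moreover have "permute_list p T = S"
    using eq' \<open>inv q = id\<close> by simp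
  ultimately show "q = id \<and> S = T"
    using semistandard_row_equivalent_eq[OF T S p] by blast
qed

lemma finite_semistandard_fillings: "finite (semistandard_fillings n)"
proof (rule finite_subset)
  show "semistandard_fillings n \<subseteq> {T. set T \<subseteq> {..<n} \<and> length T = N}"
    by (auto simp: semistandard_fillings_def)
  show "finite {T. set T \<subseteq> {..<n} \<and> length T = N}"
    by (rule finite_lists_length_eq) simp
qed

text \<open>The relation is evaluated at \<open>map x S\<close>, where \<open>S\<close> has the
  least row weight among the fillings with nonzero coefficient. By triangularity the other terms
  vanish. In the term of \<open>S\<close> only \<open>q = id\<close> contributes, so its value is
  the number of row permutations fixing \<open>S\<close>, without cancellation.\<close>

lemma filling_vectors_independent:
  assumes dual: "\<And>i j. i < n \<Longrightarrow> j < n \<Longrightarrow> v i (x j) = (if i = j then 1 else 0)"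
    and sum: "(\<Sum>T\<in>semistandard_fillings n. cscale (a T) (filling_vector v T)) = 0"
    and T: "T \<in> semistandard_fillings n"
  shows "a T = 0"
proof (rule ccontr)
  let ?F = "semistandard_fillings n"
  assume "a T \<noteq> 0"
  define B where "B = {T \<in> ?F. a T \<noteq> 0}"
  have "finite B" "B \<noteq> {}"
    using finite_semistandard_fillings T \<open>a T \<noteq> 0\<close> by (auto simp: B_def)
  then obtain S where S: "S \<in> B" "\<And>T. T \<in> B \<Longrightarrow> row_weight S \<le> row_weight T"
    using ex_min_if_finite[of "row_weight ` B"] by (metis (no_types, opaque_lifting) arg_min_if_finite(1,2) not_less)
  have SF: "S \<in> ?F" "length S = N" "set S \<subseteq> {..<n}"
    using S by (auto simp: B_def semistandard_fillings_def)
  have eval: "basis_tensor v U (map x S) = (if U = S then 1 else 0)" if U: "length U = N" "set U \<subseteq> {..<n}" for U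
  proof -
    have "v (U ! i) (x (S ! i)) = (if U ! i = S ! i then 1 else 0)" if "i < N" for i
    proof (rule dual)
      show "U ! i < n" "S ! i < n"
        using that U SF by (metis lessThan_iff nth_mem subsetD)+
    qed
    then have "basis_tensor v U (map x S) = (\<Prod>i<N. if U ! i = S ! i then 1 else 0)"
      using U SF by (simp add: basis_tensor_def pure_tensor_def)
    also have "\<dots> = (if U = S then 1 else 0)"
    proof (cases "U = S")
      case False
      then obtain i where "i < N" "U ! i \<noteq> S ! i"
        using U SF by (metis nth_equalityI)
      then show ?thesis
        using False by (subst prod_zero) auto
    qed simp
    finally show ?thesis .
  qed
  have coeff: "filling_vector v U (map x S) = (\<Sum>p\<in>row_group \<mu>. \<Sum>q\<in>column_group \<mu>.
      of_int (sign q) * (if permute_list (p \<circ> q) U = S then 1 else 0))" if U: "U \<in> ?F" for U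
  proof -
    have len: "length U = N" "set U \<subseteq> {..<n}"
      using U by (auto simp: semistandard_fillings_def)
    show ?thesis
      unfolding filling_vector_eq[OF len(1)] sum_fun_apply cscale_def
    proof (intro sum.cong refl arg_cong[of _ _ "(*) _"] eval)
      fix p q assume "p \<in> row_group \<mu>" "q \<in> column_group \<mu>"
      then have "p \<circ> q permutes {..<length U}"
        using row_groupD(1) column_groupD(1) permutes_compose len(1) by metis
      then show "length (permute_list (p \<circ> q) U) = N" "set (permute_list (p \<circ> q) U) \<subseteq> {..<n}"
        using len by simp_all
    qed
  qed
  have other: "a U * filling_vector v U (map x S) = 0" if U: "U \<in> ?F" "U \<noteq> S" for U
  proof (cases "U \<in> B")
    case True
    have "permute_list (p \<circ> q) U \<noteq> S" if "p \<in> row_group \<mu>" "q \<in> column_group \<mu>" for p q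
      using filling_permute_triangular[OF U(1) SF(1) that] S(2)[OF True] U(2) by fastforce
    then show ?thesis
      by (simp add: coeff[OF U(1)])
  qed (use U in \<open>simp add: B_def\<close>)
  have diag: "filling_vector v S (map x S) \<noteq> 0"
  proof -
    have "filling_vector v S (map x S) = (\<Sum>p\<in>row_group \<mu>. if permute_list p S = S then 1 else 0)"
      unfolding coeff[OF SF(1)]
    proof (rule sum.cong[OF refl])
      fix p assume p: "p \<in> row_group \<mu>"
      have "(\<Sum>q\<in>column_group \<mu>. of_int (sign q) * (if permute_list (p \<circ> q) S = S then 1 else 0)) =
          (\<Sum>q\<in>{id}. of_int (sign q) * (if permute_list (p \<circ> q) S = S then 1 else (0 :: complex)))"
        using id_in_groups finite_groups filling_permute_triangular(2)[OF SF(1) SF(1) p]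
        by (intro sum.mono_neutral_right) auto
      then show "(\<Sum>q\<in>column_group \<mu>. of_int (sign q) * (if permute_list (p \<circ> q) S = S then 1 else 0)) =
          (if permute_list p S = S then 1 else (0 :: complex))"
        by (simp add: sign_id)
    qed
    also have "\<dots> = of_nat (card {p \<in> row_group \<mu>. permute_list p S = S})"
      using finite_groups by (simp add: sum.If_cases Int_def)
    also have "\<dots> \<noteq> 0"
    proof -
      have "id \<in> {p \<in> row_group \<mu>. permute_list p S = S}"
        using id_in_groups by simp
      then show ?thesis
        using finite_groups by (auto simp: card_eq_0_iff)
    qed
    finally show ?thesis .
  qed
  have "0 = (\<Sum>T\<in>?F. a T * filling_vector v T (map x S))"
    using fun_cong[OF sum, of "map x S"] by (simp add: sum_fun_apply cscale_def)
  also have "\<dots> = (\<Sum>T\<in>{S}. a T * filling_vector v T (map x S))"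
    using finite_semistandard_fillings SF other by (intro sum.mono_neutral_right) auto
  finally show False
    using diag S by (simp add: B_def)
qed

lemma schur_space_eq_span:
  "schur_space \<mu> (cfun.span (v ` {..<n})) = cfun.span (filling_vector v ` semistandard_fillings n)"
proof -
  have "schur_space \<mu> (cfun.span (v ` {..<n})) =
      cfun.span (filling_vector v ` {T. length T = N \<and> set T \<subseteq> {..<n}})"
    unfolding schur_space_def tensor_power_span module_hom.span_image[OF module_hom_young_symmetrizer, symmetric]
    by (rule arg_cong[of _ _ cfun.span]) (auto simp: filling_vector_def basis_tensor_def)
  also have "\<dots> = cfun.span (filling_vector v ` semistandard_fillings n)"
    unfolding cfun.span_eq
  proof
    show "filling_vector v ` {T. length T = N \<and> set T \<subseteq> {..<n}} \<subseteq>
        cfun.span (filling_vector v ` semistandard_fillings n)"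
      using straightening by blast
    have "semistandard_fillings n \<subseteq> {T. length T = N \<and> set T \<subseteq> {..<n}}"
      by (auto simp: semistandard_fillings_def)
    then show "filling_vector v ` semistandard_fillings n \<subseteq>
        cfun.span (filling_vector v ` {T. length T = N \<and> set T \<subseteq> {..<n}})"
      using cfun.span_superset by fast
  qed
  finally show ?thesis .
qed

text \<open>Permuting a filling keeps the sum of the weights of its entries, so every semistandard
  basis vector is a weight vector and the basis restricts to each weight space.\<close>

theorem dim_weight_schur_space:
  fixes v :: "nat \<Rightarrow> 'a \<Rightarrow> complex" and wt :: "'a \<Rightarrow> int"
  assumes dual: "\<And>i j. i < n \<Longrightarrow> j < n \<Longrightarrow> v i (x j) = (if i = j then 1 else 0)"
    and weight: "\<And>j y. j < n \<Longrightarrow> v j y \<noteq> 0 \<Longrightarrow> wt y = \<kappa> j"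
  shows "cfun.dim (schur_space \<mu> (cfun.span (v ` {..<n})) \<inter> {f. \<forall>ys. f ys \<noteq> 0 \<longrightarrow> list_weight wt ys = k}) =
    card {T \<in> semistandard_fillings n. (\<Sum>j\<leftarrow>T. \<kappa> j) = k}"
proof -
  let ?F = "semistandard_fillings n"
  let ?W = "{f. \<forall>ys. f ys \<noteq> 0 \<longrightarrow> list_weight wt ys = k}"
  define B where "B = {T \<in> ?F. (\<Sum>j\<leftarrow>T. \<kappa> j) = k}"
  have "finite B"
    using finite_semistandard_fillings by (simp add: B_def)
  have support: "list_weight wt ys = (\<Sum>j\<leftarrow>T. \<kappa> j)" if T: "T \<in> ?F" and nz: "filling_vector v T ys \<noteq> 0" for T ys
  proof -
    have len: "length T = N" "set T \<subseteq> {..<n}"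
      using T by (auto simp: semistandard_fillings_def)
    obtain p q where pq: "p \<in> row_group \<mu>" "q \<in> column_group \<mu>"
      "basis_tensor v (permute_list (p \<circ> q) T) ys \<noteq> 0"
      using nz unfolding filling_vector_eq[OF len(1)] sum_fun_apply cscale_def
      by (metis (no_types, lifting) mult_zero_right sum.neutral)
    define U where "U = permute_list (p \<circ> q) T"
    have "p \<circ> q permutes {..<length T}"
      using pq row_groupD(1) column_groupD(1) permutes_compose len(1) by metis
    then have U: "mset U = mset T" "length U = N" "set U \<subseteq> {..<n}"
      using len by (simp_all add: U_def)
    have "length ys = N" "\<And>i. i < N \<Longrightarrow> v (U ! i) (ys ! i) \<noteq> 0"
      using pq(3) U by (auto simp: basis_tensor_def pure_tensor_def U_def[symmetric] split: if_splits)
    then have "map wt ys = map \<kappa> U"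
      using weight U by (intro nth_equalityI) (auto simp: subset_eq)
    then have "list_weight wt ys = sum_mset (image_mset \<kappa> (mset U))"
      by (simp add: list_weight_def sum_mset_sum_list[symmetric])
    then show ?thesis
      unfolding U(1) by (simp add: sum_mset_sum_list[symmetric])
  qed
  have inj: "inj_on (filling_vector v) ?F"
  proof (rule inj_onI, rule ccontr)
    fix S T assume ST: "S \<in> ?F" "T \<in> ?F" "filling_vector v S = filling_vector v T" "S \<noteq> T"
    define a :: "nat list \<Rightarrow> complex" where "a = (\<lambda>U. if U = S then 1 else if U = T then - 1 else 0)"
    have "(\<Sum>U\<in>?F. cscale (a U) (filling_vector v U)) = (\<Sum>U\<in>{S, T}. cscale (a U) (filling_vector v U))"
      using ST finite_semistandard_fillings by (intro sum.mono_neutral_right) (auto simp: a_def cscale_def fun_eq_iff)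
    also have "\<dots> = 0"
      using ST by (simp add: a_def cscale_def fun_eq_iff)
    finally have "a S = 0"
      using filling_vectors_independent[where n = n and v = v and x = x, OF dual] ST by blast
    then show False
      by (simp add: a_def)
  qed
  have "cfun.independent (filling_vector v ` ?F)"
  proof (rule cfun.independent_if_scalars_zero)
    fix g y assume "(\<Sum>y\<in>filling_vector v ` ?F. cscale (g y) y) = 0" "y \<in> filling_vector v ` ?F"
    then show "g y = 0"
      using filling_vectors_independent[where n = n and v = v and x = x and
          a = "\<lambda>T. g (filling_vector v T)", OF dual]
      by (auto simp: sum.reindex[OF inj])
  qed (simp add: finite_semistandard_fillings)
  then have indep: "cfun.independent (filling_vector v ` B)"
    by (rule cfun.independent_mono) (auto simp: B_def)
  have "schur_space \<mu> (cfun.span (v ` {..<n})) \<inter> ?W = cfun.span (filling_vector v ` B)"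
    unfolding schur_space_eq_span
  proof safe
    fix f assume f: "f \<in> cfun.span (filling_vector v ` ?F)" and W: "\<forall>ys. f ys \<noteq> 0 \<longrightarrow> list_weight wt ys = k"
    obtain u where "f = (\<Sum>y\<in>filling_vector v ` ?F. cscale (u y) y)"
      using f cfun.span_finite[of "filling_vector v ` ?F"] finite_semistandard_fillings by auto
    then have f_eq: "f = (\<Sum>T\<in>?F. cscale (u (filling_vector v T)) (filling_vector v T))"
      by (simp add: sum.reindex[OF inj])
    have "f = (\<Sum>T\<in>B. cscale (u (filling_vector v T)) (filling_vector v T))"
    proof
      fix ys
      show "f ys = (\<Sum>T\<in>B. cscale (u (filling_vector v T)) (filling_vector v T)) ys"
      proof (cases "list_weight wt ys = k")
        case True
        have "f ys = (\<Sum>T\<in>?F. u (filling_vector v T) * filling_vector v T ys)"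
          by (subst f_eq) (simp add: sum_fun_apply cscale_def)
        also have "\<dots> = (\<Sum>T\<in>B. u (filling_vector v T) * filling_vector v T ys)"
          using finite_semistandard_fillings support True
          by (intro sum.mono_neutral_right) (auto simp: B_def)
        finally show ?thesis
          by (simp add: sum_fun_apply cscale_def)
      next
        case False
        then have "filling_vector v T ys = 0" if "T \<in> B" for T
          using support[of T ys] that by (auto simp: B_def)
        then show ?thesis
          using W False by (auto simp: sum_fun_apply cscale_def)
      qed
    qed
    also have "\<dots> \<in> cfun.span (filling_vector v ` B)"
      by (intro cfun.span_sum cfun.span_scale cfun.span_base) auto
    finally show "f \<in> cfun.span (filling_vector v ` B)" .
  next
    fix f assume f: "f \<in> cfun.span (filling_vector v ` B)"
    show "f \<in> cfun.span (filling_vector v ` ?F)"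
      using cfun.span_mono[of "filling_vector v ` B" "filling_vector v ` ?F"] f by (auto simp: B_def)
    have "cfun.subspace ?W"
      by (auto simp: cfun.subspace_def cscale_def) (metis add_0)
    moreover have "filling_vector v ` B \<subseteq> ?W"
      using support by (auto simp: B_def)
    ultimately have "f \<in> ?W"
      using f cfun.span_minimal by blast
    then show "list_weight wt ys = k" if "f ys \<noteq> 0" for ys
      using that by blast
  qed
  then have "cfun.dim (schur_space \<mu> (cfun.span (v ` {..<n})) \<inter> ?W) = card (filling_vector v ` B)"
    using cfun.dim_span_eq_card_independent[OF indep] by simp
  also have "\<dots> = card B"
    using inj by (intro card_image) (auto simp: B_def inj_on_def)
  finally show ?thesis
    by (simp add: B_def)
qed

end

section \<open>Brackets\<close>

definition twos :: "2 list \<Rightarrow> nat" where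
  "twos xs = length (filter (\<lambda>y. y \<noteq> 1) xs)"

text \<open>The sum of all arrangements of \<open>w - j\<close> factors \<open>unit_fun 1\<close>
  and \<open>j\<close> factors \<open>unit_fun 2\<close>, for \<open>j \<le> w\<close>: a monomial
  in the symmetric power. The points \<open>monomial_list w j\<close> are dual to these
  tensors.\<close>

definition monomial_tensor :: "nat \<Rightarrow> nat \<Rightarrow> 2 list \<Rightarrow> complex" where
  "monomial_tensor w j xs = (if length xs = w \<and> twos xs = j then 1 else 0)"

definition monomial_list :: "nat \<Rightarrow> nat \<Rightarrow> 2 list" where
  "monomial_list w j = replicate j 2 @ replicate (w - j) 1"

lemma twos_le: "twos xs \<le> length xs"
  by (simp add: twos_def)

lemma mset_eq_twos: "mset xs = replicate_mset (twos xs) 2 + replicate_mset (length xs - twos xs) (1 :: 2)"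
proof (induction xs)
  case (Cons x xs)
  then show ?case
    using exhaust_2[of x] twos_le[of xs] by (auto simp: twos_def Suc_diff_le)
qed (simp add: twos_def)

lemma monomial_list_shape: "j \<le> w \<Longrightarrow> length (monomial_list w j) = w" "j \<le> w \<Longrightarrow> twos (monomial_list w j) = j"
  by (auto simp: monomial_list_def twos_def)

lemma list_weight_standard: "list_weight standard_weight xs = int (length xs) - 2 * int (twos xs)"
  by (induction xs) (auto simp: list_weight_def standard_weight_def twos_def)

lemma young_symmetrizer_one_row:
  "young_symmetrizer [w] f = (\<Sum>p | p permutes {..<w}. permute_tensor p f)"
proof -
  have boxes: "boxes [w] = map (Pair 0) [0..<w]"
    by (simp add: boxes_def)
  have less: "p k < w" if "p permutes {..<w}" "k < w" for p k
    using that by (metis lessThan_iff permutes_in_image)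
  have "row_group [w] = {p. p permutes {..<w}}"
    using less by (auto simp: row_group_def boxes)
  moreover have "column_group [w] = {id}"
  proof -
    have "q = id" if "q permutes {..<w}" "\<forall>k<w. q k = k" for q
    proof
      fix k
      show "q k = id k"
        using that permutes_not_in[OF that(1), of k] by (cases "k < w") auto
    qed
    then show ?thesis
      using less by (auto simp: column_group_def boxes permutes_id)
  qed
  ultimately show ?thesis
    by (simp add: young_symmetrizer_def sign_id)
qed

text \<open>A symmetrised tensor depends only on how often 2 occurs in its argument, hence it is a
  combination of monomials. Conversely the symmetrizer multiplies a monomial by
  \<open>fact w\<close>, which \<open>c\<close> compensates.\<close>

lemma symmetric_power_span: "schur_space [w] UNIV = cfun.span (monomial_tensor w ` {..<Suc w})"
proof
  show "schur_space [w] UNIV \<subseteq> cfun.span (monomial_tensor w ` {..<Suc w})"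
  proof
    fix f :: "2 list \<Rightarrow> complex" assume f: "f \<in> schur_space [w] UNIV"
    then obtain T where T: "f = young_symmetrizer [w] T"
      by (auto simp: schur_space_def)
    have support: "length xs = w" if "f xs \<noteq> 0" for xs
      using schur_space_support[OF f that, of UNIV] by simp
    have sym: "f xs = f ys" if eq: "mset xs = mset ys" "length ys = w" for xs ys
    proof -
      obtain \<pi> where \<pi>: "\<pi> permutes {..<length ys}" "permute_list \<pi> ys = xs"
        using mset_eq_permutation[OF eq(1)] by blast
      have perm: "\<pi> permutes {..<w}"
        using \<pi>(1) eq by simp
      have "f xs = (\<Sum>p | p permutes {..<w}. T (permute_list (inv p) (permute_list \<pi> ys)))"
        by (simp add: T young_symmetrizer_one_row sum_fun_apply permute_tensor_def \<pi>(2))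
      also have "\<dots> = (\<Sum>p | p permutes {..<w}. T (permute_list (inv p) ys))"
      proof (rule sum.reindex_bij_witness[of _ "\<lambda>p. p \<circ> \<pi>" "\<lambda>p. p \<circ> inv \<pi>"])
        fix p assume "p \<in> {p. p permutes {..<w}}"
        then have p: "p permutes {..<w}"
          by simp
        show "p \<circ> inv \<pi> \<circ> \<pi> = p" "p \<circ> \<pi> \<circ> inv \<pi> = p"
          by (simp_all add: comp_assoc permutes_inv_o[OF perm])
        show "p \<circ> inv \<pi> \<in> {p. p permutes {..<w}}" "p \<circ> \<pi> \<in> {p. p permutes {..<w}}"
          using p perm by (auto intro: permutes_compose permutes_inv)
        have "inv (p \<circ> inv \<pi>) = \<pi> \<circ> inv p"
          by (rule inv_unique_comp)
            (simp_all add: fun_eq_iff permutes_inverses[OF p] permutes_inverses[OF perm])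
        then show "T (permute_list (inv (p \<circ> inv \<pi>)) ys) = T (permute_list (inv p) (permute_list \<pi> ys))"
          using permutes_inv[OF p] eq by (simp add: permute_list_compose)
      qed
      also have "\<dots> = f ys"
        by (simp add: T young_symmetrizer_one_row sum_fun_apply permute_tensor_def)
      finally show ?thesis .
    qed
    have "f = (\<Sum>j<Suc w. cscale (f (monomial_list w j)) (monomial_tensor w j))"
    proof
      fix xs
      show "f xs = (\<Sum>j<Suc w. cscale (f (monomial_list w j)) (monomial_tensor w j)) xs"
      proof (cases "length xs = w")
        case True
        have "(\<Sum>j<Suc w. cscale (f (monomial_list w j)) (monomial_tensor w j)) xs =
            (\<Sum>j\<in>{twos xs}. f (monomial_list w j) * monomial_tensor w j xs)"
          unfolding sum_fun_apply cscale_def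
          using True twos_le[of xs] by (intro sum.mono_neutral_right) (auto simp: monomial_tensor_def)
        also have "\<dots> = f (monomial_list w (twos xs))"
          using True by (simp add: monomial_tensor_def)
        also have "\<dots> = f xs"
          using True twos_le[of xs] mset_eq_twos[of xs]
          by (intro sym) (simp_all add: monomial_list_def)
        finally show ?thesis
          by simp
      next
        case False
        then show ?thesis
          using support[of xs] by (auto simp: sum_fun_apply cscale_def monomial_tensor_def)
      qed
    qed
    also have "\<dots> \<in> cfun.span (monomial_tensor w ` {..<Suc w})"
      by (intro cfun.span_sum cfun.span_scale cfun.span_base) auto
    finally show "f \<in> cfun.span (monomial_tensor w ` {..<Suc w})" .
  qed
next
  have "monomial_tensor w j \<in> schur_space [w] UNIV" for j
  proof -
    define c where "c = inverse (of_nat (fact w) :: complex)"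
    have fin: "finite {xs :: 2 list. length xs = w}"
      using finite_lists_length_eq[of "UNIV :: 2 set" w] by simp
    have "monomial_tensor w j = (\<Sum>xs | length xs = w. cscale (monomial_tensor w j xs) (unit_fun xs))"
      using fin by (auto simp: fun_eq_iff sum_fun_apply cscale_def unit_fun_def monomial_tensor_def
          if_distrib[of "(*) _"] cong: if_cong)
    also have "\<dots> \<in> tensor_power w UNIV"
      unfolding tensor_power_def
    proof (intro cfun.span_sum cfun.span_scale cfun.span_base)
      fix xs :: "2 list" assume "xs \<in> {xs. length xs = w}"
      moreover have "unit_fun xs = pure_tensor (map unit_fun xs)" for xs :: "2 list"
      proof
        fix ys :: "2 list"
        show "unit_fun xs ys = pure_tensor (map unit_fun xs) ys"
          by (induction xs ys rule: list_induct2')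
            (auto simp: pure_tensor_Nil pure_tensor_Cons_Nil pure_tensor_Cons_Cons unit_fun_def)
      qed
      ultimately show "unit_fun xs \<in> {pure_tensor vs | vs. length vs = w \<and> set vs \<subseteq> UNIV}"
        by (metis (mono_tags, lifting) length_map mem_Collect_eq subset_UNIV)
    qed
    finally have "cscale c (monomial_tensor w j) \<in> tensor_power w UNIV"
      unfolding tensor_power_def by (rule cfun.span_scale)
    moreover have "young_symmetrizer [w] (cscale c (monomial_tensor w j)) = monomial_tensor w j"
    proof -
      have "permute_tensor p (cscale c (monomial_tensor w j)) = cscale c (monomial_tensor w j)"
        if p: "p permutes {..<w}" for p
      proof
        fix xs
        show "permute_tensor p (cscale c (monomial_tensor w j)) xs = cscale c (monomial_tensor w j) xs"
        proof (cases "length xs = w")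
          case True
          then have "mset (permute_list (inv p) xs) = mset xs"
            using permutes_inv[OF p] by simp
          then have "twos (permute_list (inv p) xs) = twos xs"
            unfolding twos_def by (metis mset_filter size_mset)
          then show ?thesis
            using True by (simp add: permute_tensor_def cscale_def monomial_tensor_def)
        qed (simp add: permute_tensor_def cscale_def monomial_tensor_def)
      qed
      then have "young_symmetrizer [w] (cscale c (monomial_tensor w j)) =
          (\<Sum>p | p permutes {..<w}. cscale c (monomial_tensor w j))"
        by (simp add: young_symmetrizer_one_row del: sum_constant)
      also have "\<dots> = monomial_tensor w j"
      proof
        fix xs
        have "(\<Sum>p | p permutes {..<w}. cscale c (monomial_tensor w j)) xs =
            (\<Sum>p | p permutes {..<w}. c * monomial_tensor w j xs)"
          by (simp only: sum_fun_apply cscale_def)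
        also have "\<dots> = monomial_tensor w j xs"
          by (simp add: card_permutations[of _ w] c_def)
        finally show "(\<Sum>p | p permutes {..<w}. cscale c (monomial_tensor w j)) xs = monomial_tensor w j xs" .
      qed
      finally show ?thesis .
    qed
    ultimately show ?thesis
      unfolding schur_space_def by (metis image_eqI sum_list.Cons sum_list.Nil add.right_neutral)
  qed
  then show "cfun.span (monomial_tensor w ` {..<Suc w}) \<subseteq> schur_space [w] UNIV"
    by (intro cfun.span_minimal subspace_schur_space) auto
qed

section \<open>Brackets as submodules of one representation\<close>

abbreviation symmetric_kernel :: "complex ^ 2 ^ 2 \<Rightarrow> 2 list \<Rightarrow> 2 list \<Rightarrow> complex" where
  "symmetric_kernel \<equiv> list_kernel standard_kernel"

abbreviation bracket_kernel :: "complex ^ 2 ^ 2 \<Rightarrow> 2 list list \<Rightarrow> 2 list list \<Rightarrow> complex" where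
  "bracket_kernel \<equiv> list_kernel symmetric_kernel"

interpretation symmetric: sl2_kernel symmetric_kernel "list_class (\<lambda>_. UNIV)" "list_weight standard_weight"
  by (rule list_sl2_kernel[OF standard_sl2_kernel])

interpretation bracket: sl2_kernel bracket_kernel "list_class (list_class (\<lambda>_. UNIV))"
  "list_weight (list_weight standard_weight)"
  by (rule list_sl2_kernel) unfold_locales

lemma act_bracket:
  assumes "finite {xs. f xs \<noteq> 0}"
  shows "act (\<langle>h \<parallel> v\<rangle>) A f = bracket.rho A f"
proof -
  have unit: "act standard_module A (unit_fun y) = (\<lambda>x. standard_kernel A x y)" for A y
    by (simp add: standard_module_def matrix_vector_mult_def unit_fun_def standard_kernel_def
        fun_eq_iff if_distrib[of "(*) _"] cong: if_cong)
  have unit': "tensor_map (act standard_module A) (unit_fun ys) = (\<lambda>xs. symmetric_kernel A xs ys)" for A ys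
    by (rule tensor_map_unit_fun[where F = "act standard_module"]) (rule unit)
  have "tensor_map (tensor_map (act standard_module A)) f = bracket.rho A f"
    by (rule tensor_map_eq_rho[where F = "\<lambda>A. tensor_map (act standard_module A)"])
      (use unit' assms symmetric.sl2_kernel_axioms in auto)
  then show ?thesis
    by (simp add: bracket_def schur_module_def)
qed

lemma vecs_bracket:
  assumes "sum_list v > 0"
  shows "vecs (\<langle>h \<parallel> v\<rangle>) =
    schur_space (bracket_partition h v) (cfun.span (monomial_tensor (sum_list v - 1) ` {..<sum_list v}))"
  using assms symmetric_power_span[of "sum_list v - 1"]
  by (simp add: bracket_def schur_module_def standard_module_def)

definition box_support :: "nat list \<Rightarrow> nat list \<Rightarrow> 2 list list set" where
  "box_support h v = {xss. length xss = sum_list (bracket_partition h v) \<and>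
     set xss \<subseteq> {xs. length xs = sum_list v - 1}}"

lemma finite_box_support: "finite (box_support h v)"
proof -
  have "finite {xs :: 2 list. length xs = sum_list v - 1}"
    using finite_lists_length_eq[of "UNIV :: 2 set"] by simp
  from finite_lists_length_eq[OF this, of "sum_list (bracket_partition h v)"] show ?thesis
    by (simp add: box_support_def conj_commute)
qed

lemma box_support_closed:
  assumes "xss \<in> box_support h v"
  shows "list_class (list_class (\<lambda>_. UNIV)) xss \<subseteq> box_support h v"
proof
  fix yss assume "yss \<in> list_class (list_class (\<lambda>_. UNIV)) xss"
  then have all: "list_all2 (\<lambda>xs ys. length xs = length ys) xss yss"
    by (simp add: list_class_iff list_all2_conv_all_nth)
  have "length ys = sum_list v - 1" if ys: "ys \<in> set yss" for ys
  proof -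
    obtain i where "i < length yss" "ys = yss ! i"
      using ys by (auto simp: in_set_conv_nth)
    moreover from this have "xss ! i \<in> set xss"
      using all by (simp add: list_all2_lengthD)
    then have "length (xss ! i) = sum_list v - 1"
      using assms by (auto simp only: box_support_def)
    ultimately show ?thesis
      using all by (simp add: list_all2_conv_all_nth)
  qed
  then show "yss \<in> box_support h v"
    using all assms by (auto simp: box_support_def list_all2_lengthD)
qed

lemma vecs_bracket_support: "f \<in> vecs (\<langle>h \<parallel> v\<rangle>) \<Longrightarrow> f xss \<noteq> 0 \<Longrightarrow> xss \<in> box_support h v"
proof -
  assume f: "f \<in> vecs (\<langle>h \<parallel> v\<rangle>)" "f xss \<noteq> 0"
  have "x \<in> {xs. length xs = sum_list v - 1}"
    if "g \<in> schur_space [sum_list v - 1] UNIV" "g x \<noteq> 0" for g :: "2 list \<Rightarrow> complex" and x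
    using schur_space_support[OF that, of UNIV] by simp
  then show "xss \<in> box_support h v"
    using schur_space_support[of f "bracket_partition h v" "schur_space [sum_list v - 1] UNIV" xss
        "{xs. length xs = sum_list v - 1}"] f
    by (simp add: bracket_def schur_module_def standard_module_def box_support_def)
qed

text \<open>The vectors of all brackets are functions on the same type. Two brackets are therefore
  submodules of the functions supported in the union \<open>X\<close> of their supports, where the
  isomorphism theorem applies.\<close>

lemma bracket_iso_if_same_weights:
  assumes dim: "\<And>k. cfun.dim (vecs (\<langle>h \<parallel> v\<rangle>) \<inter> bracket.weight_space k) =
    cfun.dim (vecs (\<langle>h' \<parallel> v'\<rangle>) \<inter> bracket.weight_space k)"
  shows "\<langle>h \<parallel> v\<rangle> \<simeq>\<^sub>S\<^sub>L \<langle>h' \<parallel> v'\<rangle>"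
proof -
  define X where "X = box_support h v \<union> box_support h' v'"
  interpret sl2_space bracket_kernel "list_class (list_class (\<lambda>_. UNIV))"
    "list_weight (list_weight standard_weight)" X
  proof
    show "finite X"
      by (simp add: X_def finite_box_support)
    show "list_class (list_class (\<lambda>_. UNIV)) x \<subseteq> X" if "x \<in> X" for x
      using that box_support_closed[of x h v] box_support_closed[of x h' v'] by (auto simp only: X_def)
  qed
  have sub: "submodule (vecs (\<langle>h \<parallel> v\<rangle>))" if X: "box_support h v \<subseteq> X" for h v
  proof -
    have invariant: "symmetric.rho A g \<in> schur_space [sum_list v - 1] UNIV"
      if "g \<in> schur_space [sum_list v - 1] UNIV" for A g
      using schur_space_invariant[OF standard_sl2_kernel _ that] by blast
    have "bracket.rho A f \<in> vecs (\<langle>h \<parallel> v\<rangle>)" if "f \<in> vecs (\<langle>h \<parallel> v\<rangle>)" for A f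
      using that schur_space_invariant[OF symmetric.sl2_kernel_axioms invariant]
      by (simp add: bracket_def schur_module_def standard_module_def)
    moreover have "cfun.subspace (vecs (\<langle>h \<parallel> v\<rangle>))"
      by (simp add: bracket_def schur_module_def subspace_schur_space)
    moreover have "vecs (\<langle>h \<parallel> v\<rangle>) \<subseteq> space"
      using vecs_bracket_support[of _ h v] X by (auto simp: space_def)
    ultimately show ?thesis
      by (simp add: submodule_def)
  qed
  have fin: "finite {xs. f xs \<noteq> 0}" if "f \<in> vecs (\<langle>h \<parallel> v\<rangle>)" for f h v
    by (rule finite_subset[OF _ finite_box_support[of h v]])
      (use vecs_bracket_support[OF that] in auto)
  have "submodule (vecs (\<langle>h \<parallel> v\<rangle>))" "submodule (vecs (\<langle>h' \<parallel> v'\<rangle>))"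
    by (rule sub; simp add: X_def)+
  from module_iso_if_same_weights[OF this dim]
  obtain \<phi> where \<phi>: "module_iso \<phi> (vecs (\<langle>h \<parallel> v\<rangle>)) (vecs (\<langle>h' \<parallel> v'\<rangle>))"
    by blast
  have "\<phi> (act (\<langle>h \<parallel> v\<rangle>) A x) = act (\<langle>h' \<parallel> v'\<rangle>) A (\<phi> x)"
    if "A \<in> SL2" "x \<in> vecs (\<langle>h \<parallel> v\<rangle>)" for A x
  proof -
    have "\<phi> x \<in> vecs (\<langle>h' \<parallel> v'\<rangle>)"
      using \<phi> that by (auto simp: module_iso_def bij_betw_def)
    then show ?thesis
      using \<phi> that by (simp add: module_iso_def act_bracket[OF fin])
  qed
  then show ?thesis
    using \<phi> unfolding sl2_iso_def module_iso_def by blast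
qed

text \<open>The difference of the two sums, multiplied by a power of \<open>q\<close>, is a
  polynomial with infinitely many zeros, and its coefficients compare the multiplicities.\<close>

lemma weights_eq_if_characters_eq:
  fixes \<kappa> :: "'a \<Rightarrow> int" and \<kappa>' :: "'b \<Rightarrow> int"
  assumes fin: "finite A" "finite B"
    and eq: "\<And>q :: real. q > 1 \<Longrightarrow> (\<Sum>x\<in>A. q powi \<kappa> x) = (\<Sum>x\<in>B. q powi \<kappa>' x)"
  shows "card {x \<in> A. \<kappa> x = k} = card {x \<in> B. \<kappa>' x = k}"
proof -
  \<comment> \<open>\<open>k\<close> is included so that its shifted exponent is nonnegative even if
    no element has the weight \<open>k\<close>.\<close>
  define S where "S = insert k (\<kappa> ` A \<union> \<kappa>' ` B)"
  define m where "m = - Min S"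
  have "finite S"
    using fin by (simp add: S_def)
  then have nonneg: "0 \<le> j + m" if "j \<in> S" for j
    using Min_le[OF _ that] by (simp add: m_def)
  define P :: "real poly" where
    "P = (\<Sum>x\<in>A. monom 1 (nat (\<kappa> x + m))) - (\<Sum>x\<in>B. monom 1 (nat (\<kappa>' x + m)))"
  have shift: "q ^ nat (j + m) = q powi j * q powi m" if "q > 1" "j \<in> S" for q :: real and j
    using that nonneg[OF that(2)] power_int_of_nat[of q "nat (j + m)"]
    by (simp add: power_int_add[symmetric] del: power_int_of_nat)
  have root: "poly P q = 0" if q: "q > 1" for q
  proof -
    have "(\<Sum>x\<in>A. q ^ nat (\<kappa> x + m)) = (\<Sum>x\<in>A. q powi \<kappa> x) * q powi m"
      unfolding sum_distrib_right using q by (intro sum.cong refl shift) (auto simp: S_def)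
    moreover have "(\<Sum>x\<in>B. q ^ nat (\<kappa>' x + m)) = (\<Sum>x\<in>B. q powi \<kappa>' x) * q powi m"
      unfolding sum_distrib_right using q by (intro sum.cong refl shift) (auto simp: S_def)
    ultimately show ?thesis
      using eq[OF q] by (simp add: P_def poly_sum poly_monom)
  qed
  have "P = 0"
  proof (rule ccontr)
    assume "P \<noteq> 0"
    then have "finite {q. poly P q = 0}"
      by (rule poly_roots_finite)
    moreover have "{1 :: real<..} \<subseteq> {q. poly P q = 0}"
      using root by auto
    ultimately have "finite {1 :: real<..}"
      by (rule rev_finite_subset)
    then show False
      by (simp add: infinite_Ioi)
  qed
  have inj: "nat (j + m) = nat (k + m) \<longleftrightarrow> j = k" if "j \<in> S" for j
    using nonneg[OF that] nonneg[of k] by (auto simp: S_def nat_eq_iff)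
  have "coeff P (nat (k + m)) = 0"
    by (simp add: \<open>P = 0\<close>)
  then have "(\<Sum>x\<in>A. if \<kappa> x = k then 1 else 0) = (\<Sum>x\<in>B. if \<kappa>' x = k then 1 else (0 :: real))"
    using inj by (simp add: P_def coeff_sum S_def cong: sum.cong)
  then have "real (card {x \<in> A. \<kappa> x = k}) = real (card {x \<in> B. \<kappa>' x = k})"
    using fin by (simp add: sum.If_cases Int_def)
  then show ?thesis
    by simp
qed

section \<open>Characters and the words of brackets\<close>

context young_diagram
begin

lemma distinct_boxes: "distinct (boxes \<mu>)"
proof -
  have "k = k'" if "k < N" "k' < N" "boxes \<mu> ! k = boxes \<mu> ! k'" for k k'
    using box_inj[OF that(1,2)] that(3) by simp
  then show ?thesis
    by (auto simp: distinct_conv_nth)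
qed

text \<open>A passage between two encodings of tableaux: functions of row and column, from which the
  largest letter is easily removed, and lists in reading order, on which the symmetric group
  acts.\<close>

lemma schur_sum_semistandard_fillings:
  "schur_sum Q n (nth_or_zero \<mu>) = (\<Sum>T\<in>semistandard_fillings n. Q ^ (\<Sum>j\<leftarrow>T. n - 1 - j))"
proof -
  define \<alpha> where "\<alpha> = nth_or_zero \<mu>"
  define f where "f t = map (\<lambda>(i, j). t i j) (boxes \<mu>)" for t :: "nat \<Rightarrow> nat \<Rightarrow> nat"
  define g where "g T i j = (case map_of (zip (boxes \<mu>) T) (i, j) of Some x \<Rightarrow> x | None \<Rightarrow> 0)"
    for T :: "nat list" and i j
  have \<alpha>: "antimono \<alpha>"
  proof (rule decseq_SucI)
    show "\<alpha> (Suc i) \<le> \<alpha> i" for i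
      using decreasing by (auto simp: \<alpha>_def sorted_wrt_iff_nth_less)
  qed
  have box: "box_col k < \<alpha> (box_row k)" if "k < N" for k
    using box_bound[OF that] by (simp add: \<alpha>_def)
  have exists: "\<exists>k<N. box_row k = i \<and> box_col k = j" if "j < \<alpha> i" for i j
    using that box_exists[of i j] by (auto simp: \<alpha>_def split: if_splits)
  have col_mono: "k \<le> k' \<longleftrightarrow> box_col k \<le> box_col k'" if "k < N" "k' < N" "box_row k = box_row k'" for k k'
    using that boxes_less[of k k'] boxes_less[of k' k] by (cases k k' rule: linorder_cases) auto
  have f_nth: "f t ! k = t (box_row k) (box_col k)" if "k < N" for t k
    using that by (simp add: f_def case_prod_unfold)
  have g_nth: "g T (box_row k) (box_col k) = T ! k" if "k < N" "length T = N" for T k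
    using that distinct_boxes map_of_zip_nth[of "boxes \<mu>" T k] by (simp add: g_def)
  have g_zero: "g T i j = 0" if "\<alpha> i \<le> j" "length T = N" for T i j
  proof -
    have "(i, j) \<notin> set (boxes \<mu>)"
      using that(1) by (auto simp: set_boxes \<alpha>_def)
    then have "map_of (zip (boxes \<mu>) T) (i, j) = None"
      using that(2) by (simp add: map_of_zip_is_None)
    then show ?thesis
      by (simp add: g_def)
  qed
  show ?thesis
    unfolding schur_sum_def \<alpha>_def[symmetric]
  proof (rule sum.reindex_bij_witness[of _ g f])
    fix t assume t: "t \<in> semistandard n \<alpha>"
    have len: "length (f t) = N"
      by (simp add: f_def)
    show "g (f t) = t"
    proof (intro ext)
      fix i j
      show "g (f t) i j = t i j"
      proof (cases "j < \<alpha> i")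
        case True
        then obtain k where "k < N" "box_row k = i" "box_col k = j"
          using exists by blast
        then show ?thesis
          using g_nth[OF _ len, of k] f_nth[of k t] by simp
      next
        case False
        then show ?thesis
          using t g_zero[OF _ len, of i j] by (simp add: semistandard_def)
      qed
    qed
    show "f t \<in> semistandard_fillings n"
      unfolding semistandard_fillings_def
    proof (intro CollectI conjI allI impI len)
      have "f t ! k < n" if "k < N" for k
        using t box[OF that] by (simp add: f_nth[OF that] semistandard_def)
      then show "set (f t) \<subseteq> {..<n}"
        using len by (auto simp: in_set_conv_nth)
      show "f t ! k \<le> f t ! k'" if "k \<le> k'" "k' < N" "box_row k = box_row k'" for k k'
        using t col_mono[of k k'] that box[of k'] by (simp add: f_nth semistandard_def)
      show "f t ! k < f t ! k'" if "k < N" "k' < N" "box_col k = box_col k'" "box_row k' = Suc (box_row k)" for k k'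
        using t that box[of k'] by (simp add: f_nth semistandard_def)
    qed
    \<comment> \<open>Column strictness bounds the number of rows by \<open>n\<close>, so the sum
      over \<open>i < n\<close> in \<open>schur_sum\<close> covers all boxes.\<close>
    have zero: "\<alpha> i = 0" if "n \<le> i" for i
    proof (rule ccontr)
      assume "\<alpha> i \<noteq> 0"
      then have "i \<le> t i 0" "t i 0 < n"
        using semistandard_ge_row[OF t \<alpha>, of 0 i] t by (auto simp: semistandard_def)
      with that show False
        by simp
    qed
    have "(\<Sum>j\<leftarrow>f t. n - 1 - j) = (\<Sum>c\<leftarrow>boxes \<mu>. n - 1 - (case c of (i, j) \<Rightarrow> t i j))"
      by (simp add: f_def o_def)
    also have "\<dots> = (\<Sum>(i, j)\<in>set (boxes \<mu>). n - 1 - t i j)"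
      by (simp add: sum_list_distinct_conv_sum_set[OF distinct_boxes] case_prod_unfold)
    also have "set (boxes \<mu>) = Sigma {..<n} (\<lambda>i. {..<\<alpha> i})"
    proof -
      have "i < n" if "j < \<alpha> i" for i j
        using zero[of i] that by (cases "i < n") auto
      then show ?thesis
        by (auto simp: set_boxes \<alpha>_def split: if_splits)
    qed
    also have "(\<Sum>(i, j)\<in>\<dots>. n - 1 - t i j) = (\<Sum>i<n. \<Sum>j<\<alpha> i. n - 1 - t i j)"
      by (simp add: sum.Sigma)
    finally show "Q ^ (\<Sum>j\<leftarrow>f t. n - 1 - j) = Q ^ (\<Sum>i<n. \<Sum>j<\<alpha> i. n - 1 - t i j)"
      by simp
  next
    fix T assume T: "T \<in> semistandard_fillings n"
    then have len: "length T = N" and less: "\<And>k. k < N \<Longrightarrow> T ! k < n"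
      by (auto simp: semistandard_fillings_def subset_eq)
    show "f (g T) = T"
    proof (rule nth_equalityI)
      show "length (f (g T)) = length T"
        by (simp add: f_def len)
      then show "f (g T) ! k = T ! k" if "k < length (f (g T))" for k
        using that len by (simp add: f_nth g_nth)
    qed
    show "g T \<in> semistandard n \<alpha>"
      unfolding semistandard_def
    proof (intro CollectI conjI allI impI)
      show "g T i j < n" if "j < \<alpha> i" for i j
        using exists[OF that] g_nth[OF _ len] less by auto
      show "g T i j = 0" if "\<alpha> i \<le> j" for i j
        using g_zero[OF that len] .
      show "g T i j \<le> g T i j'" if jj: "j \<le> j'" "j' < \<alpha> i" for i j j'
      proof -
        obtain k k' where k: "k < N" "box_row k = i" "box_col k = j" "k' < N" "box_row k' = i" "box_col k' = j'"
          using exists[of j i] exists[of j' i] jj by auto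
        then have "k \<le> k'"
          using col_mono[of k k'] jj by simp
        then have "T ! k \<le> T ! k'"
          using T k by (auto simp: semistandard_fillings_def)
        then show ?thesis
          using g_nth[OF _ len, of k] g_nth[OF _ len, of k'] k by simp
      qed
      show "g T i j < g T (Suc i) j" if j: "j < \<alpha> (Suc i)" for i j
      proof -
        have "\<alpha> (Suc i) \<le> \<alpha> i"
          using \<alpha> by (simp add: antimonoD)
        then obtain k k' where k: "k < N" "box_row k = i" "box_col k = j" "k' < N" "box_row k' = Suc i" "box_col k' = j"
          using exists[of j i] exists[of j "Suc i"] j by auto
        then have "T ! k < T ! k'"
          using T by (auto simp: semistandard_fillings_def)
        then show ?thesis
          using g_nth[OF _ len, of k] g_nth[OF _ len, of k'] k by simp
      qed
    qed
  qed
qed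

end

fun interleave :: "'a list \<Rightarrow> 'a list \<Rightarrow> 'a list" where
  "interleave (b # bs) (a # as) = b # a # interleave bs as"
| "interleave bs [] = bs"
| "interleave [] as = as"

lemma interleave_replicate:
  "interleave (replicate k a @ bs) (replicate k b @ as) = alternating_word k a b @ interleave bs as"
  by (induction k) auto

lemma interleave_Cons_replicate:
  "interleave (x # replicate k a) (replicate k b) = x # alternating_word k b a"
  by (induction k arbitrary: x) auto

lemma bracket_partition_snoc:
  "bracket_partition (h @ [a]) (b # v) = replicate b (sum_list h + a) @ bracket_partition h v"
proof -
  have "bracket_partition (h @ [a]) (b # v) = replicate b (sum_list (h @ [a])) @
      concat (map (\<lambda>i. replicate (v ! i) (sum_list (take (length h - i) (h @ [a])))) [0..<length h])"
    unfolding bracket_partition_def length_append_singleton upt_conv_Cons[OF zero_less_Suc]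
      map_Suc_upt[symmetric] by (simp add: o_def)
  then show ?thesis
    by (simp add: bracket_partition_def)
qed

text \<open>The last block of the word has no gap below it and stands for \<open>last v\<close>
  parts 0, which \<open>bracket_partition\<close> omits. The word reads from the top part, which
  contains all of \<open>h\<close>, and every gap drops the last remaining letter; hence
  \<open>h\<close> is reversed.\<close>

lemma interleave_word:
  assumes "length v = Suc (length h)"
  shows "odd (length (interleave v (rev h)))"
    and "even_part (interleave v (rev h)) = sum_list v"
    and "sum_list (interleave v (rev h)) = sum_list h + sum_list v"
    and "parts_of_word (interleave v (rev h)) = bracket_partition h v @ replicate (last v) 0"
proof -
  have "odd (length (interleave v (rev h))) \<and> even_part (interleave v (rev h)) = sum_list v \<and>
    sum_list (interleave v (rev h)) = sum_list h + sum_list v \<and>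
    parts_of_word (interleave v (rev h)) = bracket_partition h v @ replicate (last v) 0"
    using assms
  proof (induction h arbitrary: v rule: rev_induct)
    case Nil
    then obtain b where "v = [b]"
      by (auto simp: length_Suc_conv)
    then show ?case
      by (simp add: bracket_partition_def)
  next
    case (snoc a h)
    then obtain b v' where v: "v = b # v'" "length v' = Suc (length h)"
      by (cases v) auto
    then have "v' \<noteq> []"
      by auto
    then show ?case
      using snoc.IH[OF v(2)] by (simp add: v bracket_partition_snoc add.commute)
  qed
  then show "odd (length (interleave v (rev h)))" "even_part (interleave v (rev h)) = sum_list v"
    "sum_list (interleave v (rev h)) = sum_list h + sum_list v"
    "parts_of_word (interleave v (rev h)) = bracket_partition h v @ replicate (last v) 0"
    by blast+
qed

lemma young_diagram_bracket: "length v = Suc (length h) \<Longrightarrow> young_diagram (bracket_partition h v)"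
  using sorted_parts_of_word[OF interleave_word(1)] interleave_word(4)
  by (simp add: young_diagram_def sorted_wrt_append)

text \<open>A letter \<open>j\<close> has the weight \<open>n - 1 - 2 * j\<close>, while
  \<open>schur_sum\<close> at \<open>q\<^sup>2\<close> counts it with
  \<open>2 * (n - 1 - j)\<close>. The difference of \<open>n - 1\<close> per box is the prefactor of
  \<open>schur_sum_word\<close>, so the character depends on the word invariant alone.\<close>

lemma bracket_character:
  fixes q :: real
  assumes q: "q > 1" and len: "length v = Suc (length h)" and pos: "sum_list v > 0"
  shows "(\<Sum>T\<in>young_diagram.semistandard_fillings (bracket_partition h v) (sum_list v).
      q powi (\<Sum>j\<leftarrow>T. int (sum_list v - 1) - 2 * int j)) =
    exp (word_invariant (double_sum (\<lambda>d. ln (q ^ d - 1 / q ^ d))) (interleave v (rev h)))"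
proof -
  define \<mu> where "\<mu> = bracket_partition h v"
  define n where "n = sum_list v"
  define g where "g = interleave v (rev h)"
  interpret young_diagram \<mu>
    unfolding \<mu>_def by (rule young_diagram_bracket[OF len])
  have g: "odd (length g)" "even_part g = n" "parts_of_word g = \<mu> @ replicate (last v) 0"
    using interleave_word[OF len] by (simp_all add: g_def n_def \<mu>_def)
  have "nth_or_zero (parts_of_word g) = nth_or_zero \<mu>"
    by (auto simp: g(3) fun_eq_iff nth_append)
  then have "(\<Sum>T\<in>semistandard_fillings n. (q\<^sup>2) ^ (\<Sum>j\<leftarrow>T. n - 1 - j)) =
      q ^ ((n - 1) * N) * exp (word_invariant (double_sum (\<lambda>d. ln (q ^ d - 1 / q ^ d))) g)"
    using schur_sum_word[OF q g(1)] schur_sum_semistandard_fillings[of "q\<^sup>2" n]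
    by (simp add: g(2,3) sum_list_replicate)
  moreover have "(q\<^sup>2) ^ (\<Sum>j\<leftarrow>T. n - 1 - j) =
      q ^ ((n - 1) * N) * q powi (\<Sum>j\<leftarrow>T. int (n - 1) - 2 * int j)"
    if T: "T \<in> semistandard_fillings n" for T
  proof -
    have T: "length T = N" "set T \<subseteq> {..<n}"
      using T by (auto simp: semistandard_fillings_def)
    have "2 * int (\<Sum>j\<leftarrow>T. n - 1 - j) = int (n - 1) * int (length T) + (\<Sum>j\<leftarrow>T. int (n - 1) - 2 * int j)"
      using T(2) by (induction T) (auto simp: algebra_simps of_nat_diff)
    then have "q powi (2 * int (\<Sum>j\<leftarrow>T. n - 1 - j)) =
        q powi (int ((n - 1) * N)) * q powi (\<Sum>j\<leftarrow>T. int (n - 1) - 2 * int j)"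
      using q T(1) by (simp add: power_int_add)
    moreover have "q powi (2 * int a) = (q\<^sup>2) ^ a" for a
      using power_int_of_nat[of q "2 * a"] by (simp add: power_mult)
    ultimately show ?thesis
      by (simp only: power_int_of_nat)
  qed
  ultimately have "q ^ ((n - 1) * N) * (\<Sum>T\<in>semistandard_fillings n. q powi (\<Sum>j\<leftarrow>T. int (n - 1) - 2 * int j)) =
      q ^ ((n - 1) * N) * exp (word_invariant (double_sum (\<lambda>d. ln (q ^ d - 1 / q ^ d))) g)"
    by (simp add: sum_distrib_left)
  then show ?thesis
    using q by (simp add: n_def \<mu>_def g_def)
qed

theorem bracket_iso:
  assumes len: "length v = Suc (length h)" "length v' = Suc (length h')"
    and pos: "sum_list v > 0" "sum_list v' > 0"
    and inv: "\<And>\<phi>. word_invariant \<phi> (interleave v (rev h)) = word_invariant \<phi> (interleave v' (rev h'))"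
  shows "\<langle>h \<parallel> v\<rangle> \<simeq>\<^sub>S\<^sub>L \<langle>h' \<parallel> v'\<rangle>"
proof (rule bracket_iso_if_same_weights)
  fix k
  have dim: "cfun.dim (vecs (\<langle>h \<parallel> v\<rangle>) \<inter> bracket.weight_space k) =
      card {T \<in> young_diagram.semistandard_fillings (bracket_partition h v) (sum_list v).
        (\<Sum>j\<leftarrow>T. int (sum_list v - 1) - 2 * int j) = k}"
    if "length v = Suc (length h)" "sum_list v > 0" for h v
    unfolding vecs_bracket[OF that(2)] bracket.weight_space_def
  proof (rule young_diagram.dim_weight_schur_space[OF young_diagram_bracket[OF that(1)]])
    show "monomial_tensor (sum_list v - 1) i (monomial_list (sum_list v - 1) j) = (if i = j then 1 else 0)"
      if "i < sum_list v" "j < sum_list v" for i j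
      using that by (auto simp: monomial_tensor_def monomial_list_shape)
    show "list_weight standard_weight y = int (sum_list v - 1) - 2 * int j"
      if "monomial_tensor (sum_list v - 1) j y \<noteq> 0" for j y
      using that by (auto simp: list_weight_standard monomial_tensor_def split: if_splits)
  qed
  have fin: "finite (young_diagram.semistandard_fillings (bracket_partition h v) (sum_list v))"
    if "length v = Suc (length h)" for h v
    using young_diagram.finite_semistandard_fillings[OF young_diagram_bracket[OF that]] .
  show "cfun.dim (vecs (\<langle>h \<parallel> v\<rangle>) \<inter> bracket.weight_space k) =
      cfun.dim (vecs (\<langle>h' \<parallel> v'\<rangle>) \<inter> bracket.weight_space k)"
    unfolding dim[OF len(1) pos(1)] dim[OF len(2) pos(2)]
    by (rule weights_eq_if_characters_eq[OF fin[OF len(1)] fin[OF len(2)]])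
      (simp only: bracket_character[OF _ len(1) pos(1)] bracket_character[OF _ len(2) pos(2)] inv)
qed

lemma all_isomorphic_brackets:
  assumes "\<And>h v. (h, v) \<in> set ps \<Longrightarrow> length v = Suc (length h) \<and> sum_list v > 0 \<and>
    (\<forall>\<phi>. word_invariant \<phi> (interleave v (rev h)) = word_invariant \<phi> g)"
  shows "all_isomorphic (map (\<lambda>(h, v). \<langle>h \<parallel> v\<rangle>) ps)"
  using assms unfolding all_isomorphic_def by (auto intro!: bracket_iso)

theorem theorem4p2:
  fixes v z u s :: nat
  assumes "v > 0" and "z > 0" and "u > 0"
  shows
    "all_isomorphic
       [\<langle>z\<up>s @ v\<up>(s+1) \<parallel> z\<up>(s+1) @ [u] @ v\<up>s\<rangle>,
        \<langle>z\<up>s @ [u] @ v\<up>s \<parallel> z\<up>(s+1) @ v\<up>(s+1)\<rangle>,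
        \<langle>z\<up>(s+1) @ v\<up>s \<parallel> z\<up>s @ [u] @ v\<up>(s+1)\<rangle>,
        \<langle>v\<up>s @ z\<up>(s+1) \<parallel> v\<up>(s+1) @ [u] @ z\<up>s\<rangle>,
        \<langle>v\<up>s @ [u] @ z\<up>s \<parallel> v\<up>(s+1) @ z\<up>(s+1)\<rangle>,
        \<langle>v\<up>(s+1) @ z\<up>s \<parallel> v\<up>s @ [u] @ z\<up>(s+1)\<rangle>] \<and>
     all_isomorphic
       [\<langle>z\<up>s @ [u] @ v\<up>(s+1) \<parallel> z\<up>(s+2) @ v\<up>(s+1)\<rangle>,
        \<langle>z\<up>(s+1) @ v\<up>(s+1) \<parallel> z\<up>(s+1) @ [u] @ v\<up>(s+1)\<rangle>,
        \<langle>z\<up>(s+1) @ [u] @ v\<up>s \<parallel> z\<up>(s+1) @ v\<up>(s+2)\<rangle>,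
        \<langle>v\<up>s @ [u] @ z\<up>(s+1) \<parallel> v\<up>(s+2) @ z\<up>(s+1)\<rangle>,
        \<langle>v\<up>(s+1) @ z\<up>(s+1) \<parallel> v\<up>(s+1) @ [u] @ z\<up>(s+1)\<rangle>,
        \<langle>v\<up>(s+1) @ [u] @ z\<up>s \<parallel> v\<up>(s+1) @ z\<up>(s+2)\<rangle>]"
proof -
  \<comment> \<open>\<open>interleave_replicate\<close> consumes constant prefixes of equal length,
    so surplus copies have to be split off.\<close>
  have snoc: "a\<up>(s+1) @ xs = a\<up>s @ a # xs" and snoc2: "a\<up>(s+2) @ xs = a\<up>(s+1) @ a # xs"
    and Cons2: "a\<up>(s+2) = a # a\<up>(s+1)" for a :: nat and xs
    by (simp_all add: replicate_app_Cons_same)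
  \<comment> \<open>Stated for arbitrary \<open>a\<close> and \<open>b\<close>: the first three
    brackets are the case \<open>a = z\<close>, \<open>b = v\<close>, the last three the case
    \<open>a = v\<close>, \<open>b = z\<close>.\<close>
  have insert_odd: "interleave (a\<up>(s+1) @ [u] @ b\<up>s) (rev (a\<up>s @ b\<up>(s+1))) =
      alternating_word (Suc s) a b @ u # alternating_word s a b"
    "interleave (a\<up>(s+1) @ b\<up>(s+1)) (rev (a\<up>s @ [u] @ b\<up>s)) =
      alternating_word s a b @ a # u # b # alternating_word s a b"
    "interleave (a\<up>s @ [u] @ b\<up>(s+1)) (rev (a\<up>(s+1) @ b\<up>s)) =
      alternating_word s a b @ u # alternating_word (Suc s) a b" for a b
  proof -
    have "interleave (a\<up>(s+1) @ (u # b\<up>s)) (b\<up>(s+1) @ a\<up>s) =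
        alternating_word (s+1) a b @ u # alternating_word s a b"
      unfolding interleave_replicate interleave_Cons_replicate ..
    then show "interleave (a\<up>(s+1) @ [u] @ b\<up>s) (rev (a\<up>s @ b\<up>(s+1))) =
        alternating_word (Suc s) a b @ u # alternating_word s a b"
      by (simp only: rev_append rev_replicate rev.simps append.simps append_assoc Suc_eq_plus1)
    have "interleave (a\<up>s @ (a # b\<up>(s+1))) (b\<up>s @ (u # a\<up>s)) =
        alternating_word s a b @ a # u # b # alternating_word s a b"
      unfolding interleave_replicate by (simp add: interleave_Cons_replicate)
    then show "interleave (a\<up>(s+1) @ b\<up>(s+1)) (rev (a\<up>s @ [u] @ b\<up>s)) =
        alternating_word s a b @ a # u # b # alternating_word s a b"
      by (simp only: rev_append rev_replicate rev.simps append.simps append_assoc Suc_eq_plus1 snoc)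
    have "interleave (a\<up>s @ (u # b\<up>(s+1))) (b\<up>s @ a\<up>(s+1)) =
        alternating_word s a b @ u # alternating_word (s+1) a b"
      unfolding interleave_replicate interleave_Cons_replicate ..
    then show "interleave (a\<up>s @ [u] @ b\<up>(s+1)) (rev (a\<up>(s+1) @ b\<up>s)) =
        alternating_word s a b @ u # alternating_word (Suc s) a b"
      by (simp only: rev_append rev_replicate rev.simps append.simps append_assoc Suc_eq_plus1)
  qed
  have insert_even: "interleave (a\<up>(s+2) @ b\<up>(s+1)) (rev (a\<up>s @ [u] @ b\<up>(s+1))) =
      alternating_word (Suc s) a b @ a # u # b # alternating_word s a b"
    "interleave (a\<up>(s+1) @ [u] @ b\<up>(s+1)) (rev (a\<up>(s+1) @ b\<up>(s+1))) =
      alternating_word (Suc s) a b @ u # alternating_word (Suc s) a b"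
    "interleave (a\<up>(s+1) @ b\<up>(s+2)) (rev (a\<up>(s+1) @ [u] @ b\<up>s)) =
      alternating_word s a b @ a # u # b # alternating_word (Suc s) a b" for a b
  proof -
    have "interleave (a\<up>(s+1) @ (a # b\<up>(s+1))) (b\<up>(s+1) @ (u # a\<up>s)) =
        alternating_word (s+1) a b @ a # u # b # alternating_word s a b"
      unfolding interleave_replicate by (simp add: interleave_Cons_replicate)
    then show "interleave (a\<up>(s+2) @ b\<up>(s+1)) (rev (a\<up>s @ [u] @ b\<up>(s+1))) =
        alternating_word (Suc s) a b @ a # u # b # alternating_word s a b"
      by (simp only: rev_append rev_replicate rev.simps append.simps append_assoc Suc_eq_plus1 snoc snoc2)
    have "interleave (a\<up>(s+1) @ (u # b\<up>(s+1))) (b\<up>(s+1) @ a\<up>(s+1)) =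
        alternating_word (s+1) a b @ u # alternating_word (s+1) a b"
      unfolding interleave_replicate interleave_Cons_replicate ..
    then show "interleave (a\<up>(s+1) @ [u] @ b\<up>(s+1)) (rev (a\<up>(s+1) @ b\<up>(s+1))) =
        alternating_word (Suc s) a b @ u # alternating_word (Suc s) a b"
      by (simp only: rev_append rev_replicate rev.simps append.simps append_assoc Suc_eq_plus1)
    have "interleave (a\<up>s @ (a # b # b\<up>(s+1))) (b\<up>s @ (u # a\<up>(s+1))) =
        alternating_word s a b @ a # u # b # alternating_word (s+1) a b"
      unfolding interleave_replicate by (simp only: interleave.simps interleave_Cons_replicate)
    then show "interleave (a\<up>(s+1) @ b\<up>(s+2)) (rev (a\<up>(s+1) @ [u] @ b\<up>s)) =
        alternating_word s a b @ a # u # b # alternating_word (Suc s) a b"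
      unfolding rev_append rev_replicate rev.simps append.simps append_assoc
      by (simp only: Suc_eq_plus1 snoc Cons2 append.simps)
  qed
  have I: "all_isomorphic (map (\<lambda>(h, v). \<langle>h \<parallel> v\<rangle>)
      [(z\<up>s @ v\<up>(s+1), z\<up>(s+1) @ [u] @ v\<up>s), (z\<up>s @ [u] @ v\<up>s, z\<up>(s+1) @ v\<up>(s+1)),
       (z\<up>(s+1) @ v\<up>s, z\<up>s @ [u] @ v\<up>(s+1)), (v\<up>s @ z\<up>(s+1), v\<up>(s+1) @ [u] @ z\<up>s),
       (v\<up>s @ [u] @ z\<up>s, v\<up>(s+1) @ z\<up>(s+1)), (v\<up>(s+1) @ z\<up>s, v\<up>s @ [u] @ z\<up>(s+1))])"
    (is "all_isomorphic (map _ ?ps)")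
  proof (rule all_isomorphic_brackets)
    fix h w assume hw: "(h, w) \<in> set ?ps"
    then have "length w = Suc (length h) \<and> sum_list w > 0"
      using assms by (auto simp: sum_list_replicate)
    moreover have "word_invariant \<phi> (interleave w (rev h)) =
        word_invariant \<phi> (alternating_word (Suc s) z v @ u # alternating_word s z v)" for \<phi>
      using hw by (intro word_invariant_eq_I) (auto simp only: list.set insert_odd prod.inject)
    ultimately show "length w = Suc (length h) \<and> sum_list w > 0 \<and> (\<forall>\<phi>. word_invariant \<phi> (interleave w (rev h)) =
        word_invariant \<phi> (alternating_word (Suc s) z v @ u # alternating_word s z v))"
      by blast
  qed
  have II: "all_isomorphic (map (\<lambda>(h, v). \<langle>h \<parallel> v\<rangle>)
      [(z\<up>s @ [u] @ v\<up>(s+1), z\<up>(s+2) @ v\<up>(s+1)), (z\<up>(s+1) @ v\<up>(s+1), z\<up>(s+1) @ [u] @ v\<up>(s+1)),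
       (z\<up>(s+1) @ [u] @ v\<up>s, z\<up>(s+1) @ v\<up>(s+2)), (v\<up>s @ [u] @ z\<up>(s+1), v\<up>(s+2) @ z\<up>(s+1)),
       (v\<up>(s+1) @ z\<up>(s+1), v\<up>(s+1) @ [u] @ z\<up>(s+1)), (v\<up>(s+1) @ [u] @ z\<up>s, v\<up>(s+1) @ z\<up>(s+2))])"
    (is "all_isomorphic (map _ ?ps)")
  proof (rule all_isomorphic_brackets)
    fix h w assume hw: "(h, w) \<in> set ?ps"
    then have "length w = Suc (length h) \<and> sum_list w > 0"
      using assms by (auto simp: sum_list_replicate)
    moreover have "word_invariant \<phi> (interleave w (rev h)) =
        word_invariant \<phi> (alternating_word (Suc s) z v @ u # alternating_word (Suc s) z v)" for \<phi>
      using hw by (intro word_invariant_eq_II) (auto simp only: list.set insert_even prod.inject)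
    ultimately show "length w = Suc (length h) \<and> sum_list w > 0 \<and> (\<forall>\<phi>. word_invariant \<phi> (interleave w (rev h)) =
        word_invariant \<phi> (alternating_word (Suc s) z v @ u # alternating_word (Suc s) z v))"
      by blast
  qed
  show ?thesis
    using I II by (simp only: list.map prod.case)
qed

end
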